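(* For every $k\ge1$: $\rho_k(t)\le\rho_{k-1}(t)$ for every $t\ge0$, with strict inequality whenever $\rho_{k-1}(t)>0$. Furthermore, $\sigma_k\ge\sigma_{k-1}+1$.
   Context: Model: vertex set $[n]$. For each unordered pair of distinct vertices, edges arrive at the points of a Poisson process of rate $1/n$ on $(0,\infty)$, independently over pairs. $G_1(t)$ is the multigraph of edges arrived by time $t$; recursively, $F_k(t)$ is the subgraph of $G_k(t)$ of those edges which at their arrival time $s\le t$ joined two different components of $G_k(s)$, and $G_{k+1}(t):=G_k(t)\setminus F_k(t)$. $C_1(G)$ is the number of vertices in the largest component of $G$. For $k\ge1$, $\rho_k:[0,\infty)\to[0,1]$ is the continuous increasing function with $C_1(G_k(t))/n\to\rho_k(t)$ in probability uniformly in $t$, and $\sigma_k>0$ is the threshold such that $\rho_k(t)=0$ for $t\le\sigma_k$ and $\rho_k(t)>0$ for $t>\sigma_k$ (existence of both is a result of the same paper). Conventions: $\rho_0(t):=1$ for all $t\ge0$ and $\sigma_0:=0$. *)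

theory Defs
  imports "HOL-Probability.Probability" "HOL-Library.Nat_Bijection"
begin

type_synonym edge = "nat \<times> nat \<times> nat"   (* (u, v, j): j-th arrival on pair {u,v}, u < v *)
type_synonym sample = "edge \<Rightarrow> real"

text \<open>Underlying probability space: i.i.d. Exp(1) variables indexed by (u,v,j).
  For the graph on vertex set {0..<n} the inter-arrival times on the pair {u,v}
  are n times these, i.e. Exp(1/n): a Poisson process of rate 1/n.\<close>
definition Omega :: "sample measure" where
  "Omega = PiM UNIV (\<lambda>_. density lborel (exponential_density 1))"

definition arrival :: "nat \<Rightarrow> sample \<Rightarrow> edge \<Rightarrow> real" where
  "arrival n \<omega> x = real n * (\<Sum>i\<le>snd (snd x). \<omega> (fst x, fst (snd x), i))"

text \<open>Edges of the multigraph G_1(t) on vertex set {0..<n}.\<close>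
definition edges_upto :: "nat \<Rightarrow> sample \<Rightarrow> real \<Rightarrow> edge set" where
  "edges_upto n \<omega> t = {x. fst x < fst (snd x) \<and> fst (snd x) < n \<and> arrival n \<omega> x \<le> t}"

text \<open>Graph relation (symmetric) of those labelled edges whose label is at least k.\<close>
definition level_rel :: "(edge \<times> nat) list \<Rightarrow> nat \<Rightarrow> (nat \<times> nat) set" where
  "level_rel L k = {(a, b). \<exists>x l. (x, l) \<in> set L \<and> k \<le> l \<and>
       ((a, b) = (fst x, fst (snd x)) \<or> (b, a) = (fst x, fst (snd x)))}"

text \<open>Level of a new edge given the (labelled) earlier edges: the edge lies in F_k
  for the least k \<ge> 1 such that its endpoints are in different components of
  G_k just before its arrival (G_k = earlier edges of level \<ge> k).\<close>
definition new_level :: "(edge \<times> nat) list \<Rightarrow> edge \<Rightarrow> nat" where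
  "new_level L x = (LEAST k. 1 \<le> k \<and> (fst x, fst (snd x)) \<notin> (level_rel L k)\<^sup>*)"

definition add_edge :: "(edge \<times> nat) list \<Rightarrow> edge \<Rightarrow> (edge \<times> nat) list" where
  "add_edge L x = L @ [(x, new_level L x)]"

text \<open>Injective coding of edges as natural numbers (only used to list a finite edge set).\<close>
definition edge_code :: "edge \<Rightarrow> nat" where
  "edge_code x = prod_encode (fst x, prod_encode (snd x))"

definition edge_decode :: "nat \<Rightarrow> edge" where
  "edge_decode m = (fst (prod_decode m), prod_decode (snd (prod_decode m)))"

text \<open>All edges arrived by time t, processed in order of arrival, with their levels.\<close>
definition labelled_edges :: "nat \<Rightarrow> sample \<Rightarrow> real \<Rightarrow> (edge \<times> nat) list" where
  "labelled_edges n \<omega> t =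
     foldl add_edge [] (sort_key (arrival n \<omega>) (map edge_decode (sorted_list_of_set (edge_code ` edges_upto n \<omega> t))))"

text \<open>Edge relation of G_k(t).\<close>
definition G_rel :: "nat \<Rightarrow> sample \<Rightarrow> real \<Rightarrow> nat \<Rightarrow> (nat \<times> nat) set" where
  "G_rel n \<omega> t k = level_rel (labelled_edges n \<omega> t) k"

text \<open>Number of vertices of the largest component of the graph on {0..<n} with edge relation R.\<close>
definition C1 :: "nat \<Rightarrow> (nat \<times> nat) set \<Rightarrow> nat" where
  "C1 n R = Max ((\<lambda>v. card {w. w < n \<and> (v, w) \<in> R\<^sup>*}) ` {..<n})"

text \<open>C_1(G_k(t))/n \<longrightarrow> f(t) in probability, uniformly in t \<ge> 0 (outer-probability form).\<close>
definition conv_unif_prob :: "nat \<Rightarrow> (real \<Rightarrow> real) \<Rightarrow> bool" where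
  "conv_unif_prob k f \<longleftrightarrow>
     (\<forall>\<epsilon>>0. \<forall>\<delta>>0. \<exists>N. \<forall>n\<ge>N. \<exists>A\<in>sets Omega. measure Omega A < \<delta> \<and>
        {\<omega>\<in>space Omega. \<exists>t\<ge>0. \<bar>real (C1 n (G_rel n \<omega> t k)) / real n - f t\<bar> > \<epsilon>} \<subseteq> A)"

end

theory Submission
  imports Defs "HOL-Library.Transitive_Closure_Table"
begin

text \<open>
  An edge crossing between two vertex sets that are connected in \<open>G\<^sub>k\<close> joins them in the level
  that it receives, so consecutive crossing edges receive strictly increasing levels until the sets
  are joined in \<open>G\<^sub>k\<close>; on the other hand a vertex of degree \<open>d\<close> in \<open>G\<^sub>1\<close> is isolated in \<open>G\<^sub>j\<close> for
  \<open>j > d\<close>.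

  Strictness: let \<open>s < t\<close> with \<open>\<rho>\<^sub>k(s) > 0\<close>. With probability bounded below, a vertex has exactly \<open>k\<close>
  edges at time \<open>t\<close>, all of them arriving after \<open>s\<close> and leading to the giant component of \<open>G\<^sub>k(s)\<close>.
  Such a vertex is isolated in \<open>G\<^sub>k\<^sub>+\<^sub>1(t)\<close> but belongs to the giant component of \<open>G\<^sub>k(t)\<close>. The latter
  needs uniqueness of the giant: two components of linear size at time \<open>t\<close> merge before any later
  time \<open>t'\<close> (only boundedly many edges can arrive between vertices of components that stay apart, so
  the expected number of such pairs of vertices is \<open>O(n)\<close>, not quadratic), which would make \<open>\<rho>\<^sub>k\<close>
  jump at \<open>t\<close>.

  Thresholds: put \<open>a = \<sigma>\<^sub>k\<close> and \<open>t < a + 1\<close>. At time \<open>a\<close> all components of \<open>G\<^sub>k\<close> are sublinear, so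
  only \<open>o(n)\<close> edges of \<open>G\<^sub>k\<^sub>+\<^sub>1\<close> have arrived. The later edges form a subcritical random graph with
  mean degree below \<open>t - a < 1\<close>, and adding \<open>o(n)\<close> arbitrary edges to it creates no linear component.

  Independence enters by resampling: the process without a given pair (or vertex) is independent of
  the clocks of that pair (or vertex).
\<close>

subsection \<open>Counting random events\<close>

context prob_space
begin

lemma
  assumes "finite I" and [measurable]: "\<And>i. i \<in> I \<Longrightarrow> Measurable.pred M (Q i)"
  shows integrable_card: "integrable M (\<lambda>\<omega>. real (card {i \<in> I. Q i \<omega>}))"
    and expectation_card: "expectation (\<lambda>\<omega>. real (card {i \<in> I. Q i \<omega>})) = (\<Sum>i\<in>I. \<P>(\<omega> in M. Q i \<omega>))"
proof -
  have card: "real (card {i \<in> I. Q i \<omega>}) = (\<Sum>i\<in>I. indicator {\<omega> \<in> space M. Q i \<omega>} \<omega>)"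
    if "\<omega> \<in> space M" for \<omega>
    using assms(1) that by (simp add: indicator_def sum.If_cases Int_def)
  have indicator: "integrable M (indicator {\<omega> \<in> space M. Q i \<omega>} :: 'a \<Rightarrow> real)" if "i \<in> I" for i
    using that by (intro integrable_real_indicator) (auto simp: emeasure_eq_measure)
  show "integrable M (\<lambda>\<omega>. real (card {i \<in> I. Q i \<omega>}))"
    using indicator by (subst Bochner_Integration.integrable_cong[OF refl card]) auto
  show "expectation (\<lambda>\<omega>. real (card {i \<in> I. Q i \<omega>})) = (\<Sum>i\<in>I. \<P>(\<omega> in M. Q i \<omega>))"
    using indicator
    by (subst Bochner_Integration.integral_cong[OF refl card]) (auto simp: Int_absorb1)
qed

lemma sum_prob_le_if_card_le:
  assumes "finite I" "\<And>i. i \<in> I \<Longrightarrow> Measurable.pred M (Q i)"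
    and "AE \<omega> in M. real (card {i \<in> I. Q i \<omega>}) \<le> c"
  shows "(\<Sum>i\<in>I. \<P>(\<omega> in M. Q i \<omega>)) \<le> c"
proof -
  have "expectation (\<lambda>\<omega>. real (card {i \<in> I. Q i \<omega>})) \<le> expectation (\<lambda>\<omega>. c)"
    using assms by (intro integral_mono_AE integrable_card) auto
  then show ?thesis
    using assms by (simp add: expectation_card prob_space)
qed

lemma sum_prob_mono:
  assumes "finite I" "\<And>i. i \<in> I \<Longrightarrow> Measurable.pred M (Q i)"
    and "finite J" "\<And>j. j \<in> J \<Longrightarrow> Measurable.pred M (Q' j)"
    and "AE \<omega> in M. card {i \<in> I. Q i \<omega>} \<le> card {j \<in> J. Q' j \<omega>}"
  shows "(\<Sum>i\<in>I. \<P>(\<omega> in M. Q i \<omega>)) \<le> (\<Sum>j\<in>J. \<P>(\<omega> in M. Q' j \<omega>))"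
proof -
  have "expectation (\<lambda>\<omega>. real (card {i \<in> I. Q i \<omega>})) \<le>
      expectation (\<lambda>\<omega>. real (card {j \<in> J. Q' j \<omega>}))"
    using assms by (intro integral_mono_AE integrable_card) auto
  then show ?thesis
    using assms by (simp add: expectation_card)
qed

lemma prob_card_ge_le:
  assumes "finite I" "\<And>i. i \<in> I \<Longrightarrow> Measurable.pred M (Q i)" "0 < c"
  shows "\<P>(\<omega> in M. c \<le> real (card {i \<in> I. Q i \<omega>})) \<le> (\<Sum>i\<in>I. \<P>(\<omega> in M. Q i \<omega>)) / c"
  using integral_Markov_inequality_measure
    [where A = "{}", OF integrable_card[OF assms(1,2)] _ _ assms(3)]
  by (simp add: expectation_card[OF assms(1,2)])

lemma pred_card_ge [measurable (raw)]:
  assumes "finite I" "\<And>i. i \<in> I \<Longrightarrow> Measurable.pred M (Q i)"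
  shows "Measurable.pred M (\<lambda>\<omega>. c \<le> real (card {i \<in> I. Q i \<omega>}))"
  using borel_measurable_integrable[OF integrable_card[OF assms]] by measurable

lemma prob_card_ge_half:
  assumes fin: "finite I" "I \<noteq> {}" and Q: "\<And>i. i \<in> I \<Longrightarrow> Measurable.pred M (Q i)"
    and c: "0 \<le> c" "\<And>i. i \<in> I \<Longrightarrow> c \<le> \<P>(\<omega> in M. Q i \<omega>)"
  shows "c / 2 \<le> \<P>(\<omega> in M. c / 2 * real (card I) \<le> real (card {i \<in> I. Q i \<omega>}))"
proof -
  define m where "m = real (card I)"
  define E where "E = {\<omega> \<in> space M. c / 2 * m \<le> real (card {i \<in> I. Q i \<omega>})}"
  have m: "0 < m"
    using fin by (simp add: m_def card_gt_0_iff)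
  have E [measurable]: "E \<in> events"
    unfolding E_def using pred_card_ge[OF fin(1) Q] by measurable
  have "real (card {i \<in> I. Q i \<omega>}) \<le> m * indicator E \<omega> + c / 2 * m" if "\<omega> \<in> space M" for \<omega>
  proof -
    have "card {i \<in> I. Q i \<omega>} \<le> card I"
      using fin(1) by (intro card_mono) auto
    moreover have "0 \<le> c / 2 * m"
      using c(1) m by simp
    ultimately show ?thesis
      using that by (auto simp: E_def m_def indicator_def not_le)
  qed
  then have "expectation (\<lambda>\<omega>. real (card {i \<in> I. Q i \<omega>})) \<le>
      expectation (\<lambda>\<omega>. m * indicator E \<omega> + c / 2 * m)"
    using integrable_card[OF fin(1) Q]
    by (intro integral_mono) (auto intro!: integrable_real_indicator simp: emeasure_eq_measure)
  also have "\<dots> = m * prob E + c / 2 * m"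
    by (subst Bochner_Integration.integral_add)
       (auto intro!: integrable_real_indicator simp: emeasure_eq_measure prob_space)
  finally have "(\<Sum>i\<in>I. \<P>(\<omega> in M. Q i \<omega>)) \<le> m * prob E + c / 2 * m"
    by (simp add: expectation_card[OF fin(1) Q])
  moreover have "c * m \<le> (\<Sum>i\<in>I. \<P>(\<omega> in M. Q i \<omega>))"
    using sum_mono[of I "\<lambda>_. c" "\<lambda>i. \<P>(\<omega> in M. Q i \<omega>)"] c(2) by (simp add: m_def mult.commute)
  ultimately have "m * (c / 2) \<le> m * prob E"
    by (simp add: algebra_simps)
  then show ?thesis
    using m by (simp add: E_def m_def)
qed

lemma prob_Bex_disjoint:
  assumes "finite I" and [measurable]: "\<And>i. i \<in> I \<Longrightarrow> Measurable.pred M (Q i)"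
    and "\<And>i j \<omega>. i \<in> I \<Longrightarrow> j \<in> I \<Longrightarrow> Q i \<omega> \<Longrightarrow> Q j \<omega> \<Longrightarrow> i = j"
  shows "\<P>(\<omega> in M. \<exists>i\<in>I. Q i \<omega>) = (\<Sum>i\<in>I. \<P>(\<omega> in M. Q i \<omega>))"
proof -
  have "{\<omega> \<in> space M. \<exists>i\<in>I. Q i \<omega>} = (\<Union>i\<in>I. {\<omega> \<in> space M. Q i \<omega>})"
    by auto
  also have "prob \<dots> = (\<Sum>i\<in>I. \<P>(\<omega> in M. Q i \<omega>))"
    using assms by (intro finite_measure_finite_Union) (auto simp: disjoint_family_on_def)
  finally show ?thesis .
qed

lemma prob_disj_le:
  assumes [measurable]: "Measurable.pred M Q" "Measurable.pred M Q'"
  shows "\<P>(\<omega> in M. Q \<omega> \<or> Q' \<omega>) \<le> \<P>(\<omega> in M. Q \<omega>) + \<P>(\<omega> in M. Q' \<omega>)"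
proof -
  have "{\<omega> \<in> space M. Q \<omega> \<or> Q' \<omega>} = {\<omega> \<in> space M. Q \<omega>} \<union> {\<omega> \<in> space M. Q' \<omega>}"
    by auto
  then show ?thesis
    by (simp add: measure_Un_le)
qed

lemma prob_mono_AE:
  assumes [measurable]: "Measurable.pred M Q'" and "AE \<omega> in M. Q \<omega> \<longrightarrow> Q' \<omega>"
  shows "\<P>(\<omega> in M. Q \<omega>) \<le> \<P>(\<omega> in M. Q' \<omega>)"
  using assms(2) by (intro finite_measure_mono_AE) auto

end

lemma pred_finite_random_subset:
  assumes "finite I" and [measurable]: "\<And>i. i \<in> I \<Longrightarrow> Measurable.pred M (Q i)"
  shows "Measurable.pred M (\<lambda>\<omega>. F {i \<in> I. Q i \<omega>})"
proof -
  have "F {i \<in> I. Q i \<omega>} \<longleftrightarrow> (\<exists>S\<in>{S \<in> Pow I. F S}. \<forall>i\<in>I. Q i \<omega> \<longleftrightarrow> i \<in> S)" for \<omega>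
  proof
    assume "F {i \<in> I. Q i \<omega>}"
    then show "\<exists>S\<in>{S \<in> Pow I. F S}. \<forall>i\<in>I. Q i \<omega> \<longleftrightarrow> i \<in> S"
      by (intro bexI[of _ "{i \<in> I. Q i \<omega>}"]) auto
  next
    assume "\<exists>S\<in>{S \<in> Pow I. F S}. \<forall>i\<in>I. Q i \<omega> \<longleftrightarrow> i \<in> S"
    then obtain S where "F S" "S \<subseteq> I" "\<forall>i\<in>I. Q i \<omega> \<longleftrightarrow> i \<in> S"
      by blast
    moreover from this have "{i \<in> I. Q i \<omega>} = S"
      by blast
    ultimately show "F {i \<in> I. Q i \<omega>}"
      by simp
  qed
  then show ?thesis
    using assms(1) by (simp only:) (intro pred_intros_finite; simp)
qed

subsection \<open>Components of finite graphs\<close>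

lemma rtrancl_sym: "sym R \<Longrightarrow> (a, b) \<in> R\<^sup>* \<Longrightarrow> (b, a) \<in> R\<^sup>*"
  by (meson sym_rtrancl symE)

lemma isolated_rtrancl: "R `` {v} = {} \<Longrightarrow> (v, w) \<in> R\<^sup>* \<Longrightarrow> w = v"
  by (erule converse_rtranclE) auto

definition pairs :: "nat \<Rightarrow> (nat \<times> nat) set" where
  "pairs n = {(u, v). u < v \<and> v < n}"

lemma pairs_subset: "pairs n \<subseteq> {..<n} \<times> {..<n}"
  by (auto simp: pairs_def)

lemma finite_pairs [simp]: "finite (pairs n)"
  using finite_subset[OF pairs_subset] by blast

lemma card_pairs_le: "real (card (pairs n)) \<le> (real n)\<^sup>2"
  using card_mono[OF _ pairs_subset, of n] of_nat_mono[of "card (pairs n)" "n * n"]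
  by (simp add: card_cartesian_product power2_eq_square)

definition pair_of :: "nat \<Rightarrow> nat \<Rightarrow> nat \<times> nat" where
  "pair_of v w = (min v w, max v w)"

lemma pair_of_commute: "pair_of v w = pair_of w v"
  by (simp add: pair_of_def min.commute max.commute)

lemma pair_of_eq_iff: "pair_of v w = pair_of v' w' \<longleftrightarrow> {v, w} = {v', w'}"
  by (auto simp: pair_of_def min_def max_def doubleton_eq_iff)

lemma inj_pair_of: "inj (pair_of v)"
  by (auto simp: inj_def pair_of_eq_iff doubleton_eq_iff)

lemma pair_of_in_pairs: "v < n \<Longrightarrow> w < n \<Longrightarrow> v \<noteq> w \<Longrightarrow> pair_of v w \<in> pairs n"
  by (auto simp: pair_of_def pairs_def)

definition component :: "nat \<Rightarrow> (nat \<times> nat) set \<Rightarrow> nat \<Rightarrow> nat set" where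
  "component n R v = {w. w < n \<and> (v, w) \<in> R\<^sup>*}"

lemma component_subset: "component n R v \<subseteq> {..<n}"
  by (auto simp: component_def)

lemma finite_component [simp]: "finite (component n R v)"
  by (simp add: component_def)

lemma component_mono: "R \<subseteq> S \<Longrightarrow> component n R v \<subseteq> component n S v"
  using rtrancl_mono by (auto simp: component_def)

lemma component_eq: "sym R \<Longrightarrow> (v, w) \<in> R\<^sup>* \<Longrightarrow> component n R v = component n R w"
  by (auto simp: component_def intro: rtrancl_trans dest: rtrancl_sym)

lemma component_eq_imp_rtrancl: "component n R v = component n R w \<Longrightarrow> w < n \<Longrightarrow> (v, w) \<in> R\<^sup>*"
  by (auto simp: component_def)

lemma component_disjoint:
  assumes "sym R" "(v, w) \<notin> R\<^sup>*"
  shows "component n R v \<inter> component n R w = {}"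
proof -
  have "(v, x) \<notin> R\<^sup>* \<or> (w, x) \<notin> R\<^sup>*" for x
    using assms(2) rtrancl_sym[OF assms(1), of w x] rtrancl_trans[of v x R w] by blast
  then show ?thesis
    by (auto simp: component_def)
qed

lemma card_component_le_C1: "v < n \<Longrightarrow> card (component n R v) \<le> C1 n R"
  by (simp add: C1_def component_def)

lemma C1_attained:
  assumes "0 < n"
  obtains v where "v < n" "card (component n R v) = C1 n R"
proof -
  have "C1 n R \<in> (\<lambda>v. card (component n R v)) ` {..<n}"
    unfolding C1_def component_def using assms by (intro Max_in) auto
  then show thesis
    using that by auto
qed

lemma C1_mono:
  assumes "R \<subseteq> S" "0 < n"
  shows "C1 n R \<le> C1 n S"
proof -
  obtain v where v: "v < n" "card (component n R v) = C1 n R"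
    using C1_attained[OF assms(2)] .
  have "card (component n R v) \<le> card (component n S v)"
    using component_mono[OF assms(1)] by (intro card_mono) auto
  then show ?thesis
    using v card_component_le_C1[of v n S] by simp
qed

lemma card_rtrancl_pairs: "card {p \<in> {..<n} \<times> {..<n}. p \<in> R\<^sup>*} = (\<Sum>v<n. card (component n R v))"
proof -
  have "{p \<in> {..<n} \<times> {..<n}. p \<in> R\<^sup>*} = (SIGMA v:{..<n}. component n R v)"
    by (auto simp: component_def)
  then show ?thesis
    by simp
qed

lemma card_rtrancl_pairs_le: "card {p \<in> pairs n. p \<in> R\<^sup>*} \<le> n * C1 n R"
proof -
  have "card {p \<in> pairs n. p \<in> R\<^sup>*} \<le> card {p \<in> {..<n} \<times> {..<n}. p \<in> R\<^sup>*}"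
    using pairs_subset by (intro card_mono) auto
  also have "\<dots> \<le> (\<Sum>v<n. C1 n R)"
    unfolding card_rtrancl_pairs by (intro sum_mono card_component_le_C1) simp
  finally show ?thesis
    by simp
qed

lemma C1_add_isolated_le:
  assumes R: "sym R" and v: "v < n" "card (component n R v) = C1 n R" "component n R v \<subseteq> D"
    and D: "finite D" "S \<subseteq> D" and iso: "\<And>w. w \<in> S \<Longrightarrow> R `` {w} = {}"
  shows "C1 n R + card S \<le> card D + 1"
proof -
  have "w = v" if "w \<in> S" "w \<in> component n R v" for w
    using isolated_rtrancl[OF iso[OF that(1)], of v] that(2) rtrancl_sym[OF R]
    by (auto simp: component_def)
  then have "C1 n R + card (S - {v}) = card (component n R v \<union> (S - {v}))"
    unfolding v(2)[symmetric] using D finite_subset by (intro card_Un_disjoint[symmetric]) auto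
  also have "\<dots> \<le> card D"
    using v(3) D by (intro card_mono) auto
  finally show ?thesis
    using card_Diff_singleton_if[of S v] by (auto split: if_splits)
qed

lemma card_large_components:
  assumes R: "sym R" and c: "0 < c"
  shows "real (card (component n R ` {v. v < n \<and> c \<le> real (card (component n R v))})) * c \<le> real n"
proof -
  let ?S = "component n R ` {v. v < n \<and> c \<le> real (card (component n R v))}"
  have "component n R v = component n R w" if "component n R v \<inter> component n R w \<noteq> {}" for v w
    using that component_disjoint[OF R] component_eq[OF R] by blast
  then have disj: "pairwise disjnt ?S"
    unfolding pairwise_def disjnt_def by blast
  have "real (card ?S) * c = (\<Sum>A\<in>?S. c)"
    by simp
  also have "\<dots> \<le> (\<Sum>A\<in>?S. real (card A))"
    by (intro sum_mono) auto
  also have "\<dots> = real (card (\<Union>?S))"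
    using disj by (subst card_Union_disjoint) auto
  also have "\<dots> \<le> real (card {..<n})"
    using component_subset by (intro of_nat_mono card_mono) blast+
  finally show ?thesis
    by simp
qed

lemma card_in_large_components:
  "m * card {w. w < n \<and> m \<le> card (component n R w)} \<le> (\<Sum>w<n. card (component n R w))"
proof -
  have "m * card {w. w < n \<and> m \<le> card (component n R w)} =
      (\<Sum>w\<in>{w. w < n \<and> m \<le> card (component n R w)}. m)"
    by simp
  also have "\<dots> \<le> (\<Sum>w\<in>{w. w < n \<and> m \<le> card (component n R w)}. card (component n R w))"
    by (intro sum_mono) simp
  also have "\<dots> \<le> (\<Sum>w<n. card (component n R w))"
    by (intro sum_mono2) auto
  finally show ?thesis .
qed

lemma component_subset_glued:
  assumes R: "R \<subseteq> H \<union> UNIV \<times> X"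
  shows "component n R v \<subseteq> (\<Union>x\<in>insert v X. component n H x)"
proof
  fix w assume w: "w \<in> component n R v"
  then have "(v, w) \<in> R\<^sup>*"
    by (simp add: component_def)
  then have "\<exists>x\<in>insert v X. (x, w) \<in> H\<^sup>*"
  proof induction
    case (step y z)
    then have "(y, z) \<in> H \<or> z \<in> X"
      using R by auto
    then show ?case
      using step.IH rtrancl_into_rtrancl[of _ y H z] by blast
  qed auto
  then show "w \<in> (\<Union>x\<in>insert v X. component n H x)"
    using w by (auto simp: component_def)
qed

text \<open>Of the at most \<open>|X| + 1\<close> components of \<open>H\<close> that make up a component of \<open>R\<close>, those smaller than
  \<open>m\<close> cover at most \<open>(|X| + 1) m\<close> vertices.\<close>

lemma C1_le_card_large_add:
  assumes n: "0 < n" and H: "sym H" and R: "R \<subseteq> H \<union> UNIV \<times> X" and X: "finite X"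
  shows "C1 n R \<le> card {w. w < n \<and> m \<le> card (component n H w)} + (card X + 1) * m"
proof -
  obtain v where v: "v < n" "card (component n R v) = C1 n R"
    using C1_attained[OF n] .
  define large where "large = {w. w < n \<and> m \<le> card (component n H w)}"
  define small where "small = {x \<in> insert v X. card (component n H x) < m}"
  have "small \<subseteq> insert v X"
    by (auto simp: small_def)
  then have small: "finite small" "card small \<le> card X + 1"
    using X card_mono[of "insert v X" small] card_insert_le_m1[of "Suc (card X)" X v]
    by (auto intro: finite_subset)
  have "component n R v \<subseteq> large \<union> (\<Union>x\<in>small. component n H x)"
  proof
    fix w assume w: "w \<in> component n R v"
    then obtain x where x: "x \<in> insert v X" "w \<in> component n H x"
      using subsetD[OF component_subset_glued[OF R]] by blast
    show "w \<in> large \<union> (\<Union>x\<in>small. component n H x)"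
    proof (cases "x \<in> small")
      case False
      moreover have "component n H x = component n H w" "w < n"
        using x(2) component_eq[OF H] by (simp_all add: component_def)
      ultimately show ?thesis
        using x(1) by (auto simp: large_def small_def not_less)
    qed (use x(2) in blast)
  qed
  then have "C1 n R \<le> card (large \<union> (\<Union>x\<in>small. component n H x))"
    unfolding v(2)[symmetric] using small by (intro card_mono) (auto simp: large_def)
  also have "\<dots> \<le> card large + card (\<Union>x\<in>small. component n H x)"
    by (rule card_Un_le)
  also have "card (\<Union>x\<in>small. component n H x) \<le> (\<Sum>x\<in>small. card (component n H x))"
    using small by (intro card_UN_le)
  also have "\<dots> \<le> card small * m"
    using sum_bounded_above[of small "\<lambda>x. card (component n H x)" m] by (auto simp: small_def)
  also have "\<dots> \<le> (card X + 1) * m"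
    using small by (intro mult_right_mono) auto
  finally show ?thesis
    by (simp add: large_def)
qed

lemma C1_glue_bound:
  assumes "0 < n" "sym H" "R \<subseteq> H \<union> UNIV \<times> X" "finite X"
  shows "m * C1 n R \<le> (\<Sum>w<n. card (component n H w)) + m * (m * (card X + 1))"
proof -
  have "m * C1 n R \<le> m * (card {w. w < n \<and> m \<le> card (component n H w)} + (card X + 1) * m)"
    using C1_le_card_large_add[OF assms] by (rule mult_left_mono) simp
  then show ?thesis
    using card_in_large_components[of m n H] by (simp add: algebra_simps)
qed

definition separated :: "nat \<Rightarrow> real \<Rightarrow> (nat \<times> nat) set \<Rightarrow> (nat \<times> nat) set \<Rightarrow> nat \<times> nat \<Rightarrow> bool" where
  "separated n c R S p \<longleftrightarrow> c \<le> real (card (component n R (fst p))) \<and>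
     c \<le> real (card (component n R (snd p))) \<and> p \<notin> S\<^sup>*"

lemma card_separated_ge:
  assumes RS: "R \<subseteq> S" "sym R" "sym S" and c: "0 \<le> c"
    and u: "c \<le> real (card (component n R u))" and v: "c \<le> real (card (component n R v))"
    and uv: "(u, v) \<notin> S\<^sup>*"
  shows "c\<^sup>2 \<le> 2 * real (card {p \<in> pairs n. separated n c R S p})"
proof -
  let ?T = "{p \<in> pairs n. separated n c R S p}"
  have "component n R u \<times> component n R v \<subseteq> ?T \<union> prod.swap ` ?T"
  proof (intro subsetI)
    fix p assume "p \<in> component n R u \<times> component n R v"
    then obtain a b where p: "p = (a, b)" and a: "a \<in> component n R u" and b: "b \<in> component n R v"
      by blast
    have comp: "component n R a = component n R u" "component n R b = component n R v"
      using a b component_eq[OF RS(2)] by (auto simp: component_def)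
    have "(u, a) \<in> S\<^sup>*" "(v, b) \<in> S\<^sup>*"
      using a b rtrancl_mono[OF RS(1)] by (auto simp: component_def)
    then have "(a, b) \<notin> S\<^sup>*"
      using uv rtrancl_sym[OF RS(3)] by (meson rtrancl_trans)
    then have "separated n c R S (a, b)" "separated n c R S (b, a)" "a \<noteq> b"
      using u v comp rtrancl_sym[OF RS(3)] by (auto simp: separated_def)
    moreover have "a < n" "b < n"
      using a b component_subset by auto
    ultimately have "(a, b) \<in> ?T \<or> (b, a) \<in> ?T"
      by (auto simp: pairs_def)
    then show "p \<in> ?T \<union> prod.swap ` ?T"
      unfolding p by force
  qed
  then have "card (component n R u \<times> component n R v) \<le> card (?T \<union> prod.swap ` ?T)"
    by (intro card_mono) auto
  also have "\<dots> \<le> card ?T + card (prod.swap ` ?T)"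
    by (rule card_Un_le)
  also have "\<dots> \<le> 2 * card ?T"
    using card_image_le[of ?T prod.swap] by simp
  finally have "real (card (component n R u)) * real (card (component n R v)) \<le> real (2 * card ?T)"
    unfolding card_cartesian_product of_nat_mult[symmetric] by (rule of_nat_mono)
  moreover have "c * c \<le> real (card (component n R u)) * real (card (component n R v))"
    using u v c by (intro mult_mono) auto
  ultimately show ?thesis
    by (simp add: power2_eq_square)
qed

definition unique_large_component :: "nat \<Rightarrow> real \<Rightarrow> (nat \<times> nat) set \<Rightarrow> bool" where
  "unique_large_component n c R \<longleftrightarrow> (\<forall>u<n. \<forall>v<n. c \<le> real (card (component n R u)) \<longrightarrow>
     c \<le> real (card (component n R v)) \<longrightarrow> (u, v) \<in> R\<^sup>*)"

lemma unique_large_componentI: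
  assumes RS: "R \<subseteq> S" "sym R" "sym S" and c: "0 \<le> c" and n: "0 < n"
    and few: "2 * real (card {p \<in> pairs n. separated n c R S p}) < c\<^sup>2"
    and growth: "real (C1 n S) < real (C1 n R) + c"
  shows "unique_large_component n c R"
proof -
  obtain m where m: "m < n" "card (component n R m) = C1 n R"
    using C1_attained[OF n] .
  have "(m, v) \<in> R\<^sup>*" if v: "v < n" "c \<le> real (card (component n R v))" for v
  proof (rule ccontr)
    assume "(m, v) \<notin> R\<^sup>*"
    then have disj: "component n R m \<inter> component n R v = {}"
      by (rule component_disjoint[OF RS(2)])
    have "c \<le> real (card (component n R m))"
      using v card_component_le_C1[OF v(1), of R] m(2) by linarith
    then have "(m, v) \<in> S\<^sup>*"
      using card_separated_ge[OF RS c _ v(2), of m] few by fastforce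
    then have "component n R v \<subseteq> component n S m"
      using component_mono[OF RS(1)] component_eq[OF RS(3)] by metis
    then have "card (component n R m \<union> component n R v) \<le> card (component n S m)"
      using component_mono[OF RS(1)] by (intro card_mono) auto
    then have "C1 n R + card (component n R v) \<le> C1 n S"
      using disj m card_component_le_C1[OF m(1), of S] by (simp add: card_Un_disjoint)
    then show False
      using growth v(2) by linarith
  qed
  then show ?thesis
    unfolding unique_large_component_def using rtrancl_sym[OF RS(2)] by (meson rtrancl_trans)
qed

subsection \<open>Levels of a sequence of edges\<close>

definition ends :: "edge \<Rightarrow> nat \<times> nat" where
  "ends x = (fst x, fst (snd x))"

lemma ends_simp [simp]: "ends (u, v, j) = (u, v)"
  by (simp add: ends_def)

definition loop_free :: "edge list \<Rightarrow> bool" where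
  "loop_free es \<longleftrightarrow> (\<forall>x\<in>set es. fst (ends x) \<noteq> snd (ends x))"

lemma loop_free_Cons [simp]: "loop_free (x # es) \<longleftrightarrow> fst (ends x) \<noteq> snd (ends x) \<and> loop_free es"
  and loop_free_append [simp]: "loop_free (es @ fs) \<longleftrightarrow> loop_free es \<and> loop_free fs"
  by (auto simp: loop_free_def)

definition labelled :: "edge list \<Rightarrow> (edge \<times> nat) list" where
  "labelled es = foldl add_edge [] es"

abbreviation conn :: "edge list \<Rightarrow> nat \<Rightarrow> (nat \<times> nat) set" where
  "conn es k \<equiv> (level_rel (labelled es) k)\<^sup>*"

lemma labelled_Nil [simp]: "labelled [] = []"
  by (simp add: labelled_def)

lemma labelled_snoc: "labelled (es @ [x]) = labelled es @ [(x, new_level (labelled es) x)]"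
  by (simp add: labelled_def add_edge_def)

lemma map_fst_labelled [simp]: "map fst (labelled es) = es"
  by (induction es rule: rev_induct) (auto simp: labelled_snoc)

lemma labelled_imp_mem: "(x, l) \<in> set (labelled es) \<Longrightarrow> x \<in> set es"
  by (metis fst_conv image_eqI list.set_map map_fst_labelled)

lemma mem_imp_labelled: "x \<in> set es \<Longrightarrow> \<exists>l. (x, l) \<in> set (labelled es)"
  by (metis imageE list.set_map map_fst_labelled prod.collapse)

lemma labelled_append_mono: "set (labelled es) \<subseteq> set (labelled (es @ fs))"
proof (induction fs rule: rev_induct)
  case (snoc x xs)
  then show ?case
    using labelled_snoc[of "es @ xs" x] by auto
qed simp

lemma new_level_mem_labelled: "(x, new_level (labelled es) x) \<in> set (labelled (es @ x # fs))"
  using labelled_append_mono[of "es @ [x]" fs] by (simp add: labelled_snoc)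

lemma labelled_unique:
  assumes "distinct es" "(x, l) \<in> set (labelled es)" "(x, l') \<in> set (labelled es)"
  shows "l = l'"
  using assms eq_key_imp_eq_value[of "labelled es" x l l'] by simp

lemma level_rel_iff:
  "(a, b) \<in> level_rel L k \<longleftrightarrow> (\<exists>x l. (x, l) \<in> set L \<and> k \<le> l \<and> (ends x = (a, b) \<or> ends x = (b, a)))"
  by (auto simp: level_rel_def ends_def)

lemma level_rel_mono: "set L \<subseteq> set M \<Longrightarrow> j \<le> k \<Longrightarrow> level_rel L k \<subseteq> level_rel M j"
  by (meson level_rel_iff order_trans subrelI subsetD)

lemma sym_level_rel: "sym (level_rel L k)"
  by (auto simp: sym_def level_rel_iff)

lemmas conn_sym = rtrancl_sym[OF sym_level_rel]

lemma conn_mono: "p \<in> conn es k \<Longrightarrow> j \<le> k \<Longrightarrow> p \<in> conn (es @ fs) j"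
  using rtrancl_mono[OF level_rel_mono[OF labelled_append_mono]] by blast

lemma ends_in_conn: "(x, l) \<in> set (labelled es) \<Longrightarrow> k \<le> l \<Longrightarrow> ends x \<in> conn es k"
  by (metis level_rel_iff prod.collapse r_into_rtrancl)

lemma conn_quadrangle:
  "(a, b) \<in> conn es k \<Longrightarrow> (a, c) \<in> conn es k \<Longrightarrow> (b, d) \<in> conn es k \<Longrightarrow> (c, d) \<in> conn es k"
  by (meson conn_sym rtrancl_trans)

lemma new_level_finite:
  assumes "fst (ends x) \<noteq> snd (ends x)"
  shows "\<exists>k. 1 \<le> k \<and> ends x \<notin> (level_rel L k)\<^sup>*"
proof (intro exI conjI)
  let ?k = "Suc (sum_list (map snd L))"
  have "l < ?k" if "(y, l) \<in> set L" for y l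
    using member_le_sum_list[of l "map snd L"] that by force
  then have "level_rel L ?k = {}"
    by (force simp: level_rel_def)
  then show "ends x \<notin> (level_rel L ?k)\<^sup>*"
    using assms by (auto simp: ends_def)
qed simp

lemma
  assumes "fst (ends x) \<noteq> snd (ends x)"
  shows new_level_ge_1: "1 \<le> new_level L x"
    and less_new_level_iff: "1 \<le> j \<Longrightarrow> j < new_level L x \<longleftrightarrow> ends x \<in> (level_rel L j)\<^sup>*"
proof -
  have eq: "new_level L x = (LEAST k. 1 \<le> k \<and> ends x \<notin> (level_rel L k)\<^sup>*)"
    by (simp add: new_level_def ends_def)
  have level: "1 \<le> new_level L x \<and> ends x \<notin> (level_rel L (new_level L x))\<^sup>*"
    unfolding eq using new_level_finite[OF assms] by (rule LeastI_ex)
  then show "1 \<le> new_level L x"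
    by simp
  show "j < new_level L x \<longleftrightarrow> ends x \<in> (level_rel L j)\<^sup>*" if "1 \<le> j"
  proof
    assume "j < new_level L x"
    then show "ends x \<in> (level_rel L j)\<^sup>*"
      unfolding eq using that not_less_Least by blast
  next
    assume "ends x \<in> (level_rel L j)\<^sup>*"
    then show "j < new_level L x"
      using level rtrancl_mono[OF level_rel_mono[OF order_refl, of "new_level L x" j L]]
      by (meson not_less subsetD)
  qed
qed

lemma labelled_level_ge_1:
  assumes "loop_free es" "(x, l) \<in> set (labelled es)"
  shows "1 \<le> l"
  using assms by (induction es rule: rev_induct) (auto simp: labelled_snoc dest: new_level_ge_1)

lemma same_level_edge_unique:
  assumes "loop_free (base @ rest)"
    and "(x, l) \<in> set (labelled (base @ rest))" "(y, l) \<in> set (labelled (base @ rest))"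
    and "x \<notin> set base" "y \<notin> set base" "l \<le> k"
    and "(fst (ends x), fst (ends y)) \<in> conn base k" "(snd (ends x), snd (ends y)) \<in> conn base k"
  shows "x = y"
  using assms
proof (induction rest arbitrary: x y rule: rev_induct)
  case Nil
  then show ?case
    using labelled_imp_mem by fastforce
next
  case (snoc z es)
  let ?L = "labelled (base @ es)"
  have labelled: "labelled (base @ es @ [z]) = ?L @ [(z, new_level ?L z)]"
    using labelled_snoc[of "base @ es" z] by simp
  have less: "l < new_level ?L z"
    if w: "(w, l) \<in> set ?L"
      and "(fst (ends w), fst (ends z)) \<in> conn base k"
        "(snd (ends w), snd (ends z)) \<in> conn base k" for w
  proof -
    have "(fst (ends w), snd (ends w)) \<in> conn (base @ es) l"
      using ends_in_conn[OF w order_refl] by simp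
    moreover have "(fst (ends w), fst (ends z)) \<in> conn (base @ es) l"
      "(snd (ends w), snd (ends z)) \<in> conn (base @ es) l"
      using that(2,3) snoc.prems(6) by (simp_all add: conn_mono)
    ultimately have "(fst (ends z), snd (ends z)) \<in> conn (base @ es) l"
      by (rule conn_quadrangle)
    moreover have "1 \<le> l"
      using labelled_level_ge_1[OF _ w] snoc.prems(1) by simp
    ultimately show ?thesis
      using snoc.prems(1) by (simp add: less_new_level_iff)
  qed
  show ?case
  proof (cases "(x, l) \<in> set ?L \<and> (y, l) \<in> set ?L")
    case True
    then show ?thesis
      using snoc.IH[of x y] snoc.prems by simp
  next
    case False
    then show ?thesis
      using snoc.prems(2,3,7,8) less[of x] less[of y] conn_sym by (auto simp: labelled)
  qed
qed

definition crosses :: "nat set \<Rightarrow> nat set \<Rightarrow> edge \<Rightarrow> bool" where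
  "crosses A B x \<longleftrightarrow> ends x \<in> A \<times> B \<union> B \<times> A"

lemma crossing_edge_connects:
  assumes "A \<times> A \<subseteq> conn es j" "B \<times> B \<subseteq> conn es j"
    and x: "crosses A B x" "(x, l) \<in> set (labelled es)" "j \<le> l"
  shows "A \<times> B \<subseteq> conn es j"
proof -
  have "ends x \<in> conn es j"
    using x(2,3) by (rule ends_in_conn)
  then obtain a b where "a \<in> A" "b \<in> B" and ab: "(a, b) \<in> conn es j"
    using x(1) conn_sym[of "fst (ends x)" "snd (ends x)"]
      by (cases "ends x") (auto simp: crosses_def)
  then show ?thesis
    using assms(1,2) conn_quadrangle[OF ab] by blast
qed

text \<open>Once \<open>j\<close> edges have crossed between \<open>A\<close> and \<open>B\<close>, these sets are joined in \<open>G\<^sub>j\<close>, so that the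
  next crossing edge has a level above \<open>j\<close> and joins them in \<open>G\<^sub>j\<^sub>+\<^sub>1\<close>.\<close>

lemma crossing_edges_connect:
  assumes A: "A \<times> A \<subseteq> conn base k" and B: "B \<times> B \<subseteq> conn base k"
    and "loop_free rest" "1 \<le> j" "j \<le> k" "j \<le> length (filter (crosses A B) rest)"
  shows "A \<times> B \<subseteq> conn (base @ rest) j"
  using assms(3-6)
proof (induction rest arbitrary: j rule: rev_induct)
  case (snoc y ys)
  let ?L = "labelled (base @ ys)"
  show ?case
  proof (cases "j \<le> length (filter (crosses A B) ys)")
    case True
    then have "A \<times> B \<subseteq> conn (base @ ys) j"
      using snoc by simp
    then show ?thesis
      using conn_mono[of _ "base @ ys" j j "[y]"] by auto
  next
    case False
    then have y: "crosses A B y" and IH: "2 \<le> j \<Longrightarrow> A \<times> B \<subseteq> conn (base @ ys) (j - 1)"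
      using snoc.prems snoc.IH[of "j - 1"] by (auto split: if_splits)
    have "j \<le> new_level ?L y"
    proof (cases "j = 1")
      case True
      then show ?thesis
        using new_level_ge_1 snoc.prems(1) by simp
    next
      case False
      then have "A \<times> B \<subseteq> conn (base @ ys) (j - 1)"
        using IH snoc.prems(2) by simp
      then have "ends y \<in> conn (base @ ys) (j - 1)"
        using y conn_sym by (auto simp: crosses_def)
      then have "j - 1 < new_level ?L y"
        using False snoc.prems(1,2) by (simp add: less_new_level_iff)
      then show ?thesis
        by simp
    qed
    moreover have "A \<times> A \<subseteq> conn (base @ ys @ [y]) j" "B \<times> B \<subseteq> conn (base @ ys @ [y]) j"
      using A B conn_mono snoc.prems(3) by blast+
    ultimately show ?thesis
      using new_level_mem_labelled[of y "base @ ys" "[]"] y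
      by (intro crossing_edge_connects[of A _ j B y]) simp_all
  qed
qed simp

definition incident :: "nat \<Rightarrow> edge \<Rightarrow> bool" where
  "incident v x \<longleftrightarrow> fst (ends x) = v \<or> snd (ends x) = v"

lemma isolated_above_degree:
  assumes "loop_free es" "length (filter (incident v) es) < k"
  shows "level_rel (labelled es) k `` {v} = {}"
  using assms
proof (induction es arbitrary: k rule: rev_induct)
  case (snoc y ys)
  have "l < k \<or> \<not> incident v x" if "(x, l) \<in> set (labelled (ys @ [y]))" for x l
  proof (cases "(x, l) \<in> set (labelled ys)")
    case True
    have "level_rel (labelled ys) k `` {v} = {}"
      using snoc by (simp split: if_splits)
    then show ?thesis
      using True level_rel_iff[of _ _ "labelled ys" k] unfolding incident_def
      by (metis Image_singleton_iff empty_iff leI prod.collapse)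
  next
    case False
    then have xl: "x = y" "l = new_level (labelled ys) y"
      using that by (auto simp: labelled_snoc)
    show ?thesis
    proof (cases "incident v y")
      case True
      then have k: "1 \<le> k - 1" and iso: "level_rel (labelled ys) (k - 1) `` {v} = {}"
        using snoc by auto
      have "ends y \<notin> conn ys (k - 1)"
        using True isolated_rtrancl[OF iso] conn_sym snoc.prems(1)
        by (metis incident_def loop_free_Cons loop_free_append prod.collapse)
      then have "new_level (labelled ys) y \<le> k - 1"
        using k snoc.prems(1) less_new_level_iff[of y "k - 1" "labelled ys"] by simp
      then show ?thesis
        using k xl by linarith
    qed (simp add: xl)
  qed
  then show ?case
    by (force simp: level_rel_iff incident_def)
qed (simp add: level_rel_def)

subsection \<open>Arrival order and deletion of pairs\<close>

definition gap :: "nat \<Rightarrow> sample \<Rightarrow> nat \<times> nat \<Rightarrow> nat \<Rightarrow> real" where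
  "gap n \<omega> p i = real n * \<omega> (fst p, snd p, i)"

definition first_edge :: "nat \<times> nat \<Rightarrow> edge" where
  "first_edge p = (fst p, snd p, 0)"

lemma ends_first_edge [simp]: "ends (first_edge p) = p"
  by (simp add: first_edge_def)

lemma inj_first_edge: "inj first_edge"
  by (metis ends_first_edge injI)

lemma arrival_eq: "arrival n \<omega> x = (\<Sum>i\<le>snd (snd x). gap n \<omega> (ends x) i)"
  by (simp add: arrival_def gap_def ends_def sum_distrib_left)

lemma arrival_first_edge [simp]: "arrival n \<omega> (first_edge p) = gap n \<omega> p 0"
  by (simp add: arrival_eq) (simp add: first_edge_def)

lemma edges_upto_iff: "x \<in> edges_upto n \<omega> t \<longleftrightarrow> ends x \<in> pairs n \<and> arrival n \<omega> x \<le> t"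
  by (auto simp: edges_upto_def pairs_def ends_def)

text \<open>Almost surely, the clocks of each pair are positive and unbounded, so that \<open>edges_upto\<close> is
  finite; for an infinite set, \<open>labelled_edges\<close> would be the junk value \<open>[]\<close>.\<close>

definition regular :: "sample \<Rightarrow> bool" where
  "regular \<omega> \<longleftrightarrow> (\<forall>e. 0 < \<omega> e) \<and> (\<forall>u v. \<forall>c::nat. \<exists>j. real c < \<omega> (u, v, j))"

lemma gap_nonneg: "regular \<omega> \<Longrightarrow> 0 \<le> gap n \<omega> p i"
  by (simp add: regular_def gap_def less_imp_le)

lemma gap_le_arrival:
  assumes "regular \<omega>" "i \<le> j"
  shows "gap n \<omega> (u, v) i \<le> arrival n \<omega> (u, v, j)"
  using assms member_le_sum[of i "{..j}" "gap n \<omega> (u, v)"] by (simp add: arrival_eq gap_nonneg)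

lemma first_gap_le:
  assumes "regular \<omega>" "x \<in> edges_upto n \<omega> t"
  shows "gap n \<omega> (ends x) 0 \<le> t"
  using assms gap_le_arrival[of \<omega> 0 "snd (snd x)" n "fst x" "fst (snd x)"]
  by (simp add: edges_upto_iff ends_def)

lemma first_edge_if_second_gap_greater:
  assumes "regular \<omega>" "x \<in> edges_upto n \<omega> t" "t < gap n \<omega> (ends x) (Suc 0)"
  shows "x = first_edge (ends x)"
proof (cases x)
  case (fields u v j)
  then have "\<not> Suc 0 \<le> j"
    using assms gap_le_arrival[OF assms(1), of "Suc 0" j n u v] by (auto simp: edges_upto_iff)
  then show ?thesis
    using fields by (simp add: first_edge_def)
qed

lemma finite_edges_upto:
  assumes "regular \<omega>"
  shows "finite (edges_upto n \<omega> t)"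
proof (cases "n = 0")
  case False
  obtain c :: nat where c: "t / real n \<le> real c"
    using real_arch_simple by blast
  obtain J where J: "\<And>u v. real c < \<omega> (u, v, J u v)"
    using assms unfolding regular_def by moura
  have "j < J u v" if "(u, v, j) \<in> edges_upto n \<omega> t" for u v j
  proof (rule ccontr)
    assume "\<not> j < J u v"
    then have "gap n \<omega> (u, v) (J u v) \<le> t"
      using that gap_le_arrival[OF assms, of "J u v" j n u v] by (simp add: edges_upto_iff)
    then have "\<omega> (u, v, J u v) \<le> t / real n"
      using False by (simp add: gap_def field_simps)
    then show False
      using c J[of u v] by linarith
  qed
  then have "edges_upto n \<omega> t \<subseteq> (\<Union>u<n. \<Union>v<n. \<Union>j<J u v. {(u, v, j)})"
    by (auto simp: edges_upto_iff pairs_def)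
  then show ?thesis
    by (rule finite_subset) auto
qed (simp add: edges_upto_def)

definition arrivals :: "nat \<Rightarrow> sample \<Rightarrow> real \<Rightarrow> edge list" where
  "arrivals n \<omega> t = sort_key (arrival n \<omega>)
     (map edge_decode (sorted_list_of_set (edge_code ` edges_upto n \<omega> t)))"

lemma G_rel_eq: "G_rel n \<omega> t k = level_rel (labelled (arrivals n \<omega> t)) k"
  by (simp add: G_rel_def labelled_edges_def arrivals_def labelled_def)

lemma edge_decode_code [simp]: "edge_decode (edge_code x) = x"
  by (simp add: edge_decode_def edge_code_def)

lemma set_arrivals: "regular \<omega> \<Longrightarrow> set (arrivals n \<omega> t) = edges_upto n \<omega> t"
  by (simp add: arrivals_def finite_edges_upto image_image)

lemma distinct_arrivals: "regular \<omega> \<Longrightarrow> distinct (arrivals n \<omega> t)"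
  by (auto simp: arrivals_def finite_edges_upto distinct_map intro!: inj_onI)

lemma sorted_arrivals: "sorted (map (arrival n \<omega>) (arrivals n \<omega> t))"
  by (simp add: arrivals_def)

lemma loop_free_arrivals: "regular \<omega> \<Longrightarrow> loop_free (arrivals n \<omega> t)"
  by (auto simp: loop_free_def set_arrivals edges_upto_iff pairs_def)

lemma sort_key_cong:
  fixes f g :: "'a \<Rightarrow> 'b::linorder"
  assumes "\<And>x. x \<in> set xs \<Longrightarrow> f x = g x"
  shows "sort_key f xs = sort_key g xs"
proof -
  have "insort_key f x ys = insort_key g x ys" if "\<forall>y\<in>insert x (set ys). f y = g y" for x ys
    using that by (induction ys) auto
  then show ?thesis
    using assms by (induction xs) auto
qed

lemma sorted_list_of_set_Collect:
  "finite A \<Longrightarrow> sorted_list_of_set {x \<in> A. P x} = filter P (sorted_list_of_set A)"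
  by (rule sorted_distinct_set_unique) (auto simp: sorted_wrt_filter)

lemma arrivals_eq_filter:
  assumes "regular \<omega>" and sub: "edges_upto n \<omega>' s = {x \<in> edges_upto n \<omega> t. Q x}"
    and eq: "\<And>x. x \<in> edges_upto n \<omega>' s \<Longrightarrow> arrival n \<omega>' x = arrival n \<omega> x"
  shows "arrivals n \<omega>' s = filter Q (arrivals n \<omega> t)"
proof -
  let ?list = "\<lambda>E. map edge_decode (sorted_list_of_set (edge_code ` E))"
  have fin: "finite (edges_upto n \<omega> t)"
    using assms(1) by (rule finite_edges_upto)
  have "edge_code ` edges_upto n \<omega>' s = {m \<in> edge_code ` edges_upto n \<omega> t. Q (edge_decode m)}"
    unfolding sub by auto
  then have "?list (edges_upto n \<omega>' s) = filter Q (?list (edges_upto n \<omega> t))"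
    using fin by (simp add: sorted_list_of_set_Collect filter_map o_def)
  moreover have "sort_key (arrival n \<omega>') (?list (edges_upto n \<omega>' s)) =
      sort_key (arrival n \<omega>) (?list (edges_upto n \<omega>' s))"
    using fin eq by (intro sort_key_cong) (auto simp: sub)
  ultimately show ?thesis
    by (simp add: arrivals_def filter_sort)
qed

lemma arrivals_prefix:
  assumes "regular \<omega>" "s \<le> t"
  obtains rest where "arrivals n \<omega> t = arrivals n \<omega> s @ rest"
proof -
  let ?P = "\<lambda>x. arrival n \<omega> x \<le> s"
  have "\<forall>x\<in>set (dropWhile ?P xs). s < arrival n \<omega> x" if "sorted (map (arrival n \<omega>) xs)" for xs
    using that by (induction xs) auto
  from this[OF sorted_arrivals] have "takeWhile ?P (arrivals n \<omega> t) = filter ?P (arrivals n \<omega> t)"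
    by (intro takeWhile_eq_filter) (simp add: not_le)
  also have "\<dots> = arrivals n \<omega> s"
    using assms by (intro arrivals_eq_filter[symmetric]) (auto simp: edges_upto_iff)
  finally show thesis
    using that takeWhile_dropWhile_id[of ?P "arrivals n \<omega> t"] by metis
qed

text \<open>Setting the clocks of the pairs in \<open>P\<close> to a large constant removes these pairs from the graph
  while keeping the vertex set.\<close>

definition delete_until :: "real \<Rightarrow> (nat \<times> nat) set \<Rightarrow> sample \<Rightarrow> sample" where
  "delete_until t P \<omega> = (\<lambda>e. if ends e \<in> P then t + 1 else \<omega> e)"

lemma arrival_delete_until:
  "arrival n (delete_until t P \<omega>) x =
    (if ends x \<in> P then real n * (real (Suc (snd (snd x))) * (t + 1)) else arrival n \<omega> x)"
  by (simp add: arrival_def delete_until_def ends_def)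

lemma edges_upto_delete_until:
  assumes "0 < n" "0 \<le> t" "s \<le> t"
  shows "edges_upto n (delete_until t P \<omega>) s = {x \<in> edges_upto n \<omega> s. ends x \<notin> P}"
proof -
  have "s < real n * (real (Suc j) * (t + 1))" for j
  proof -
    have "s < 1 * (1 * (t + 1))"
      using assms by simp
    also have "\<dots> \<le> real n * (real (Suc j) * (t + 1))"
      using assms by (intro mult_mono) auto
    finally show ?thesis .
  qed
  then show ?thesis
    by (auto simp: edges_upto_iff arrival_delete_until not_le[symmetric]
        simp del: of_nat_Suc split: if_splits)
qed

lemma arrivals_delete_until:
  assumes "regular \<omega>" "0 < n" "0 \<le> t" "s \<le> t"
  shows "arrivals n (delete_until t P \<omega>) s = filter (\<lambda>x. ends x \<notin> P) (arrivals n \<omega> s)"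
  using assms(1)
proof (rule arrivals_eq_filter)
  show "edges_upto n (delete_until t P \<omega>) s = {x \<in> edges_upto n \<omega> s. ends x \<notin> P}"
    using assms by (intro edges_upto_delete_until)
  then show "arrival n (delete_until t P \<omega>) x = arrival n \<omega> x"
    if "x \<in> edges_upto n (delete_until t P \<omega>) s" for x
    using that by (simp add: arrival_delete_until)
qed

lemma G_rel_delete_until:
  assumes "regular \<omega>" "0 < n" "0 \<le> t" "s \<le> t"
    and late: "\<And>p. p \<in> P \<Longrightarrow> p \<in> pairs n \<Longrightarrow> s < gap n \<omega> p 0"
  shows "G_rel n (delete_until t P \<omega>) s k = G_rel n \<omega> s k"
proof -
  have "ends x \<notin> P" if "x \<in> set (arrivals n \<omega> s)" for x
    using that late[of "ends x"] first_gap_le[OF assms(1), of x n s] set_arrivals[OF assms(1)]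
    by (force simp: edges_upto_iff)
  then show ?thesis
    using assms by (simp add: G_rel_eq arrivals_delete_until filter_True)
qed

lemma connected_without_edge:
  assumes reg: "regular \<omega>" and n: "0 < n" and s: "0 \<le> s" "s \<le> t"
    and p: "p \<in> pairs n" "gap n \<omega> p 0 \<le> s" "s < gap n \<omega> p (Suc 0)"
    and level: "(first_edge p, l) \<in> set (labelled (arrivals n \<omega> t))" "1 \<le> j" "j < l"
  shows "p \<in> (G_rel n (delete_until s {p} \<omega>) s j)\<^sup>*"
proof -
  have "first_edge p \<in> set (arrivals n \<omega> s)"
    using p(1,2) by (simp add: set_arrivals[OF reg] edges_upto_iff)
  then obtain pre post where split: "arrivals n \<omega> s = pre @ first_edge p # post"
    by (meson split_list)
  have dist: "first_edge p \<notin> set pre \<union> set post"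
    using distinct_arrivals[OF reg, of n s] split by auto
  have "ends x \<noteq> p" if "x \<in> set pre \<union> set post" for x
  proof
    assume "ends x = p"
    moreover have "x \<in> edges_upto n \<omega> s"
      using that split set_arrivals[OF reg, of n s] by auto
    ultimately have "x = first_edge p"
      using first_edge_if_second_gap_greater[OF reg, of x n s] p(3) by simp
    then show False
      using dist that by simp
  qed
  then have deleted: "arrivals n (delete_until s {p} \<omega>) s = pre @ post"
    using arrivals_delete_until[OF reg n s(1) order_refl] by (simp add: split filter_id_conv)
  obtain rest where "arrivals n \<omega> t = arrivals n \<omega> s @ rest"
    using arrivals_prefix[OF reg s(2)] .
  then have "(first_edge p, new_level (labelled pre) (first_edge p)) \<in>
      set (labelled (arrivals n \<omega> t))"
    using new_level_mem_labelled[of "first_edge p" pre "post @ rest"] by (simp add: split)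
  then have "l = new_level (labelled pre) (first_edge p)"
    using labelled_unique[OF distinct_arrivals[OF reg] level(1)] by simp
  then have "p \<in> conn pre j"
    using level(2,3) p(1) less_new_level_iff[of "first_edge p" j "labelled pre"]
    by (auto simp: pairs_def)
  then show ?thesis
    unfolding G_rel_eq deleted by (rule conn_mono) simp
qed

lemma G_rel_mono_time:
  assumes "regular \<omega>" "s \<le> t"
  shows "G_rel n \<omega> s k \<subseteq> G_rel n \<omega> t k"
proof -
  obtain rest where "arrivals n \<omega> t = arrivals n \<omega> s @ rest"
    using arrivals_prefix[OF assms] .
  then show ?thesis
    unfolding G_rel_eq by (metis labelled_append_mono level_rel_mono order_refl)
qed

lemma G_rel_antimono_level: "j \<le> k \<Longrightarrow> G_rel n \<omega> t k \<subseteq> G_rel n \<omega> t j"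
  unfolding G_rel_eq by (intro level_rel_mono) auto

lemma sym_G_rel: "sym (G_rel n \<omega> t k)"
  by (simp add: G_rel_eq sym_level_rel)

subsection \<open>The probability space\<close>

interpretation Om: prob_space Omega
  unfolding Omega_def by (intro prob_space_PiM prob_space_exponential_density) simp

lemma space_Omega: "space Omega = UNIV"
  by (simp add: Omega_def space_PiM)

lemma clock_measurable [measurable]: "(\<lambda>\<omega>. \<omega> e) \<in> borel_measurable Omega"
proof -
  have "(\<lambda>\<omega>. \<omega> e) \<in> measurable Omega (density lborel (exponential_density 1))"
    unfolding Omega_def by (rule measurable_component_singleton) simp
  then show ?thesis
    by simp
qed

lemma gap_measurable [measurable]: "(\<lambda>\<omega>. gap n \<omega> p i) \<in> borel_measurable Omega"
  unfolding gap_def by measurable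

lemma arrival_measurable [measurable]: "(\<lambda>\<omega>. arrival n \<omega> x) \<in> borel_measurable Omega"
  unfolding arrival_def by measurable

lemma measurable_OmegaI:
  assumes "\<And>e. (\<lambda>x. f x e) \<in> borel_measurable M"
  shows "f \<in> measurable M Omega"
  unfolding Omega_def
  using measurable_PiM_single'[of UNIV "\<lambda>e x. f x e" M
      "\<lambda>_. density lborel (exponential_density 1)"] assms
  by simp

lemma delete_until_measurable [measurable]: "delete_until t P \<in> measurable Omega Omega"
  by (rule measurable_OmegaI) (simp add: delete_until_def)

lemma measurable_sort_key:
  fixes f :: "'a \<Rightarrow> 'b::countable \<Rightarrow> real"
  assumes [measurable]: "\<And>x. (\<lambda>\<omega>. f \<omega> x) \<in> borel_measurable M"
  shows "(\<lambda>\<omega>. sort_key (f \<omega>) xs) \<in> measurable M (count_space UNIV)"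
proof (induction xs)
  case (Cons x xs)
  have "(\<lambda>\<omega>. insort_key (f \<omega>) x ys) \<in> measurable M (count_space UNIV)" for ys
  proof (induction ys)
    case (Cons y ys)
    have [measurable]: "(\<lambda>\<omega>. y # insort_key (f \<omega>) x ys) \<in> measurable M (count_space UNIV)"
      by (rule measurable_compose[OF Cons.IH]) simp
    show ?case
      by simp
  qed simp
  from measurable_compose_countable[OF this Cons.IH] show ?case
    by simp
qed simp

lemma sorted_list_of_set_eq_iff:
  fixes A :: "nat set"
  shows "sorted_list_of_set A = l \<longleftrightarrow>
    (if \<exists>k. \<forall>m. m \<in> A \<longrightarrow> m \<le> k then sorted l \<and> distinct l \<and> (\<forall>m. m \<in> A \<longleftrightarrow> m \<in> set l) else l = [])"
proof -
  have "finite A \<longleftrightarrow> (\<exists>k. \<forall>m. m \<in> A \<longrightarrow> m \<le> k)"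
    by (simp add: finite_nat_set_iff_bounded_le Ball_def)
  moreover have "sorted_list_of_set A = l \<longleftrightarrow> sorted l \<and> distinct l \<and> (\<forall>m. m \<in> A \<longleftrightarrow> m \<in> set l)"
    if "finite A"
    using that sorted_distinct_set_unique[of "sorted_list_of_set A" l] by (auto simp: set_eq_iff)
  moreover have "sorted_list_of_set A = []" if "infinite A"
    using that by simp
  ultimately show ?thesis
    by (metis (no_types, lifting))
qed

lemma measurable_sorted_list_of_set:
  fixes S :: "'a \<Rightarrow> nat set"
  assumes [measurable]: "\<And>m. Measurable.pred M (\<lambda>\<omega>. m \<in> S \<omega>)"
  shows "(\<lambda>\<omega>. sorted_list_of_set (S \<omega>)) \<in> measurable M (count_space UNIV)"
proof -
  have "{\<omega> \<in> space M. sorted_list_of_set (S \<omega>) = l} \<in> sets M" for l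
    unfolding sorted_list_of_set_eq_iff by measurable
  moreover have "(\<lambda>\<omega>. sorted_list_of_set (S \<omega>)) -` {l} \<inter> space M =
      {\<omega> \<in> space M. sorted_list_of_set (S \<omega>) = l}" for l
    by auto
  ultimately show ?thesis
    by (simp add: measurable_count_space_eq2_countable)
qed

lemma labelled_edges_measurable [measurable]:
  "(\<lambda>\<omega>. labelled_edges n \<omega> t) \<in> measurable Omega (count_space UNIV)"
proof -
  have "m \<in> edge_code ` edges_upto n \<omega> t \<longleftrightarrow> edge_code (edge_decode m) = m \<and>
      ends (edge_decode m) \<in> pairs n \<and> arrival n \<omega> (edge_decode m) \<le> t" for m \<omega>
    by (metis (no_types, lifting) edge_decode_code edges_upto_iff image_iff)
  then have "(\<lambda>\<omega>. sorted_list_of_set (edge_code ` edges_upto n \<omega> t)) \<in>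
      measurable Omega (count_space UNIV)"
    by (intro measurable_sorted_list_of_set) simp
  then have "(\<lambda>\<omega>. sort_key (arrival n \<omega>)
      (map edge_decode (sorted_list_of_set (edge_code ` edges_upto n \<omega> t)))) \<in>
      measurable Omega (count_space UNIV)"
    by (rule measurable_compose_countable[rotated]) (intro measurable_sort_key arrival_measurable)
  then show ?thesis
    unfolding labelled_edges_def by (rule measurable_compose) simp
qed

lemma measurable_of_G_rel:
  assumes "W \<in> measurable M Omega" "\<And>R. f R \<in> space N"
  shows "(\<lambda>\<omega>. f (G_rel n (W \<omega>) t k)) \<in> measurable M N"
proof -
  have "(\<lambda>\<omega>. f (level_rel (labelled_edges n \<omega> t) k)) \<in> measurable Omega N"
    by (rule measurable_compose[OF labelled_edges_measurable]) (simp add: assms(2))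
  then show ?thesis
    unfolding G_rel_def using measurable_compose[OF assms(1)] by blast
qed

lemma
  assumes [measurable]: "W \<in> measurable M Omega"
  shows pred_of_G_rel: "Measurable.pred M (\<lambda>\<omega>. Q (G_rel n (W \<omega>) t k))"
    and pred_conn [measurable]: "Measurable.pred M (\<lambda>\<omega>. p \<in> (G_rel n (W \<omega>) t k)\<^sup>*)"
    and C1_measurable [measurable]: "(\<lambda>\<omega>. real (C1 n (G_rel n (W \<omega>) t k))) \<in> borel_measurable M"
    and card_component_measurable [measurable]:
      "(\<lambda>\<omega>. real (card (component n (G_rel n (W \<omega>) t k) v))) \<in> borel_measurable M"
  by (rule measurable_of_G_rel; simp add: assms)+

subsection \<open>Independence of the clocks\<close>

definition depends_on :: "'a set \<Rightarrow> (('a \<Rightarrow> 'b) \<Rightarrow> bool) \<Rightarrow> bool" where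
  "depends_on K Q \<longleftrightarrow> (\<forall>\<omega> \<omega>'. (\<forall>e\<in>K. \<omega> e = \<omega>' e) \<longrightarrow> Q \<omega> = Q \<omega>')"

lemma depends_onI: "(\<And>\<omega> \<omega>'. (\<And>e. e \<in> K \<Longrightarrow> \<omega> e = \<omega>' e) \<Longrightarrow> Q \<omega> = Q \<omega>') \<Longrightarrow> depends_on K Q"
  unfolding depends_on_def by blast

lemma depends_on_mono: "depends_on K Q \<Longrightarrow> K \<subseteq> L \<Longrightarrow> depends_on L Q"
  unfolding depends_on_def by blast

lemma depends_on_delete_until: "depends_on {e. ends e \<notin> P} (\<lambda>\<omega>. Q (delete_until t P \<omega>))"
proof (rule depends_onI)
  fix \<omega> \<omega>' :: sample
  assume "\<And>e. e \<in> {e. ends e \<notin> P} \<Longrightarrow> \<omega> e = \<omega>' e"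
  then have "delete_until t P \<omega> = delete_until t P \<omega>'"
    by (auto simp: delete_until_def)
  then show "Q (delete_until t P \<omega>) = Q (delete_until t P \<omega>')"
    by simp
qed

lemma distr_clock: "distr Omega borel (\<lambda>\<omega>. \<omega> e) = density lborel (exponential_density 1)"
proof -
  have "distr Omega borel (\<lambda>\<omega>. \<omega> e) =
      distr Omega (density lborel (exponential_density 1)) (\<lambda>\<omega>. \<omega> e)"
    by (rule distr_cong) auto
  also have "\<dots> = density lborel (exponential_density 1)"
    unfolding Omega_def by (rule distr_PiM_component) (auto intro: prob_space_exponential_density)
  finally show ?thesis .
qed

lemma indep_vars_clocks: "Om.indep_vars (\<lambda>_. borel) (\<lambda>e \<omega>. \<omega> e) UNIV"
proof -
  have "distr Omega (Pi\<^sub>M UNIV (\<lambda>_. borel)) (\<lambda>x. \<lambda>i\<in>UNIV. x i) = distr Omega Omega (\<lambda>x. x)"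
  proof (rule distr_cong)
    show "sets (Pi\<^sub>M UNIV (\<lambda>_. borel)) = sets Omega"
      unfolding Omega_def by (rule sets_PiM_cong) auto
  qed auto
  also have "\<dots> = (\<Pi>\<^sub>M e\<in>UNIV. distr Omega borel (\<lambda>\<omega>. \<omega> e))"
    unfolding distr_clock distr_id by (simp add: Omega_def)
  finally show ?thesis
    by (subst Om.indep_vars_iff_distr_eq_PiM) auto
qed

lemma depends_on_factor:
  assumes "Measurable.pred Omega Q" "depends_on K Q"
  obtains A where "A \<in> sets (PiM K (\<lambda>_. borel))" "\<And>\<omega>. restrict \<omega> K \<in> A \<longleftrightarrow> Q \<omega>"
proof
  let ?ext = "\<lambda>\<eta> e. if e \<in> K then \<eta> e else (0::real)"
  define A where "A = {\<eta> \<in> space (PiM K (\<lambda>_. borel)). Q (?ext \<eta>)}"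
  have "(\<lambda>\<eta>. ?ext \<eta> e) \<in> borel_measurable (PiM K (\<lambda>_. borel))" for e
    by (cases "e \<in> K") auto
  then have "?ext \<in> measurable (PiM K (\<lambda>_. borel)) Omega"
    by (rule measurable_OmegaI)
  from measurable_compose[OF this assms(1)] show "A \<in> sets (PiM K (\<lambda>_. borel))"
    by (simp add: A_def pred_def)
  show "restrict \<omega> K \<in> A \<longleftrightarrow> Q \<omega>" for \<omega>
  proof -
    have "Q (?ext (restrict \<omega> K)) = Q \<omega>"
      by (rule assms(2)[unfolded depends_on_def, rule_format]) simp
    then show ?thesis
      by (simp add: A_def space_PiM)
  qed
qed

lemma prob_Ball_indep:
  assumes "finite L" and disj: "disjoint_family_on K L"
    and Q: "\<And>j. j \<in> L \<Longrightarrow> Measurable.pred Omega (Q j)" "\<And>j. j \<in> L \<Longrightarrow> depends_on (K j) (Q j)"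
  shows "\<P>(\<omega> in Omega. \<forall>j\<in>L. Q j \<omega>) = (\<Prod>j\<in>L. \<P>(\<omega> in Omega. Q j \<omega>))"
proof (cases "L = {}")
  case True
  then show ?thesis
    using Om.prob_space by simp
next
  case False
  let ?X = "\<lambda>j \<omega>. restrict (\<lambda>e. \<omega> e) (K j)"
  have "\<exists>A. A \<in> sets (PiM (K j) (\<lambda>_. borel)) \<and> (\<forall>\<omega>. restrict \<omega> (K j) \<in> A \<longleftrightarrow> Q j \<omega>)" if "j \<in> L" for j
    using depends_on_factor[OF Q(1,2)[OF that]] by metis
  then obtain A where A: "\<And>j. j \<in> L \<Longrightarrow> A j \<in> sets (PiM (K j) (\<lambda>_. borel))"
    "\<And>j \<omega>. j \<in> L \<Longrightarrow> restrict \<omega> (K j) \<in> A j \<longleftrightarrow> Q j \<omega>"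
    by metis
  have "Om.indep_vars (\<lambda>j. PiM (K j) (\<lambda>_. borel)) ?X L"
    using Om.indep_vars_restrict[OF indep_vars_clocks _ disj] by simp
  from Om.indep_varsD[OF this False assms(1) order_refl, of A]
  have "Om.prob (\<Inter>j\<in>L. ?X j -` A j \<inter> space Omega) = (\<Prod>j\<in>L. Om.prob (?X j -` A j \<inter> space Omega))"
    using A(1) by blast
  moreover have "(\<Inter>j\<in>L. ?X j -` A j \<inter> space Omega) = {\<omega> \<in> space Omega. \<forall>j\<in>L. Q j \<omega>}"
    using False A(2) by auto
  moreover have "?X j -` A j \<inter> space Omega = {\<omega> \<in> space Omega. Q j \<omega>}" if "j \<in> L" for j
    using A(2)[OF that] by auto
  ultimately show ?thesis
    by simp
qed

lemma prob_conj_indep: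
  assumes "Measurable.pred Omega Q1" "Measurable.pred Omega Q2"
    and "depends_on K1 Q1" "depends_on K2 Q2" "K1 \<inter> K2 = {}"
  shows "\<P>(\<omega> in Omega. Q1 \<omega> \<and> Q2 \<omega>) = \<P>(\<omega> in Omega. Q1 \<omega>) * \<P>(\<omega> in Omega. Q2 \<omega>)"
proof -
  have "\<P>(\<omega> in Omega. \<forall>j\<in>{True, False}. (if j then Q1 else Q2) \<omega>) =
      (\<Prod>j\<in>{True, False}. \<P>(\<omega> in Omega. (if j then Q1 else Q2) \<omega>))"
    by (rule prob_Ball_indep[where K = "\<lambda>j. if j then K1 else K2"])
       (use assms in \<open>auto simp: disjoint_family_on_def\<close>)
  then show ?thesis
    by (simp add: ex_bool_eq)
qed

lemma clock_distributed: "distributed Omega lborel (\<lambda>\<omega>. \<omega> e) (exponential_density 1)"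
  using distr_clock[of e] distr_cong[of Omega Omega borel lborel "\<lambda>\<omega>. \<omega> e" "\<lambda>\<omega>. \<omega> e"]
  by (simp add: distributed_def)

lemma prob_clock_gt: "0 \<le> c \<Longrightarrow> \<P>(\<omega> in Omega. c < \<omega> e) = exp (- c)"
  using Om.exponential_distributedD_gt[OF clock_distributed, of c e] by simp

lemma prob_clock_le: "0 \<le> c \<Longrightarrow> \<P>(\<omega> in Omega. \<omega> e \<le> c) = 1 - exp (- c)"
  using Om.exponential_distributedD_le[OF clock_distributed, of c e] by simp

lemma AE_clock_pos: "AE \<omega> in Omega. 0 < \<omega> e"
proof -
  have "AE \<omega> in Omega. \<not> \<omega> e \<le> 0"
    by (subst Om.prob_Collect_eq_0[symmetric]) (simp_all add: prob_clock_le)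
  then show ?thesis
    by (simp add: not_le)
qed

lemma AE_clocks_unbounded: "AE \<omega> in Omega. \<exists>j. real c < \<omega> (u, v, j)"
proof -
  let ?p = "\<P>(\<omega> in Omega. \<forall>j. \<omega> (u, v, j) \<le> real c)"
  have "?p \<le> (1 - exp (- real c)) ^ m" for m
  proof -
    have "?p \<le> \<P>(\<omega> in Omega. \<forall>j\<in>{..<m}. \<omega> (u, v, j) \<le> real c)"
      by (rule Om.prob_mono_AE) auto
    also have "\<dots> = (\<Prod>j<m. \<P>(\<omega> in Omega. \<omega> (u, v, j) \<le> real c))"
      by (rule prob_Ball_indep[where K = "\<lambda>j. {(u, v, j)}"])
         (auto simp: disjoint_family_on_def depends_on_def)
    finally show ?thesis
      by (simp add: prob_clock_le)
  qed
  moreover have "(\<lambda>m. (1 - exp (- real c)) ^ m) \<longlonglongrightarrow> 0"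
    by (rule LIMSEQ_power_zero) simp
  ultimately have "?p \<le> 0"
    by (intro LIMSEQ_le_const) auto
  then have "?p = 0"
    by (simp add: antisym)
  then have "AE \<omega> in Omega. \<not> (\<forall>j. \<omega> (u, v, j) \<le> real c)"
    by (subst Om.prob_Collect_eq_0[symmetric]) simp_all
  then show ?thesis
    by (simp add: not_le)
qed

lemma AE_regular: "AE \<omega> in Omega. regular \<omega>"
  unfolding regular_def using AE_clock_pos AE_clocks_unbounded by (simp add: AE_all_countable)

lemma prob_mono_regular:
  assumes "Measurable.pred Omega Q'" "\<And>\<omega>. regular \<omega> \<Longrightarrow> Q \<omega> \<Longrightarrow> Q' \<omega>"
  shows "\<P>(\<omega> in Omega. Q \<omega>) \<le> \<P>(\<omega> in Omega. Q' \<omega>)"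
  using assms AE_regular by (intro Om.prob_mono_AE) (auto elim: eventually_mono)

subsection \<open>Arrival probabilities\<close>

lemma exp_minus_diff_ge: "(d - c) * exp (- d) \<le> exp (- c) - exp (- d)" for c d :: real
proof -
  have "(d - c) * exp (- d) \<le> (exp (d - c) - 1) * exp (- d)"
    using exp_ge_add_one_self[of "d - c"]
    by (intro mult_right_mono) (simp_all add: le_diff_eq add.commute)
  also have "\<dots> = exp (- c) - exp (- d)"
    by (simp add: left_diff_distrib mult_exp_exp)
  finally show ?thesis .
qed

lemma exp_minus_diff_le:
  fixes c d :: real
  assumes "0 \<le> c" "c \<le> d"
  shows "exp (- c) - exp (- d) \<le> d - c"
proof -
  have "exp (- c) - exp (- d) \<le> (d - c) * exp (- c)"
    using exp_minus_diff_ge[of c d] by (simp add: algebra_simps)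
  also have "\<dots> \<le> (d - c) * 1"
    using assms by (intro mult_left_mono) auto
  finally show ?thesis
    by simp
qed

lemma prob_gap_gt:
  assumes "0 \<le> t" "0 < n"
  shows "\<P>(\<omega> in Omega. t < gap n \<omega> p i) = exp (- (t / real n))"
proof -
  have "t < gap n \<omega> p i \<longleftrightarrow> t / real n < \<omega> (fst p, snd p, i)" for \<omega>
    using assms by (simp add: gap_def field_simps)
  then show ?thesis
    using prob_clock_gt[of "t / real n"] assms by simp
qed

lemma prob_gap_between:
  assumes "0 \<le> s" "s \<le> t" "0 < n"
  shows "\<P>(\<omega> in Omega. s < gap n \<omega> p i \<and> gap n \<omega> p i \<le> t) =
      exp (- (s / real n)) - exp (- (t / real n))"
proof -
  have "{\<omega> \<in> space Omega. s < gap n \<omega> p i \<and> gap n \<omega> p i \<le> t} =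
      {\<omega> \<in> space Omega. s < gap n \<omega> p i} - {\<omega> \<in> space Omega. t < gap n \<omega> p i}"
    by auto
  also have "Om.prob \<dots> = \<P>(\<omega> in Omega. s < gap n \<omega> p i) - \<P>(\<omega> in Omega. t < gap n \<omega> p i)"
    using assms by (intro Om.finite_measure_Diff) auto
  finally show ?thesis
    using assms by (simp add: prob_gap_gt)
qed

lemma prob_gap_between_le:
  assumes "0 \<le> s" "s \<le> t" "0 < n"
  shows "\<P>(\<omega> in Omega. s < gap n \<omega> p i \<and> gap n \<omega> p i \<le> t) \<le> (t - s) / real n"
  using exp_minus_diff_le[of "s / real n" "t / real n"] assms
  by (simp add: prob_gap_between divide_right_mono diff_divide_distrib)

lemma prob_gap_le:
  assumes "0 \<le> t" "0 < n"
  shows "\<P>(\<omega> in Omega. gap n \<omega> p i \<le> t) \<le> t / real n"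
proof -
  have "\<P>(\<omega> in Omega. gap n \<omega> p i \<le> t) = 1 - \<P>(\<omega> in Omega. t < gap n \<omega> p i)"
    by (subst Om.prob_neg[symmetric]) (auto simp: not_less)
  then show ?thesis
    using exp_ge_add_one_self[of "- (t / real n)"] assms by (simp add: prob_gap_gt)
qed

definition single_arrival :: "nat \<Rightarrow> real \<Rightarrow> real \<Rightarrow> nat \<times> nat \<Rightarrow> sample \<Rightarrow> bool" where
  "single_arrival n s t p \<omega> \<longleftrightarrow> (s < gap n \<omega> p 0 \<and> gap n \<omega> p 0 \<le> t) \<and> t < gap n \<omega> p (Suc 0)"

lemma single_arrival_measurable [measurable]: "Measurable.pred Omega (single_arrival n s t p)"
  unfolding single_arrival_def[abs_def] by measurable

lemma depends_on_gap:
  "depends_on {(fst p, snd p, i)} (\<lambda>\<omega>. F (gap n \<omega> p i))"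
  by (simp add: depends_on_def gap_def)

lemma depends_on_single_arrival: "depends_on {e. ends e = p} (single_arrival n s t p)"
  by (auto simp: depends_on_def single_arrival_def gap_def)

lemma prob_single_arrival_ge:
  assumes n: "0 < n" and st: "0 \<le> s" "s \<le> t"
  shows "(t - s) / real n * exp (- (2 * t)) \<le> \<P>(\<omega> in Omega. single_arrival n s t p \<omega>)"
proof -
  let ?e = "exp (- (t / real n))"
  have e: "exp (- t) \<le> ?e"
    using divide_left_mono[of 1 "real n" t] st n by simp
  have "(t - s) / real n * exp (- (2 * t)) = (t - s) / real n * exp (- t) * exp (- t)"
    by (simp add: mult_exp_exp)
  also have "\<dots> \<le> (t - s) / real n * ?e * ?e"
    using e st by (intro mult_mono) auto
  also have "\<dots> \<le> (exp (- (s / real n)) - ?e) * ?e"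
    using exp_minus_diff_ge[of "t / real n" "s / real n"]
    by (intro mult_right_mono) (simp_all add: diff_divide_distrib)
  also have "\<dots> = \<P>(\<omega> in Omega. s < gap n \<omega> p 0 \<and> gap n \<omega> p 0 \<le> t) *
      \<P>(\<omega> in Omega. t < gap n \<omega> p (Suc 0))"
    using st n by (simp add: prob_gap_between prob_gap_gt)
  also have "\<dots> = \<P>(\<omega> in Omega. single_arrival n s t p \<omega>)"
    unfolding single_arrival_def
    by (rule prob_conj_indep[symmetric, OF _ _ depends_on_gap depends_on_gap]) auto
  finally show ?thesis .
qed

definition exact_arrivals ::
  "nat \<Rightarrow> real \<Rightarrow> real \<Rightarrow> (nat \<times> nat) set \<Rightarrow> (nat \<times> nat) set \<Rightarrow> sample \<Rightarrow> bool" where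
  "exact_arrivals n s t P S \<omega> \<longleftrightarrow>
     (\<forall>p\<in>P. if p \<in> S then single_arrival n s t p \<omega> else t < gap n \<omega> p 0)"

lemma exact_arrivals_measurable [measurable (raw)]:
  "finite P \<Longrightarrow> Measurable.pred Omega (exact_arrivals n s t P S)"
  unfolding exact_arrivals_def[abs_def] by (intro pred_intros_finite) auto

lemma depends_on_exact_arrivals: "depends_on {e. ends e \<in> P} (exact_arrivals n s t P S)"
proof (rule depends_onI)
  fix \<omega> \<omega>' :: sample
  assume "\<And>e. e \<in> {e. ends e \<in> P} \<Longrightarrow> \<omega> e = \<omega>' e"
  then have "gap n \<omega> p i = gap n \<omega>' p i" if "p \<in> P" for p i
    using that by (simp add: gap_def)
  then show "exact_arrivals n s t P S \<omega> = exact_arrivals n s t P S \<omega>'"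
    by (simp add: exact_arrivals_def single_arrival_def)
qed

lemma exact_arrivals_gap_greater:
  "exact_arrivals n s t P S \<omega> \<Longrightarrow> s \<le> t \<Longrightarrow> p \<in> P \<Longrightarrow> s < gap n \<omega> p 0"
  by (fastforce simp: exact_arrivals_def single_arrival_def split: if_splits)

lemma exact_arrivals_unique:
  assumes "exact_arrivals n s t P S \<omega>" "exact_arrivals n s t P S' \<omega>" "S \<subseteq> P" "S' \<subseteq> P"
  shows "S = S'"
proof -
  have "p \<in> T \<longleftrightarrow> gap n \<omega> p 0 \<le> t" if "exact_arrivals n s t P T \<omega>" "p \<in> P" for p T
    using that by (force simp: exact_arrivals_def single_arrival_def split: if_splits)
  then show ?thesis
    using assms by blast
qed

lemma edges_of_exact_arrivals:
  assumes reg: "regular \<omega>" and PS: "P \<subseteq> pairs n" "S \<subseteq> P" and exact: "exact_arrivals n s t P S \<omega>"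
  shows "{x \<in> edges_upto n \<omega> t. ends x \<in> P} = first_edge ` S"
proof (intro equalityI subsetI)
  fix x assume "x \<in> {x \<in> edges_upto n \<omega> t. ends x \<in> P}"
  then have x: "x \<in> edges_upto n \<omega> t" "ends x \<in> P"
    by auto
  then have "gap n \<omega> (ends x) 0 \<le> t"
    using first_gap_le[OF reg] by blast
  then have "ends x \<in> S" "single_arrival n s t (ends x) \<omega>"
    using exact x(2) by (force simp: exact_arrivals_def split: if_splits)+
  then show "x \<in> first_edge ` S"
    using first_edge_if_second_gap_greater[OF reg x(1)] by (auto simp: single_arrival_def)
next
  fix x assume "x \<in> first_edge ` S"
  then show "x \<in> {x \<in> edges_upto n \<omega> t. ends x \<in> P}"
    using exact PS by (force simp: exact_arrivals_def single_arrival_def edges_upto_iff)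
qed

lemma prob_exact_arrivals_ge:
  assumes n: "0 < n" and st: "0 \<le> s" "s \<le> t"
    and P: "finite P" "card P \<le> n" "S \<subseteq> P"
  shows "((t - s) / real n * exp (- (2 * t))) ^ card S * exp (- t) \<le>
    \<P>(\<omega> in Omega. exact_arrivals n s t P S \<omega>)"
proof -
  let ?a = "(t - s) / real n * exp (- (2 * t))"
  let ?Q = "\<lambda>p \<omega>. if p \<in> S then single_arrival n s t p \<omega> else t < gap n \<omega> p 0"
  have a: "0 \<le> ?a"
    using st by simp
  have "real (card (P - S)) * (t / real n) \<le> real n * (t / real n)"
    using P card_mono[of P "P - S"] st by (intro mult_right_mono) auto
  then have "exp (- t) \<le> exp (- (t / real n)) ^ card (P - S)"
    using n by (simp add: exp_of_nat_mult[symmetric])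
  then have "?a ^ card S * exp (- t) \<le> (\<Prod>p\<in>S. ?a) * (\<Prod>p\<in>P - S. exp (- (t / real n)))"
    using a by (simp add: mult_left_mono)
  also have "\<dots> \<le> (\<Prod>p\<in>S. \<P>(\<omega> in Omega. ?Q p \<omega>)) * (\<Prod>p\<in>P - S. \<P>(\<omega> in Omega. ?Q p \<omega>))"
  proof (rule mult_mono)
    show "(\<Prod>p\<in>S. ?a) \<le> (\<Prod>p\<in>S. \<P>(\<omega> in Omega. ?Q p \<omega>))"
      using a prob_single_arrival_ge[OF n st] by (intro prod_mono) simp
    show "(\<Prod>p\<in>P - S. exp (- (t / real n))) \<le> (\<Prod>p\<in>P - S. \<P>(\<omega> in Omega. ?Q p \<omega>))"
      using st n by (intro prod_mono) (simp add: prob_gap_gt)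
  qed (auto intro!: prod_nonneg)
  also have "\<dots> = (\<Prod>p\<in>P. \<P>(\<omega> in Omega. ?Q p \<omega>))"
    using P by (subst prod.subset_diff[of S P]) (auto simp: mult.commute)
  also have "\<dots> = \<P>(\<omega> in Omega. exact_arrivals n s t P S \<omega>)"
    unfolding exact_arrivals_def
  proof (rule prob_Ball_indep[symmetric, OF P(1)])
    show "disjoint_family_on (\<lambda>p. {e. ends e = p}) P"
      by (auto simp: disjoint_family_on_def)
    show "depends_on {e. ends e = p} (?Q p)" for p
    proof (cases "p \<in> S")
      case False
      then show ?thesis
        by (simp add: depends_on_mono[OF depends_on_gap[of p 0 "\<lambda>g. t < g"]])
    qed (simp add: depends_on_single_arrival)
  qed auto
  finally show ?thesis .
qed

lemma prob_delete_until_le: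
  assumes n: "0 < n" and st: "0 \<le> s" "s \<le> t" and P: "P \<subseteq> pairs n" "card P \<le> n"
  shows "\<P>(\<omega> in Omega. Q (G_rel n (delete_until t P \<omega>) s k)) \<le>
      exp s * \<P>(\<omega> in Omega. Q (G_rel n \<omega> s k))"
proof -
  let ?D = "\<lambda>\<omega>. Q (G_rel n (delete_until t P \<omega>) s k)" and ?E = "exact_arrivals n 0 s P {}"
  have fin: "finite P"
    using finite_subset[OF P(1)] by simp
  have pred: "Measurable.pred Omega (\<lambda>\<omega>. Q (G_rel n \<omega> s k))" "Measurable.pred Omega ?D"
    "Measurable.pred Omega ?E"
    by (rule pred_of_G_rel, simp, rule pred_of_G_rel, simp, rule exact_arrivals_measurable[OF fin])
  have "\<P>(\<omega> in Omega. ?D \<omega>) * exp (- s) \<le> \<P>(\<omega> in Omega. ?D \<omega>) * \<P>(\<omega> in Omega. ?E \<omega>)"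
    using prob_exact_arrivals_ge[OF n order_refl st(1) fin P(2), of "{}"]
    by (intro mult_left_mono) auto
  also have "\<dots> = \<P>(\<omega> in Omega. ?D \<omega> \<and> ?E \<omega>)"
    by (rule prob_conj_indep[symmetric, OF pred(2,3) depends_on_delete_until
          depends_on_exact_arrivals]) auto
  also have "\<dots> \<le> \<P>(\<omega> in Omega. Q (G_rel n \<omega> s k))"
  proof (rule prob_mono_regular[OF pred(1)])
    fix \<omega> assume reg: "regular \<omega>" and DE: "?D \<omega> \<and> ?E \<omega>"
    have "G_rel n (delete_until t P \<omega>) s k = G_rel n \<omega> s k"
      using DE st by (intro G_rel_delete_until[OF reg n]) (auto simp: exact_arrivals_def)
    then show "Q (G_rel n \<omega> s k)"
      using DE by simp
  qed
  finally show ?thesis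
    by (simp add: exp_minus field_simps)
qed

subsection \<open>Events of high probability\<close>

text \<open>Outer probability, as in \<open>conv_unif_prob\<close>, spares the measurability of \<open>Q\<close>.\<close>

definition whp :: "(nat \<Rightarrow> sample \<Rightarrow> bool) \<Rightarrow> bool" where
  "whp Q \<longleftrightarrow> (\<forall>\<delta>>0. \<forall>\<^sub>F n in sequentially. \<exists>B\<in>sets Omega. Om.prob B < \<delta> \<and>
     (\<forall>\<omega>. regular \<omega> \<longrightarrow> \<omega> \<notin> B \<longrightarrow> Q n \<omega>))"

lemma whpI: "(\<And>n \<omega>. 0 < n \<Longrightarrow> regular \<omega> \<Longrightarrow> Q n \<omega>) \<Longrightarrow> whp Q"
  unfolding whp_def
  by (auto intro!: eventually_mono[OF eventually_gt_at_top[of 0]] bexI[of _ "{}"])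

lemma whp_mono:
  assumes "whp Q" "\<And>n \<omega>. 0 < n \<Longrightarrow> regular \<omega> \<Longrightarrow> Q n \<omega> \<Longrightarrow> Q' n \<omega>"
  shows "whp Q'"
  unfolding whp_def
proof (intro allI impI)
  fix \<delta> :: real assume "0 < \<delta>"
  with assms(1) have "\<forall>\<^sub>F n in sequentially. \<exists>B\<in>sets Omega. Om.prob B < \<delta> \<and>
      (\<forall>\<omega>. regular \<omega> \<longrightarrow> \<omega> \<notin> B \<longrightarrow> Q n \<omega>)"
    unfolding whp_def by blast
  with eventually_gt_at_top[of 0] show "\<forall>\<^sub>F n in sequentially. \<exists>B\<in>sets Omega. Om.prob B < \<delta> \<and>
      (\<forall>\<omega>. regular \<omega> \<longrightarrow> \<omega> \<notin> B \<longrightarrow> Q' n \<omega>)"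
    by eventually_elim (use assms(2) in blast)
qed

lemma whp_conj:
  assumes "whp Q" "whp Q'"
  shows "whp (\<lambda>n \<omega>. Q n \<omega> \<and> Q' n \<omega>)"
  unfolding whp_def
proof (intro allI impI)
  fix \<delta> :: real assume "0 < \<delta>"
  then have "0 < \<delta> / 2"
    by simp
  with assms have "\<forall>\<^sub>F n in sequentially. \<exists>B\<in>sets Omega. Om.prob B < \<delta> / 2 \<and>
      (\<forall>\<omega>. regular \<omega> \<longrightarrow> \<omega> \<notin> B \<longrightarrow> Q n \<omega>)"
    and "\<forall>\<^sub>F n in sequentially. \<exists>B\<in>sets Omega. Om.prob B < \<delta> / 2 \<and>
      (\<forall>\<omega>. regular \<omega> \<longrightarrow> \<omega> \<notin> B \<longrightarrow> Q' n \<omega>)"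
    unfolding whp_def by blast+
  then show "\<forall>\<^sub>F n in sequentially. \<exists>B\<in>sets Omega. Om.prob B < \<delta> \<and>
      (\<forall>\<omega>. regular \<omega> \<longrightarrow> \<omega> \<notin> B \<longrightarrow> Q n \<omega> \<and> Q' n \<omega>)"
  proof eventually_elim
    case (elim n)
    then obtain B B' where B: "B \<in> sets Omega" "Om.prob B < \<delta> / 2" "\<And>\<omega>. regular \<omega> \<Longrightarrow> \<omega> \<notin> B \<Longrightarrow> Q n \<omega>"
      and B': "B' \<in> sets Omega" "Om.prob B' < \<delta> / 2" "\<And>\<omega>. regular \<omega> \<Longrightarrow> \<omega> \<notin> B' \<Longrightarrow> Q' n \<omega>"
      by blast
    have "Om.prob (B \<union> B') < \<delta>"
      using measure_Un_le[OF B(1) B'(1)] B(2) B'(2) by simp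
    then show ?case
      using B B' by (intro bexI[of _ "B \<union> B'"]) auto
  qed
qed

lemma whpI_prob:
  assumes "\<And>n. Measurable.pred Omega (Q n)" "(\<lambda>n. \<P>(\<omega> in Omega. \<not> Q n \<omega>)) \<longlonglongrightarrow> 0"
  shows "whp Q"
  unfolding whp_def
proof (intro allI impI)
  fix \<delta> :: real assume "0 < \<delta>"
  with assms(2) have "\<forall>\<^sub>F n in sequentially. \<P>(\<omega> in Omega. \<not> Q n \<omega>) < \<delta>"
    by (rule order_tendstoD)
  then show "\<forall>\<^sub>F n in sequentially. \<exists>B\<in>sets Omega. Om.prob B < \<delta> \<and>
      (\<forall>\<omega>. regular \<omega> \<longrightarrow> \<omega> \<notin> B \<longrightarrow> Q n \<omega>)"
  proof eventually_elim
    case (elim n)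
    have "{\<omega> \<in> space Omega. \<not> Q n \<omega>} \<in> sets Omega"
      using assms(1) by measurable
    then show ?case
      using elim by (intro bexI[of _ "{\<omega> \<in> space Omega. \<not> Q n \<omega>}"]) (auto simp: space_Omega)
  qed
qed

lemma whp_imp_prob_less:
  assumes "whp Q" "0 < \<delta>"
  shows "\<forall>\<^sub>F n in sequentially. \<P>(\<omega> in Omega. \<not> Q n \<omega>) < \<delta>"
proof -
  have "\<forall>\<^sub>F n in sequentially. \<exists>B\<in>sets Omega. Om.prob B < \<delta> \<and> (\<forall>\<omega>. regular \<omega> \<longrightarrow> \<omega> \<notin> B \<longrightarrow> Q n \<omega>)"
    using assms unfolding whp_def by blast
  then show ?thesis
  proof eventually_elim
    case (elim n)
    then obtain B where B [measurable]: "B \<in> sets Omega" and "Om.prob B < \<delta>"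
      and Q: "\<And>\<omega>. regular \<omega> \<Longrightarrow> \<omega> \<notin> B \<Longrightarrow> Q n \<omega>"
      by blast
    have "\<P>(\<omega> in Omega. \<not> Q n \<omega>) \<le> \<P>(\<omega> in Omega. \<omega> \<in> B)"
      using Q by (intro prob_mono_regular) auto
    then show ?case
      using \<open>Om.prob B < \<delta>\<close> by (simp add: space_Omega)
  qed
qed

lemma whp_card_less:
  assumes fin: "\<And>n. finite (I n)" and pred: "\<And>n i. i \<in> I n \<Longrightarrow> Measurable.pred Omega (Q n i)"
    and pos: "\<forall>\<^sub>F n in sequentially. 0 < c n"
    and lim: "(\<lambda>n. (\<Sum>i\<in>I n. \<P>(\<omega> in Omega. Q n i \<omega>)) / c n) \<longlonglongrightarrow> 0"
  shows "whp (\<lambda>n \<omega>. real (card {i \<in> I n. Q n i \<omega>}) < c n)"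
proof (rule whpI_prob)
  fix n
  have "Measurable.pred Omega (\<lambda>\<omega>. \<not> c n \<le> real (card {i \<in> I n. Q n i \<omega>}))"
    by (intro pred_intros_logic Om.pred_card_ge fin pred)
  then show "Measurable.pred Omega (\<lambda>\<omega>. real (card {i \<in> I n. Q n i \<omega>}) < c n)"
    by (simp add: not_le)
next
  have "\<forall>\<^sub>F n in sequentially. \<P>(\<omega> in Omega. \<not> real (card {i \<in> I n. Q n i \<omega>}) < c n) \<le>
      (\<Sum>i\<in>I n. \<P>(\<omega> in Omega. Q n i \<omega>)) / c n"
    using pos by eventually_elim (simp add: not_less Om.prob_card_ge_le fin pred)
  then show "(\<lambda>n. \<P>(\<omega> in Omega. \<not> real (card {i \<in> I n. Q n i \<omega>}) < c n)) \<longlonglongrightarrow> 0"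
    using lim by (rule tendsto_sandwich[OF _ _ tendsto_const, rotated]) simp
qed

lemma sum_prob_le_outside:
  assumes fin: "finite I" and pred: "\<And>i. i \<in> I \<Longrightarrow> Measurable.pred Omega (Q i)"
    and B [measurable]: "B \<in> sets Omega" and m: "0 \<le> m"
    and few: "\<And>\<omega>. regular \<omega> \<Longrightarrow> \<omega> \<notin> B \<Longrightarrow> real (card {i \<in> I. Q i \<omega>}) \<le> m"
  shows "(\<Sum>i\<in>I. \<P>(\<omega> in Omega. Q i \<omega>)) \<le> m + real (card I) * Om.prob B"
proof -
  have Q: "Measurable.pred Omega (\<lambda>\<omega>. Q i \<omega> \<and> \<omega> \<notin> B)" if "i \<in> I" for i
    using pred[OF that] by measurable
  have "(\<Sum>i\<in>I. \<P>(\<omega> in Omega. Q i \<omega>)) \<le> (\<Sum>i\<in>I. \<P>(\<omega> in Omega. Q i \<omega> \<and> \<omega> \<notin> B) + Om.prob B)"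
  proof (rule sum_mono)
    fix i assume i: "i \<in> I"
    have "\<P>(\<omega> in Omega. Q i \<omega>) \<le> \<P>(\<omega> in Omega. (Q i \<omega> \<and> \<omega> \<notin> B) \<or> \<omega> \<in> B)"
      using Q[OF i] by (intro Om.prob_mono_AE) auto
    also have "\<dots> \<le> \<P>(\<omega> in Omega. Q i \<omega> \<and> \<omega> \<notin> B) + \<P>(\<omega> in Omega. \<omega> \<in> B)"
      using Q[OF i] by (intro Om.prob_disj_le) auto
    finally show "\<P>(\<omega> in Omega. Q i \<omega>) \<le> \<P>(\<omega> in Omega. Q i \<omega> \<and> \<omega> \<notin> B) + Om.prob B"
      by (simp add: space_Omega)
  qed
  also have "\<dots> = (\<Sum>i\<in>I. \<P>(\<omega> in Omega. Q i \<omega> \<and> \<omega> \<notin> B)) + real (card I) * Om.prob B"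
    by (simp add: sum.distrib)
  also have "(\<Sum>i\<in>I. \<P>(\<omega> in Omega. Q i \<omega> \<and> \<omega> \<notin> B)) \<le> m"
  proof (rule Om.sum_prob_le_if_card_le[OF fin Q])
    show "AE \<omega> in Omega. real (card {i \<in> I. Q i \<omega> \<and> \<omega> \<notin> B}) \<le> m"
      using AE_regular
    proof eventually_elim
      case (elim \<omega>)
      then show ?case
        using few[of \<omega>] m by (cases "\<omega> \<in> B") simp_all
    qed
  qed
  finally show ?thesis
    by simp
qed

lemma sum_prob_tendsto_0:
  assumes fin: "\<And>n. finite (I n)" and pred: "\<And>n i. i \<in> I n \<Longrightarrow> Measurable.pred Omega (Q n i)"
    and pos: "\<forall>\<^sub>F n in sequentially. 0 < c n" and card: "\<And>n. real (card (I n)) \<le> c n"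
    and few: "\<And>\<epsilon>. 0 < \<epsilon> \<Longrightarrow> whp (\<lambda>n \<omega>. real (card {i \<in> I n. Q n i \<omega>}) \<le> \<epsilon> * c n)"
  shows "(\<lambda>n. (\<Sum>i\<in>I n. \<P>(\<omega> in Omega. Q n i \<omega>)) / c n) \<longlonglongrightarrow> 0"
proof (rule tendstoI)
  fix e :: real assume "0 < e"
  then have e: "0 < e / 2"
    by simp
  then have "\<forall>\<^sub>F n in sequentially. \<exists>B\<in>sets Omega. Om.prob B < e / 2 \<and>
      (\<forall>\<omega>. regular \<omega> \<longrightarrow> \<omega> \<notin> B \<longrightarrow> real (card {i \<in> I n. Q n i \<omega>}) \<le> e / 2 * c n)"
    using few[OF e] unfolding whp_def by blast
  with pos show "\<forall>\<^sub>F n in sequentially. dist ((\<Sum>i\<in>I n. \<P>(\<omega> in Omega. Q n i \<omega>)) / c n) 0 < e"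
  proof eventually_elim
    case (elim n)
    then obtain B where B: "B \<in> sets Omega" "Om.prob B < e / 2"
      and few_outside: "\<And>\<omega>. regular \<omega> \<Longrightarrow> \<omega> \<notin> B \<Longrightarrow>
        real (card {i \<in> I n. Q n i \<omega>}) \<le> e / 2 * c n"
      by blast
    have "0 \<le> e / 2 * c n"
      using e elim(1) by simp
    then have "(\<Sum>i\<in>I n. \<P>(\<omega> in Omega. Q n i \<omega>)) \<le> e / 2 * c n + real (card (I n)) * Om.prob B"
      by (intro sum_prob_le_outside fin pred B(1) few_outside)
    also have "real (card (I n)) * Om.prob B \<le> c n * Om.prob B"
      using card by (intro mult_right_mono) auto
    also have "\<dots> < c n * (e / 2)"
      using B(2) elim(1) by simp
    finally have "(\<Sum>i\<in>I n. \<P>(\<omega> in Omega. Q n i \<omega>)) < e * c n"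
      by (simp add: mult.commute)
    then show ?case
      using elim(1) by (simp add: pos_divide_less_eq sum_nonneg)
  qed
qed

lemma whp_witness:
  assumes "whp Q" "0 < c" "\<forall>\<^sub>F n in sequentially. c \<le> \<P>(\<omega> in Omega. E n \<omega>)"
  shows "\<forall>\<^sub>F n in sequentially. \<exists>\<omega>. regular \<omega> \<and> E n \<omega> \<and> Q n \<omega>"
proof -
  have "\<forall>\<^sub>F n in sequentially. \<exists>B\<in>sets Omega. Om.prob B < c \<and> (\<forall>\<omega>. regular \<omega> \<longrightarrow> \<omega> \<notin> B \<longrightarrow> Q n \<omega>)"
    using assms(1,2) unfolding whp_def by blast
  with assms(3) show ?thesis
  proof eventually_elim
    case (elim n)
    then obtain B where B: "B \<in> sets Omega" "Om.prob B < c" "\<And>\<omega>. regular \<omega> \<Longrightarrow> \<omega> \<notin> B \<Longrightarrow> Q n \<omega>"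
      by blast
    have "\<P>(\<omega> in Omega. E n \<omega>) \<le> \<P>(\<omega> in Omega. \<omega> \<in> B)" if "\<And>\<omega>. regular \<omega> \<Longrightarrow> E n \<omega> \<Longrightarrow> \<omega> \<in> B"
      using B(1) that by (intro prob_mono_regular) auto
    moreover have "\<P>(\<omega> in Omega. \<omega> \<in> B) = Om.prob B"
      by (simp add: space_Omega)
    ultimately show ?case
      using B elim by fastforce
  qed
qed

lemma whp_exists:
  assumes "whp Q"
  shows "\<forall>\<^sub>F n in sequentially. \<exists>\<omega>. regular \<omega> \<and> Q n \<omega>"
  using whp_witness[OF assms, of 1 "\<lambda>_ _. True"] Om.prob_space by simp

definition giant_limit :: "nat \<Rightarrow> real \<Rightarrow> real \<Rightarrow> bool" where
  "giant_limit k t x \<longleftrightarrow> (\<forall>\<epsilon>>0. whp (\<lambda>n \<omega>.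
     (x - \<epsilon>) * real n \<le> real (C1 n (G_rel n \<omega> t k)) \<and>
     real (C1 n (G_rel n \<omega> t k)) \<le> (x + \<epsilon>) * real n))"

lemma giant_limitD:
  "giant_limit k t x \<Longrightarrow> 0 < \<epsilon> \<Longrightarrow> whp (\<lambda>n \<omega>.
     (x - \<epsilon>) * real n \<le> real (C1 n (G_rel n \<omega> t k)) \<and>
     real (C1 n (G_rel n \<omega> t k)) \<le> (x + \<epsilon>) * real n)"
  by (simp add: giant_limit_def)

lemma conv_unif_prob_imp_giant_limit:
  assumes "conv_unif_prob k f" "0 \<le> t"
  shows "giant_limit k t (f t)"
  unfolding giant_limit_def whp_def
proof (intro allI impI)
  fix \<epsilon> \<delta> :: real assume "0 < \<epsilon>" "0 < \<delta>"
  let ?C = "\<lambda>n \<omega>. real (C1 n (G_rel n \<omega> t k))"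
  have "\<forall>\<^sub>F n in sequentially. \<exists>B\<in>sets Omega. Om.prob B < \<delta> \<and>
        {\<omega>\<in>space Omega. \<exists>t\<ge>0. \<bar>real (C1 n (G_rel n \<omega> t k)) / real n - f t\<bar> > \<epsilon>} \<subseteq> B"
    using assms(1) \<open>0 < \<epsilon>\<close> \<open>0 < \<delta>\<close> unfolding conv_unif_prob_def eventually_sequentially by blast
  with eventually_gt_at_top[of 0]
  show "\<forall>\<^sub>F n in sequentially. \<exists>B\<in>sets Omega. Om.prob B < \<delta> \<and> (\<forall>\<omega>. regular \<omega> \<longrightarrow> \<omega> \<notin> B \<longrightarrow>
      (f t - \<epsilon>) * real n \<le> ?C n \<omega> \<and> ?C n \<omega> \<le> (f t + \<epsilon>) * real n)"
  proof eventually_elim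
    case (elim n)
    then obtain B where B: "B \<in> sets Omega" "Om.prob B < \<delta>"
      and close: "\<And>\<omega>. \<omega> \<notin> B \<Longrightarrow> \<bar>?C n \<omega> / real n - f t\<bar> \<le> \<epsilon>"
      using assms(2) by (force simp: space_Omega not_less)
    have "(f t - \<epsilon>) * real n \<le> ?C n \<omega> \<and> ?C n \<omega> \<le> (f t + \<epsilon>) * real n" if "\<omega> \<notin> B" for \<omega>
      using close[OF that] elim(1) by (auto simp: abs_le_iff field_simps)
    then show ?case
      using B by blast
  qed
qed

lemma giant_limit_le:
  assumes "giant_limit j s x" "giant_limit k t y"
    and le: "\<And>n \<omega>. 0 < n \<Longrightarrow> regular \<omega> \<Longrightarrow> C1 n (G_rel n \<omega> s j) \<le> C1 n (G_rel n \<omega> t k)"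
  shows "x \<le> y"
proof (rule field_le_epsilon)
  fix e :: real assume "0 < e"
  then have e: "0 < e / 2"
    by simp
  have "\<forall>\<^sub>F n in sequentially. x * real n \<le> (y + e) * real n"
    using whp_exists[OF whp_conj[OF giant_limitD[OF assms(1) e] giant_limitD[OF assms(2) e]]]
      eventually_gt_at_top[of 0]
  proof eventually_elim
    case (elim n)
    then obtain \<omega> where \<omega>: "regular \<omega>" "(x - e / 2) * real n \<le> real (C1 n (G_rel n \<omega> s j))"
      "real (C1 n (G_rel n \<omega> t k)) \<le> (y + e / 2) * real n"
      by blast
    then have "(x - e / 2) * real n \<le> (y + e / 2) * real n"
      using le[OF elim(2) \<omega>(1)] by linarith
    then show ?case
      by (simp add: algebra_simps)
  qed
  then have "\<forall>\<^sub>F n in sequentially. x \<le> y + e"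
    using eventually_gt_at_top[of 0] by eventually_elim simp
  then show "x \<le> y + e"
    by simp
qed

subsection \<open>Subcritical edges\<close>

definition late_rel :: "nat \<Rightarrow> real \<Rightarrow> real \<Rightarrow> sample \<Rightarrow> (nat \<times> nat) set" where
  "late_rel n a t \<omega> = {p \<in> {..<n} \<times> {..<n}.
     a < gap n \<omega> (pair_of (fst p) (snd p)) 0 \<and> gap n \<omega> (pair_of (fst p) (snd p)) 0 \<le> t}"

lemma sym_late_rel: "sym (late_rel n a t \<omega>)"
  by (auto simp: sym_def late_rel_def pair_of_commute)

lemma late_conn_measurable [measurable]: "Measurable.pred Omega (\<lambda>\<omega>. p \<in> (late_rel n a t \<omega>)\<^sup>*)"
  unfolding late_rel_def by (rule pred_finite_random_subset) auto

definition distinct_paths :: "nat \<Rightarrow> nat \<Rightarrow> nat \<Rightarrow> nat list set" where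
  "distinct_paths n x l = {xs. set xs \<subseteq> {..<n} \<and> length xs = l \<and> distinct (x # xs)}"

lemma distinct_paths_subset: "distinct_paths n x l \<subseteq> {xs. set xs \<subseteq> {..<n} \<and> length xs = l}"
  by (auto simp: distinct_paths_def)

lemma finite_distinct_paths [simp]: "finite (distinct_paths n x l)"
  using finite_subset[OF distinct_paths_subset] by (simp add: finite_lists_length_eq)

lemma card_distinct_paths_le: "card (distinct_paths n x l) \<le> n ^ l"
  using card_mono[OF _ distinct_paths_subset, of n l x]
  by (simp add: finite_lists_length_eq card_lists_length_eq)

lemma rtrancl_imp_distinct_path:
  assumes R: "R \<subseteq> {..<n} \<times> {..<n}" and x: "x < n" and "(x, y) \<in> R\<^sup>*"
  obtains l xs where "l < n" "xs \<in> distinct_paths n x l" "last (x # xs) = y"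
    "\<And>i. i < l \<Longrightarrow> ((x # xs) ! i, xs ! i) \<in> R"
proof -
  have "(\<lambda>x y. (x, y) \<in> R)\<^sup>*\<^sup>* x y"
    using assms(3) by (simp add: rtranclp_rtrancl_eq)
  then obtain xs where path: "rtrancl_path (\<lambda>x y. (x, y) \<in> R) x xs y" and dist: "distinct (x # xs)"
    unfolding rtranclp_eq_rtrancl_path by (meson rtrancl_path_distinct)
  have xs: "set (x # xs) \<subseteq> {..<n}"
    using R x rtrancl_path_Range[OF path] by fastforce
  then have "card (set (x # xs)) \<le> card {..<n}"
    by (intro card_mono) auto
  then have "length xs < n"
    unfolding distinct_card[OF dist] by simp
  moreover have "xs \<in> distinct_paths n x (length xs)"
    using xs dist by (simp add: distinct_paths_def)
  moreover have "last (x # xs) = y"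
    using path rtrancl_path_last[OF path] by (cases xs) (auto elim: rtrancl_path.cases)
  ultimately show thesis
    using that rtrancl_path_nth[OF path] by blast
qed

definition late_path :: "nat \<Rightarrow> real \<Rightarrow> real \<Rightarrow> nat \<Rightarrow> nat list \<Rightarrow> sample \<Rightarrow> bool" where
  "late_path n a t x xs \<omega> \<longleftrightarrow> (\<forall>i\<in>{..<length xs}.
     a < gap n \<omega> (pair_of ((x # xs) ! i) (xs ! i)) 0 \<and>
     gap n \<omega> (pair_of ((x # xs) ! i) (xs ! i)) 0 \<le> t)"

lemma late_path_measurable [measurable]: "Measurable.pred Omega (late_path n a t x xs)"
  unfolding late_path_def[abs_def] by measurable

lemma prob_late_path_le:
  assumes "0 < n" "0 \<le> a" "a \<le> t" and dist: "distinct (x # xs)"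
  shows "\<P>(\<omega> in Omega. late_path n a t x xs \<omega>) \<le> ((t - a) / real n) ^ length xs"
proof -
  let ?p = "\<lambda>i. pair_of ((x # xs) ! i) (xs ! i)"
  have inj: "i = j" if "i < length xs" "j < length xs" "?p i = ?p j" for i j
  proof -
    have eq_iff: "(x # xs) ! i = (x # xs) ! j \<longleftrightarrow> i = j" if "i \<le> length xs" "j \<le> length xs" for i j
      using that nth_eq_iff_index_eq[OF dist, of i j] by (simp del: distinct.simps)
    have "{(x # xs) ! i, (x # xs) ! Suc i} = {(x # xs) ! j, (x # xs) ! Suc j}"
      using that(3) by (simp add: pair_of_eq_iff)
    then have "i = j \<or> i = Suc j \<and> Suc i = j"
      unfolding doubleton_eq_iff
      using that(1,2) eq_iff[of i j] eq_iff[of i "Suc j"] eq_iff[of "Suc i" j] by auto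
    then show ?thesis
      by auto
  qed
  have "\<P>(\<omega> in Omega. late_path n a t x xs \<omega>) =
      (\<Prod>i<length xs. \<P>(\<omega> in Omega. a < gap n \<omega> (?p i) 0 \<and> gap n \<omega> (?p i) 0 \<le> t))"
    unfolding late_path_def
  proof (rule prob_Ball_indep)
    show "disjoint_family_on (\<lambda>i. {(fst (?p i), snd (?p i), 0)}) {..<length xs}"
      using inj by (auto simp: disjoint_family_on_def prod_eq_iff)
    show "depends_on {(fst (?p i), snd (?p i), 0)} 
        (\<lambda>\<omega>. a < gap n \<omega> (?p i) 0 \<and> gap n \<omega> (?p i) 0 \<le> t)" for i
      using depends_on_gap[of "?p i" 0 "\<lambda>g. a < g \<and> g \<le> t" n] by simp
  qed auto
  also have "\<dots> \<le> (\<Prod>i<length xs. (t - a) / real n)"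
    using assms by (intro prod_mono) (auto intro: prob_gap_between_le)
  finally show ?thesis
    by simp
qed

lemma card_late_conn_le:
  assumes x: "x < n"
  shows "card {y \<in> {..<n}. (x, y) \<in> (late_rel n a t \<omega>)\<^sup>*} \<le>
    card {xs \<in> (\<Union>l<n. distinct_paths n x l). late_path n a t x xs \<omega>}"
proof (rule surj_card_le)
  show "{y \<in> {..<n}. (x, y) \<in> (late_rel n a t \<omega>)\<^sup>*} \<subseteq>
      (\<lambda>xs. last (x # xs)) ` {xs \<in> (\<Union>l<n. distinct_paths n x l). late_path n a t x xs \<omega>}"
  proof
    fix y assume "y \<in> {y \<in> {..<n}. (x, y) \<in> (late_rel n a t \<omega>)\<^sup>*}"
    then have conn: "(x, y) \<in> (late_rel n a t \<omega>)\<^sup>*"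
      by simp
    have "late_rel n a t \<omega> \<subseteq> {..<n} \<times> {..<n}"
      by (auto simp: late_rel_def)
    then obtain l xs where xs: "l < n" "xs \<in> distinct_paths n x l" "last (x # xs) = y"
      "\<And>i. i < l \<Longrightarrow> ((x # xs) ! i, xs ! i) \<in> late_rel n a t \<omega>"
      using rtrancl_imp_distinct_path[OF _ x conn] by blast
    then have "late_path n a t x xs \<omega>"
      by (auto simp: late_path_def late_rel_def distinct_paths_def)
    then show "y \<in> (\<lambda>xs. last (x # xs)) `
        {xs \<in> (\<Union>l<n. distinct_paths n x l). late_path n a t x xs \<omega>}"
      using xs by (intro image_eqI[of _ _ xs]) auto
  qed
qed simp

lemma sum_prob_late_conn_le:
  assumes a: "0 \<le> a" "a \<le> t" "t < a + 1" and x: "x < n"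
  shows "(\<Sum>y<n. \<P>(\<omega> in Omega. (x, y) \<in> (late_rel n a t \<omega>)\<^sup>*)) \<le> 1 / (1 - (t - a))"
proof -
  let ?I = "\<Union>l<n. distinct_paths n x l"
  have n: "0 < n"
    using x by simp
  have "(\<Sum>y<n. \<P>(\<omega> in Omega. (x, y) \<in> (late_rel n a t \<omega>)\<^sup>*)) \<le>
      (\<Sum>xs\<in>?I. \<P>(\<omega> in Omega. late_path n a t x xs \<omega>))"
    using card_late_conn_le[OF x] by (intro Om.sum_prob_mono) auto
  also have "\<dots> = (\<Sum>l<n. \<Sum>xs\<in>distinct_paths n x l. \<P>(\<omega> in Omega. late_path n a t x xs \<omega>))"
    by (intro sum.UNION_disjoint ballI finite_lessThan finite_distinct_paths)
      (auto simp: distinct_paths_def)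
  also have "\<dots> \<le> (\<Sum>l<n. (t - a) ^ l)"
  proof (rule sum_mono)
    fix l
    have "(\<Sum>xs\<in>distinct_paths n x l. \<P>(\<omega> in Omega. late_path n a t x xs \<omega>)) \<le>
        (\<Sum>xs\<in>distinct_paths n x l. ((t - a) / real n) ^ l)"
      using prob_late_path_le[OF n a(1,2)] by (intro sum_mono) (auto simp: distinct_paths_def)
    also have "\<dots> = real (card (distinct_paths n x l)) * ((t - a) / real n) ^ l"
      by simp
    also have "\<dots> \<le> real (n ^ l) * ((t - a) / real n) ^ l"
      using a card_distinct_paths_le by (intro mult_right_mono of_nat_mono) auto
    also have "\<dots> = (t - a) ^ l"
      using n by (simp add: power_divide)
    finally show "(\<Sum>xs\<in>distinct_paths n x l. \<P>(\<omega> in Omega. late_path n a t x xs \<omega>)) \<le> (t - a) ^ l" .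
  qed
  also have "\<dots> \<le> (\<Sum>l. (t - a) ^ l)"
    using a by (intro sum_le_suminf summable_geometric) auto
  also have "\<dots> = 1 / (1 - (t - a))"
    using a by (intro suminf_geometric) auto
  finally show ?thesis .
qed

lemma prob_few_late_conn:
  fixes a t :: real
  defines "D \<equiv> 1 / (1 - (t - a))"
  assumes a: "0 \<le> a" "a \<le> t" "t < a + 1" and n: "0 < n"
  shows "1 / 2 \<le>
    \<P>(\<omega> in Omega. real (\<Sum>v<n. card (component n (late_rel n a t \<omega>) v)) \<le> 2 * D * real n)"
proof -
  let ?V = "{..<n} \<times> {..<n}" and ?H = "late_rel n a t"
  have D: "0 < D"
    using a by (simp add: D_def)
  have "(\<Sum>p\<in>?V. \<P>(\<omega> in Omega. p \<in> (?H \<omega>)\<^sup>*)) = (\<Sum>x<n. \<Sum>y<n. \<P>(\<omega> in Omega. (x, y) \<in> (?H \<omega>)\<^sup>*))"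
    by (simp add: sum.cartesian_product case_prod_unfold)
  also have "\<dots> \<le> (\<Sum>x<n. D)"
    unfolding D_def by (intro sum_mono sum_prob_late_conn_le a) simp
  finally have "(\<Sum>p\<in>?V. \<P>(\<omega> in Omega. p \<in> (?H \<omega>)\<^sup>*)) / (2 * D * real n) \<le> 1 / 2"
    using D n by (simp add: field_simps)
  moreover have "\<P>(\<omega> in Omega. 2 * D * real n \<le> real (card {p \<in> ?V. p \<in> (?H \<omega>)\<^sup>*})) \<le>
      (\<Sum>p\<in>?V. \<P>(\<omega> in Omega. p \<in> (?H \<omega>)\<^sup>*)) / (2 * D * real n)"
    using D n by (intro Om.prob_card_ge_le) auto
  ultimately have "1 / 2 \<le> 1 - \<P>(\<omega> in Omega. 2 * D * real n \<le> real (card {p \<in> ?V. p \<in> (?H \<omega>)\<^sup>*}))"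
    by linarith
  also have "\<dots> = \<P>(\<omega> in Omega. \<not> 2 * D * real n \<le> real (card {p \<in> ?V. p \<in> (?H \<omega>)\<^sup>*}))"
    by (rule Om.prob_neg[symmetric]) (auto intro: Om.pred_card_ge)
  also have "\<dots> \<le> \<P>(\<omega> in Omega. real (\<Sum>v<n. card (component n (?H \<omega>) v)) \<le> 2 * D * real n)"
  proof (rule Om.prob_mono_AE)
    show "Measurable.pred Omega (\<lambda>\<omega>. real (\<Sum>v<n. card (component n (?H \<omega>) v)) \<le> 2 * D * real n)"
      unfolding late_rel_def by (rule pred_finite_random_subset) auto
  qed (simp add: card_rtrancl_pairs)
  finally show ?thesis .
qed

subsection \<open>Early edges and the threshold\<close>

text \<open>The pairs that may contribute an edge of \<open>G\<^sub>j\<^sub>+\<^sub>1(t)\<close> other than a single arrival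
  after time \<open>a\<close>.\<close>

definition bad_pair :: "nat \<Rightarrow> real \<Rightarrow> real \<Rightarrow> nat \<Rightarrow> nat \<times> nat \<Rightarrow> sample \<Rightarrow> bool" where
  "bad_pair n a t j p \<omega> \<longleftrightarrow> gap n \<omega> p 0 \<le> t \<and> gap n \<omega> p (Suc 0) \<le> t \<or>
     p \<in> (G_rel n (delete_until a {p} \<omega>) a j)\<^sup>* \<and> gap n \<omega> p 0 \<le> a"

lemma bad_pair_measurable [measurable]: "Measurable.pred Omega (bad_pair n a t j p)"
  unfolding bad_pair_def[abs_def] by measurable

lemma G_rel_Suc_subset:
  assumes reg: "regular \<omega>" and n: "0 < n" and a: "0 \<le> a" "a \<le> t" and j: "a = 0 \<or> 1 \<le> j"
  shows "G_rel n \<omega> t (Suc j) \<subseteq> late_rel n a t \<omega> \<union>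
    UNIV \<times> (\<Union>p\<in>{p \<in> pairs n. bad_pair n a t j p \<omega>}. {fst p, snd p})"
proof
  fix q assume "q \<in> G_rel n \<omega> t (Suc j)"
  then obtain e l where e: "(e, l) \<in> set (labelled (arrivals n \<omega> t))" "Suc j \<le> l"
    and q: "ends e = q \<or> ends e = prod.swap q"
    by (cases q) (auto simp: G_rel_eq level_rel_iff)
  define p where "p = ends e"
  have arrived: "e \<in> edges_upto n \<omega> t"
    using labelled_imp_mem[OF e(1)] set_arrivals[OF reg] by simp
  then have p: "p \<in> pairs n" "gap n \<omega> p 0 \<le> t"
    using first_gap_le[OF reg] by (auto simp: p_def edges_upto_iff)
  have "bad_pair n a t j p \<omega>" if early: "gap n \<omega> p 0 \<le> a"
  proof (cases "gap n \<omega> p (Suc 0) \<le> t")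
    case True
    then show ?thesis
      using p by (simp add: bad_pair_def)
  next
    case False
    then have "e = first_edge p"
      using first_edge_if_second_gap_greater[OF reg arrived] by (simp add: p_def)
    moreover have "0 < gap n \<omega> p 0"
      using reg n by (simp add: gap_def regular_def)
    then have "1 \<le> j"
      using j early by auto
    ultimately have "p \<in> (G_rel n (delete_until a {p} \<omega>) a j)\<^sup>*"
      using connected_without_edge[OF reg n a p(1) early, of l j] e False a(2) by simp
    then show ?thesis
      using early by (simp add: bad_pair_def)
  qed
  moreover have "q \<in> late_rel n a t \<omega>" if "a < gap n \<omega> p 0"
  proof -
    have "pair_of (fst q) (snd q) = p"
      using q p(1) by (cases q) (auto simp: p_def pair_of_def pairs_def)
    then show ?thesis
      using that p q by (cases q) (auto simp: late_rel_def p_def pairs_def)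
  qed
  ultimately show "q \<in> late_rel n a t \<omega> \<union>
      UNIV \<times> (\<Union>p\<in>{p \<in> pairs n. bad_pair n a t j p \<omega>}. {fst p, snd p})"
    using p(1) q unfolding p_def by (cases q) (force simp: not_le)
qed

lemma prob_bad_pair_le:
  assumes n: "0 < n" and a: "0 \<le> a" "a \<le> t" and p: "p \<in> pairs n"
  shows "\<P>(\<omega> in Omega. bad_pair n a t j p \<omega>) \<le>
    (t / real n)\<^sup>2 + a * exp a / real n * \<P>(\<omega> in Omega. p \<in> (G_rel n \<omega> a j)\<^sup>*)"
proof -
  let ?C = "\<lambda>\<omega>. p \<in> (G_rel n (delete_until a {p} \<omega>) a j)\<^sup>*"
  have "\<P>(\<omega> in Omega. gap n \<omega> p 0 \<le> t \<and> gap n \<omega> p (Suc 0) \<le> t) =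
      \<P>(\<omega> in Omega. gap n \<omega> p 0 \<le> t) * \<P>(\<omega> in Omega. gap n \<omega> p (Suc 0) \<le> t)"
    by (rule prob_conj_indep[OF _ _ depends_on_gap depends_on_gap]) auto
  also have "\<dots> \<le> t / real n * (t / real n)"
    using a n by (intro mult_mono prob_gap_le) auto
  finally have double: "\<P>(\<omega> in Omega. gap n \<omega> p 0 \<le> t \<and> gap n \<omega> p (Suc 0) \<le> t) \<le> (t / real n)\<^sup>2"
    by (simp add: power2_eq_square)
  have "depends_on {(fst p, snd p, 0)} (\<lambda>\<omega>. gap n \<omega> p 0 \<le> a)"
    by (rule depends_on_gap)
  then have "\<P>(\<omega> in Omega. ?C \<omega> \<and> gap n \<omega> p 0 \<le> a) =
      \<P>(\<omega> in Omega. ?C \<omega>) * \<P>(\<omega> in Omega. gap n \<omega> p 0 \<le> a)"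
    by (intro prob_conj_indep[OF _ _ depends_on_delete_until]) auto
  also have "\<dots> \<le> (exp a * \<P>(\<omega> in Omega. p \<in> (G_rel n \<omega> a j)\<^sup>*)) * (a / real n)"
    using n a p by (intro mult_mono prob_delete_until_le prob_gap_le) auto
  finally have early: "\<P>(\<omega> in Omega. ?C \<omega> \<and> gap n \<omega> p 0 \<le> a) \<le>
      a * exp a / real n * \<P>(\<omega> in Omega. p \<in> (G_rel n \<omega> a j)\<^sup>*)"
    by (simp add: mult_ac)
  have "\<P>(\<omega> in Omega. bad_pair n a t j p \<omega>) \<le>
      \<P>(\<omega> in Omega. gap n \<omega> p 0 \<le> t \<and> gap n \<omega> p (Suc 0) \<le> t) +
      \<P>(\<omega> in Omega. ?C \<omega> \<and> gap n \<omega> p 0 \<le> a)"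
    unfolding bad_pair_def by (rule Om.prob_disj_le) auto
  then show ?thesis
    using double early by linarith
qed

lemma sum_prob_conn_tendsto_0:
  assumes "giant_limit j a 0"
  shows "(\<lambda>n. (\<Sum>p\<in>pairs n. \<P>(\<omega> in Omega. p \<in> (G_rel n \<omega> a j)\<^sup>*)) / (real n)\<^sup>2) \<longlonglongrightarrow> 0"
proof (rule sum_prob_tendsto_0)
  fix \<epsilon> :: real assume "0 < \<epsilon>"
  from giant_limitD[OF assms this]
  show "whp (\<lambda>n \<omega>. real (card {p \<in> pairs n. p \<in> (G_rel n \<omega> a j)\<^sup>*}) \<le> \<epsilon> * (real n)\<^sup>2)"
  proof (rule whp_mono)
    fix n \<omega>
    assume "(0 - \<epsilon>) * real n \<le> real (C1 n (G_rel n \<omega> a j)) \<and>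
        real (C1 n (G_rel n \<omega> a j)) \<le> (0 + \<epsilon>) * real n"
    then have "real (n * C1 n (G_rel n \<omega> a j)) \<le> real n * (\<epsilon> * real n)"
      unfolding of_nat_mult by (intro mult_left_mono) auto
    with of_nat_mono[OF card_rtrancl_pairs_le, of n "G_rel n \<omega> a j", where 'a = real]
    show "real (card {p \<in> pairs n. p \<in> (G_rel n \<omega> a j)\<^sup>*}) \<le> \<epsilon> * (real n)\<^sup>2"
      by (simp add: power2_eq_square mult_ac)
  qed
next
  show "real (card (pairs n)) \<le> (real n)\<^sup>2" for n
    by (rule card_pairs_le)
  show "\<forall>\<^sub>F n in sequentially. 0 < (real n)\<^sup>2"
    using eventually_gt_at_top[of 0] by eventually_elim simp
qed auto

lemma sum_prob_bad_pairs_le: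
  assumes n: "0 < n" and a: "0 \<le> a" "a \<le> t"
  shows "(\<Sum>p\<in>pairs n. \<P>(\<omega> in Omega. bad_pair n a t j p \<omega>)) \<le> t\<^sup>2 +
    a * exp a * (\<Sum>p\<in>pairs n. \<P>(\<omega> in Omega. p \<in> (G_rel n \<omega> a j)\<^sup>*)) / real n"
proof -
  have "(\<Sum>p\<in>pairs n. \<P>(\<omega> in Omega. bad_pair n a t j p \<omega>)) \<le>
      (\<Sum>p\<in>pairs n. (t / real n)\<^sup>2 + a * exp a / real n * \<P>(\<omega> in Omega. p \<in> (G_rel n \<omega> a j)\<^sup>*))"
    by (intro sum_mono prob_bad_pair_le n a)
  also have "\<dots> = real (card (pairs n)) * (t / real n)\<^sup>2 +
      a * exp a / real n * (\<Sum>p\<in>pairs n. \<P>(\<omega> in Omega. p \<in> (G_rel n \<omega> a j)\<^sup>*))"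
    by (simp only: sum.distrib sum_distrib_left sum_constant)
  also have "real (card (pairs n)) * (t / real n)\<^sup>2 \<le> (real n)\<^sup>2 * (t / real n)\<^sup>2"
    by (intro mult_right_mono card_pairs_le) simp
  also have "\<dots> = t\<^sup>2"
    using n by (simp add: power_divide)
  finally show ?thesis
    by simp
qed

lemma whp_few_bad_pairs:
  assumes a: "0 \<le> a" "a \<le> t" and start: "a = 0 \<or> giant_limit j a 0" and \<eta>: "0 < \<eta>"
  shows "whp (\<lambda>n \<omega>. real (card {p \<in> pairs n. bad_pair n a t j p \<omega>}) < \<eta> * real n)"
proof (rule whp_card_less)
  let ?S = "\<lambda>n. \<Sum>p\<in>pairs n. \<P>(\<omega> in Omega. bad_pair n a t j p \<omega>)"
  define conn where "conn n = (\<Sum>p\<in>pairs n. \<P>(\<omega> in Omega. p \<in> (G_rel n \<omega> a j)\<^sup>*)) / (real n)\<^sup>2" for n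
  have bound: "?S n / (\<eta> * real n) \<le> (t\<^sup>2 / real n + exp a * (a * conn n)) / \<eta>" if n: "0 < n" for n
  proof -
    have "?S n \<le> (t\<^sup>2 / real n + exp a * (a * conn n)) * real n"
      using sum_prob_bad_pairs_le[OF n a, of j] n
      by (simp add: conn_def power2_eq_square algebra_simps)
    then have "?S n / real n / \<eta> \<le> (t\<^sup>2 / real n + exp a * (a * conn n)) / \<eta>"
      using n \<eta> by (intro divide_right_mono) (simp_all add: pos_divide_le_eq)
    then show ?thesis
      by (simp add: mult.commute)
  qed
  have "(\<lambda>n. a * conn n) \<longlonglongrightarrow> 0"
  proof (cases "a = 0")
    case False
    then show ?thesis
      using start unfolding conn_def by (intro tendsto_mult_right_zero sum_prob_conn_tendsto_0) simp
  qed simp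
  then have "(\<lambda>n. (t\<^sup>2 / real n + exp a * (a * conn n)) / \<eta>) \<longlonglongrightarrow> (0 + exp a * 0) / \<eta>"
    using \<eta> by (intro tendsto_intros lim_const_over_n) auto
  then have lim: "(\<lambda>n. (t\<^sup>2 / real n + exp a * (a * conn n)) / \<eta>) \<longlonglongrightarrow> 0"
    by simp
  show "(\<lambda>n. ?S n / (\<eta> * real n)) \<longlonglongrightarrow> 0"
  proof (rule tendsto_sandwich[OF _ _ tendsto_const lim])
    show "\<forall>\<^sub>F n in sequentially. ?S n / (\<eta> * real n) \<le> (t\<^sup>2 / real n + exp a * (a * conn n)) / \<eta>"
      using eventually_gt_at_top[of 0] by eventually_elim (rule bound)
    show "\<forall>\<^sub>F n in sequentially. 0 \<le> ?S n / (\<eta> * real n)"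
      using \<eta> by (intro always_eventually allI divide_nonneg_nonneg sum_nonneg) auto
  qed
  show "\<forall>\<^sub>F n in sequentially. 0 < \<eta> * real n"
    using eventually_gt_at_top[of 0] by eventually_elim (simp add: \<eta>)
qed auto

lemma C1_le_bad_pairs:
  assumes reg: "regular \<omega>" and n: "0 < n" and a: "0 \<le> a" "a \<le> t" and j: "a = 0 \<or> 1 \<le> j"
  shows "L * C1 n (G_rel n \<omega> t (Suc j)) \<le> (\<Sum>v<n. card (component n (late_rel n a t \<omega>) v)) +
    L * (L * (2 * card {p \<in> pairs n. bad_pair n a t j p \<omega>} + 1))"
proof -
  let ?B = "{p \<in> pairs n. bad_pair n a t j p \<omega>}"
  have "card (\<Union>p\<in>?B. {fst p, snd p}) \<le> (\<Sum>p\<in>?B. card {fst p, snd p})"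
    by (intro card_UN_le) simp
  also have "\<dots> \<le> (\<Sum>p\<in>?B. 2)"
    by (intro sum_mono) (simp add: card_insert_if)
  finally have "L * (L * (card (\<Union>p\<in>?B. {fst p, snd p}) + 1)) \<le> L * (L * (2 * card ?B + 1))"
    by (intro mult_left_mono) auto
  with C1_glue_bound[OF n sym_late_rel G_rel_Suc_subset[OF reg n a j], of L]
  show ?thesis
    by (rule order_trans[OF _ add_left_mono]) simp
qed

lemma subcritical_density_le:
  assumes reg: "regular \<omega>" and n: "0 < n" and a: "0 \<le> a" "a \<le> t" and j: "a = 0 \<or> 1 \<le> j"
    and late: "real (\<Sum>v<n. card (component n (late_rel n a t \<omega>) v)) \<le> D * real n"
    and giant: "(y - \<eta>) * real n \<le> real (C1 n (G_rel n \<omega> t (Suc j)))"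
    and bad: "real (card {p \<in> pairs n. bad_pair n a t j p \<omega>}) \<le> \<eta> * real n"
    and L: "(real L)\<^sup>2 \<le> \<eta> * real n"
  shows "real L * y \<le> D + (real L + 2 * (real L)\<^sup>2 + 1) * \<eta>"
proof -
  let ?Z = "\<Sum>v<n. card (component n (late_rel n a t \<omega>) v)"
  let ?b = "card {p \<in> pairs n. bad_pair n a t j p \<omega>}"
  have "real L * real (C1 n (G_rel n \<omega> t (Suc j))) \<le>
      real ?Z + 2 * ((real L)\<^sup>2 * real ?b) + (real L)\<^sup>2"
    using C1_le_bad_pairs[OF reg n a j, of L]
    by (simp add: power2_eq_square algebra_simps flip: of_nat_le_iff[where 'a = real])
  moreover have "real L * ((y - \<eta>) * real n) \<le> real L * real (C1 n (G_rel n \<omega> t (Suc j)))"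
    using giant by (intro mult_left_mono) auto
  moreover have "(real L)\<^sup>2 * real ?b \<le> (real L)\<^sup>2 * (\<eta> * real n)"
    using bad by (intro mult_left_mono) auto
  ultimately have "real L * ((y - \<eta>) * real n) \<le>
      D * real n + 2 * ((real L)\<^sup>2 * (\<eta> * real n)) + \<eta> * real n"
    using late L by linarith
  then have "(real L * y) * real n \<le> (D + (real L + 2 * (real L)\<^sup>2 + 1) * \<eta>) * real n"
    by (simp add: algebra_simps)
  then show ?thesis
    using n by simp
qed

lemma subcritical_limit_bound:
  fixes L :: nat
  assumes a: "0 \<le> a" "a \<le> t" "t < a + 1" and start: "a = 0 \<or> 1 \<le> j \<and> giant_limit j a 0"
    and lim: "giant_limit (Suc j) t y" and \<eta>: "0 < \<eta>"
  shows "real L * y \<le> 2 * (1 / (1 - (t - a))) + (real L + 2 * (real L)\<^sup>2 + 1) * \<eta>"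
proof -
  define D where "D = 1 / (1 - (t - a))"
  obtain N :: nat where N: "(real L)\<^sup>2 / \<eta> \<le> real N"
    using real_arch_simple by blast
  have "\<forall>\<^sub>F n in sequentially. 1 / 2 \<le>
      \<P>(\<omega> in Omega. real (\<Sum>v<n. card (component n (late_rel n a t \<omega>) v)) \<le> 2 * D * real n)"
    unfolding D_def using eventually_gt_at_top[of 0]
    by eventually_elim (rule prob_few_late_conn[OF a])
  with whp_conj[OF giant_limitD[OF lim \<eta>] whp_few_bad_pairs[OF a(1,2) _ \<eta>]]
  have "\<forall>\<^sub>F n in sequentially. \<exists>\<omega>. regular \<omega> \<and>
      real (\<Sum>v<n. card (component n (late_rel n a t \<omega>) v)) \<le> 2 * D * real n \<and>
      ((y - \<eta>) * real n \<le> real (C1 n (G_rel n \<omega> t (Suc j))) \<and>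
       real (C1 n (G_rel n \<omega> t (Suc j))) \<le> (y + \<eta>) * real n) \<and>
      real (card {p \<in> pairs n. bad_pair n a t j p \<omega>}) < \<eta> * real n"
    using start by (intro whp_witness[where c = "1 / 2"]) auto
  then have "\<forall>\<^sub>F n in sequentially. real L * y \<le> 2 * D + (real L + 2 * (real L)\<^sup>2 + 1) * \<eta>"
    using eventually_gt_at_top[of 0] eventually_ge_at_top[of N]
  proof eventually_elim
    case (elim n)
    then obtain \<omega> where reg: "regular \<omega>"
      and late: "real (\<Sum>v<n. card (component n (late_rel n a t \<omega>) v)) \<le> 2 * D * real n"
      and giant: "(y - \<eta>) * real n \<le> real (C1 n (G_rel n \<omega> t (Suc j)))"
      and bad: "real (card {p \<in> pairs n. bad_pair n a t j p \<omega>}) < \<eta> * real n"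
      by blast
    have "(real L)\<^sup>2 / \<eta> \<le> real n"
      using N elim(3) by linarith
    then have L: "(real L)\<^sup>2 \<le> \<eta> * real n"
      using \<eta> by (simp add: field_simps)
    have "a = 0 \<or> 1 \<le> j"
      using start by blast
    from subcritical_density_le[OF reg elim(2) a(1,2) this late giant _ L] show ?case
      using bad by simp
  qed
  then show ?thesis
    by (simp add: D_def)
qed

lemma subcritical_limit_le_0:
  assumes a: "0 \<le> a" "a \<le> t" "t < a + 1" and start: "a = 0 \<or> 1 \<le> j \<and> giant_limit j a 0"
    and lim: "giant_limit (Suc j) t y"
  shows "y \<le> 0"
proof (rule ccontr)
  assume "\<not> y \<le> 0"
  define D where "D = 2 * (1 / (1 - (t - a)))"
  have "real L * y \<le> D" for L :: nat
  proof (rule field_le_epsilon)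
    fix e :: real assume e: "0 < e"
    let ?K = "real L + 2 * (real L)\<^sup>2 + 1"
    have K: "0 < ?K"
      by (simp add: add_nonneg_pos)
    then have "0 < e / ?K"
      using e by simp
    from subcritical_limit_bound[OF a start lim this, of L] show "real L * y \<le> D + e"
      using K by (simp add: D_def)
  qed
  moreover obtain L :: nat where "D < real L * y"
    using reals_Archimedean3[of y] \<open>\<not> y \<le> 0\<close> by auto
  ultimately show False
    by (simp add: not_less[symmetric])
qed

subsection \<open>Uniqueness of the giant component\<close>

lemma level_of_single_arrival:
  assumes reg: "regular \<omega>" and n: "0 < n" and st: "0 \<le> s" "s \<le> t" and k: "1 \<le> k"
    and p: "p \<in> pairs n" "single_arrival n s t p \<omega>" "p \<notin> (G_rel n (delete_until t {p} \<omega>) t k)\<^sup>*"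
  obtains l where "(first_edge p, l) \<in> set (labelled (arrivals n \<omega> t))" "1 \<le> l" "l \<le> k"
proof -
  have "first_edge p \<in> set (arrivals n \<omega> t)"
    using p by (simp add: set_arrivals[OF reg] edges_upto_iff single_arrival_def)
  then obtain l where l: "(first_edge p, l) \<in> set (labelled (arrivals n \<omega> t))"
    using mem_imp_labelled by blast
  moreover have "1 \<le> l"
    using labelled_level_ge_1[OF loop_free_arrivals[OF reg] l] .
  moreover have "l \<le> k"
    using connected_without_edge[OF reg n _ order_refl p(1) _ _ l k] p(2,3) st
    by (auto simp: single_arrival_def not_less)
  ultimately show thesis
    using that by blast
qed

definition separated_at :: "nat \<Rightarrow> real \<Rightarrow> real \<Rightarrow> real \<Rightarrow> nat \<Rightarrow> nat \<times> nat \<Rightarrow> sample \<Rightarrow> bool" where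
  "separated_at n c s t k p \<omega> \<longleftrightarrow> separated n c (G_rel n \<omega> s k) (G_rel n \<omega> t k) p"

lemma separated_at_measurable [measurable]:
  assumes [measurable]: "W \<in> measurable M Omega"
  shows "Measurable.pred M (\<lambda>\<omega>. separated_at n c s t k p (W \<omega>))"
  unfolding separated_at_def separated_def by measurable

lemma separated_arrival_unique:
  assumes reg: "regular \<omega>" and st: "s \<le> t"
    and pq: "single_arrival n s t p \<omega>" "single_arrival n s t q \<omega>" "fst q < n" "snd q < n"
    and level: "(first_edge p, l) \<in> set (labelled (arrivals n \<omega> t))"
      "(first_edge q, l) \<in> set (labelled (arrivals n \<omega> t))" "l \<le> k"
    and comp: "component n (G_rel n \<omega> s k) (fst p) = component n (G_rel n \<omega> s k) (fst q)"
      "component n (G_rel n \<omega> s k) (snd p) = component n (G_rel n \<omega> s k) (snd q)"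
  shows "p = q"
proof -
  obtain rest where rest: "arrivals n \<omega> t = arrivals n \<omega> s @ rest"
    using arrivals_prefix[OF reg st] .
  have "first_edge p \<notin> set (arrivals n \<omega> s)" "first_edge q \<notin> set (arrivals n \<omega> s)"
    using pq(1,2) by (simp_all add: single_arrival_def set_arrivals[OF reg] edges_upto_iff)
  moreover have "(fst p, fst q) \<in> (G_rel n \<omega> s k)\<^sup>*" "(snd p, snd q) \<in> (G_rel n \<omega> s k)\<^sup>*"
    using comp pq(3,4) by (auto intro: component_eq_imp_rtrancl)
  ultimately have "first_edge p = first_edge q"
    using level loop_free_arrivals[OF reg, of n t] unfolding rest G_rel_eq
    by (intro same_level_edge_unique[of "arrivals n \<omega> s" rest _ l _ k]) simp_all
  then show ?thesis
    using injD[OF inj_first_edge] by blast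
qed

text \<open>Edges between two fixed components of \<open>G\<^sub>k(s)\<close> have distinct levels as long as these are at
  most \<open>k\<close>.\<close>

lemma card_separated_arrivals:
  assumes reg: "regular \<omega>" and n: "0 < n" and st: "0 \<le> s" "s \<le> t" and k: "1 \<le> k" and c: "0 < c"
  shows "real (card {p \<in> pairs n. single_arrival n s t p \<omega> \<and>
    separated_at n c s t k p (delete_until t {p} \<omega>)}) \<le> real k * (real n / c)\<^sup>2"
proof -
  let ?R = "G_rel n \<omega> s k" and ?es = "labelled (arrivals n \<omega> t)"
  let ?Large = "component n ?R ` {v. v < n \<and> c \<le> real (card (component n ?R v))}"
  define T where "T = {p \<in> pairs n. single_arrival n s t p \<omega> \<and>
    separated_at n c s t k p (delete_until t {p} \<omega>)}"
  have "\<exists>l. (first_edge p, l) \<in> set ?es \<and> 1 \<le> l \<and> l \<le> k" if "p \<in> T" for p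
    using level_of_single_arrival[OF reg n st k, of p] that
    by (auto simp: T_def separated_at_def separated_def)
  then obtain l where l: "\<And>p. p \<in> T \<Longrightarrow> (first_edge p, l p) \<in> set ?es \<and> 1 \<le> l p \<and> l p \<le> k"
    by metis
  define f where "f p = (component n ?R (fst p), component n ?R (snd p), l p)" for p
  have "inj_on f T"
  proof (rule inj_onI)
    fix p q assume T: "p \<in> T" "q \<in> T" and eq: "f p = f q"
    then show "p = q"
      using l[OF T(1)] l[OF T(2)]
      by (intro separated_arrival_unique[OF reg st(2), of n p q "l p" k])
        (auto simp: f_def T_def pairs_def)
  qed
  moreover have "f p \<in> ?Large \<times> ?Large \<times> {1..k}" if p: "p \<in> T" for p
  proof -
    have "G_rel n (delete_until t {p} \<omega>) s k = ?R"
      using p st by (intro G_rel_delete_until[OF reg n]) (auto simp: T_def single_arrival_def)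
    then show ?thesis
      using p l by (auto simp: f_def T_def separated_at_def separated_def pairs_def)
  qed
  then have "f ` T \<subseteq> ?Large \<times> ?Large \<times> {1..k}"
    by blast
  ultimately have "card T \<le> card (?Large \<times> ?Large \<times> {1..k})"
    by (intro card_inj_on_le[of f]) auto
  then have "real (card T) \<le> real k * (real (card ?Large))\<^sup>2"
    by (simp add: card_cartesian_product power2_eq_square mult_ac flip: of_nat_mult)
  also have "\<dots> \<le> real k * (real n / c)\<^sup>2"
    using card_large_components[OF sym_G_rel c, of n n \<omega> s k] c
    by (intro mult_left_mono power_mono) (simp_all add: pos_le_divide_eq)
  finally show ?thesis
    unfolding T_def .
qed

lemma sum_prob_separated_without_pair_le:
  assumes n: "0 < n" and st: "0 \<le> s" "s < t" and k: "1 \<le> k" and d: "0 < d"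
  shows "(\<Sum>p\<in>pairs n. \<P>(\<omega> in Omega. separated_at n (d * real n) s t k p (delete_until t {p} \<omega>)))
    \<le> real k / d\<^sup>2 * exp (2 * t) / (t - s) * real n"
proof -
  let ?Q = "\<lambda>p \<omega>. separated_at n (d * real n) s t k p (delete_until t {p} \<omega>)"
  define c where "c = (t - s) / real n * exp (- (2 * t))"
  have c: "0 < c"
    using st n by (simp add: c_def)
  have "c * (\<Sum>p\<in>pairs n. \<P>(\<omega> in Omega. ?Q p \<omega>)) \<le>
      (\<Sum>p\<in>pairs n. \<P>(\<omega> in Omega. single_arrival n s t p \<omega> \<and> ?Q p \<omega>))"
    unfolding sum_distrib_left
  proof (rule sum_mono)
    fix p
    have "c * \<P>(\<omega> in Omega. ?Q p \<omega>) \<le>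
        \<P>(\<omega> in Omega. single_arrival n s t p \<omega>) * \<P>(\<omega> in Omega. ?Q p \<omega>)"
      unfolding c_def using prob_single_arrival_ge[OF n] st by (intro mult_right_mono) auto
    also have "\<dots> = \<P>(\<omega> in Omega. single_arrival n s t p \<omega> \<and> ?Q p \<omega>)"
      by (rule prob_conj_indep[symmetric, OF _ _ depends_on_single_arrival
            depends_on_delete_until[of "{p}" "separated_at n (d * real n) s t k p"]]) auto
    finally show "c * \<P>(\<omega> in Omega. ?Q p \<omega>) \<le> \<P>(\<omega> in Omega. single_arrival n s t p \<omega> \<and> ?Q p \<omega>)" .
  qed
  also have "\<dots> \<le> real k * (real n / (d * real n))\<^sup>2"
  proof (rule Om.sum_prob_le_if_card_le)
    show "AE \<omega> in Omega. real (card {p \<in> pairs n. single_arrival n s t p \<omega> \<and> ?Q p \<omega>}) \<le>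
        real k * (real n / (d * real n))\<^sup>2"
      using AE_regular by eventually_elim (rule card_separated_arrivals; use n st k d in simp)
  qed auto
  also have "\<dots> = real k / d\<^sup>2"
    using n by (simp add: power_divide)
  finally have "(\<Sum>p\<in>pairs n. \<P>(\<omega> in Omega. ?Q p \<omega>)) \<le> real k / d\<^sup>2 / c"
    using c by (simp only: pos_le_divide_eq mult.commute)
  also have "\<dots> = real k / d\<^sup>2 * exp (2 * t) / (t - s) * real n"
    using n st by (simp add: c_def exp_minus field_simps)
  finally show ?thesis .
qed

lemma sum_prob_separated_le:
  assumes n: "0 < n" and st: "0 \<le> s" "s < t" and k: "1 \<le> k" and d: "0 < d"
  shows "(\<Sum>p\<in>pairs n. \<P>(\<omega> in Omega. separated_at n (d * real n) s t k p \<omega>))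
    \<le> (real k / d\<^sup>2 * exp (2 * t) / (t - s) + t) * real n"
proof -
  let ?Q = "separated_at n (d * real n) s t k"
  have "(\<Sum>p\<in>pairs n. \<P>(\<omega> in Omega. ?Q p \<omega>)) \<le>
      (\<Sum>p\<in>pairs n. \<P>(\<omega> in Omega. ?Q p (delete_until t {p} \<omega>)) + t / real n)"
  proof (rule sum_mono)
    fix p
    have "\<P>(\<omega> in Omega. ?Q p \<omega>) \<le> \<P>(\<omega> in Omega. ?Q p (delete_until t {p} \<omega>) \<or> gap n \<omega> p 0 \<le> t)"
    proof (rule prob_mono_regular)
      fix \<omega> assume reg: "regular \<omega>" and sep: "?Q p \<omega>"
      show "?Q p (delete_until t {p} \<omega>) \<or> gap n \<omega> p 0 \<le> t"
      proof (cases "gap n \<omega> p 0 \<le> t")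
        case False
        then have "G_rel n (delete_until t {p} \<omega>) r k = G_rel n \<omega> r k" if "r \<le> t" for r
          using that st by (intro G_rel_delete_until[OF reg n]) auto
        then show ?thesis
          using sep st by (simp add: separated_at_def)
      qed simp
    qed auto
    also have "\<dots> \<le> \<P>(\<omega> in Omega. ?Q p (delete_until t {p} \<omega>)) + \<P>(\<omega> in Omega. gap n \<omega> p 0 \<le> t)"
      by (rule Om.prob_disj_le) auto
    also have "\<P>(\<omega> in Omega. gap n \<omega> p 0 \<le> t) \<le> t / real n"
      using st n by (intro prob_gap_le) auto
    finally show "\<P>(\<omega> in Omega. ?Q p \<omega>) \<le> \<P>(\<omega> in Omega. ?Q p (delete_until t {p} \<omega>)) + t / real n"
      by simp
  qed
  also have "\<dots> = (\<Sum>p\<in>pairs n. \<P>(\<omega> in Omega. ?Q p (delete_until t {p} \<omega>))) +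
      real (card (pairs n)) * (t / real n)"
    by (simp add: sum.distrib)
  also have "\<dots> \<le> real k / d\<^sup>2 * exp (2 * t) / (t - s) * real n + (real n)\<^sup>2 * (t / real n)"
    using sum_prob_separated_without_pair_le[OF assms] card_pairs_le[of n] st
    by (intro add_mono mult_right_mono) auto
  finally show ?thesis
    using n by (simp add: power2_eq_square algebra_simps)
qed

lemma whp_few_separated:
  assumes st: "0 \<le> s" "s < t" and k: "1 \<le> k" and d: "0 < d"
  shows "whp (\<lambda>n \<omega>. real (card {p \<in> pairs n. separated_at n (d * real n) s t k p \<omega>})
    < (d * real n)\<^sup>2 / 2)"
proof (rule whp_card_less)
  let ?S = "\<lambda>n. \<Sum>p\<in>pairs n. \<P>(\<omega> in Omega. separated_at n (d * real n) s t k p \<omega>)"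
  define K where "K = real k / d\<^sup>2 * exp (2 * t) / (t - s) + t"
  have "?S n / ((d * real n)\<^sup>2 / 2) \<le> 2 * K / d\<^sup>2 / real n" if n: "0 < n" for n
  proof -
    have "?S n / ((d * real n)\<^sup>2 / 2) \<le> K * real n / ((d * real n)\<^sup>2 / 2)"
      unfolding K_def using sum_prob_separated_le[OF n st k d] by (intro divide_right_mono) auto
    also have "\<dots> = 2 * K / d\<^sup>2 / real n"
      using n d by (simp add: power2_eq_square field_simps)
    finally show ?thesis .
  qed
  then have upper: "\<forall>\<^sub>F n in sequentially. ?S n / ((d * real n)\<^sup>2 / 2) \<le> 2 * K / d\<^sup>2 / real n"
    using eventually_gt_at_top[of 0] by (rule eventually_mono[rotated])
  have lower: "\<forall>\<^sub>F n in sequentially. 0 \<le> ?S n / ((d * real n)\<^sup>2 / 2)"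
    by (intro always_eventually allI divide_nonneg_nonneg sum_nonneg) auto
  show "(\<lambda>n. ?S n / ((d * real n)\<^sup>2 / 2)) \<longlonglongrightarrow> 0"
    by (rule tendsto_sandwich[OF lower upper tendsto_const lim_const_over_n])
  show "\<forall>\<^sub>F n in sequentially. 0 < (d * real n)\<^sup>2 / 2"
    using eventually_gt_at_top[of 0] by eventually_elim (use d in simp)
qed auto

lemma whp_unique_large_component:
  assumes st: "0 \<le> s" "s < t" and k: "1 \<le> k" and d: "0 < d"
    and lim: "giant_limit k s x" "giant_limit k t y" and xy: "y < x + d"
  shows "whp (\<lambda>n \<omega>. unique_large_component n (d * real n) (G_rel n \<omega> s k))"
proof -
  define \<epsilon> where "\<epsilon> = (x + d - y) / 3"
  have \<epsilon>: "0 < \<epsilon>"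
    using xy by (simp add: \<epsilon>_def)
  from whp_conj[OF whp_few_separated[OF st k d]
      whp_conj[OF giant_limitD[OF lim(1) \<epsilon>] giant_limitD[OF lim(2) \<epsilon>]]]
  show ?thesis
  proof (rule whp_mono, elim conjE)
    fix n \<omega>
    assume n: "0 < n" and reg: "regular \<omega>"
      and few: "real (card {p \<in> pairs n. separated_at n (d * real n) s t k p \<omega>})
        < (d * real n)\<^sup>2 / 2"
      and giant: "(x - \<epsilon>) * real n \<le> real (C1 n (G_rel n \<omega> s k))"
        "real (C1 n (G_rel n \<omega> t k)) \<le> (y + \<epsilon>) * real n"
    have "(y + \<epsilon>) * real n < (x - \<epsilon> + d) * real n"
      using n \<epsilon> by (intro mult_strict_right_mono) (simp_all add: \<epsilon>_def field_simps)
    then have "real (C1 n (G_rel n \<omega> t k)) < real (C1 n (G_rel n \<omega> s k)) + d * real n"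
      using giant by (simp add: distrib_right)
    then show "unique_large_component n (d * real n) (G_rel n \<omega> s k)"
      using few n d st
      by (intro unique_large_componentI[OF G_rel_mono_time[OF reg, of s t] sym_G_rel sym_G_rel])
        (auto simp: separated_at_def)
  qed
qed

subsection \<open>Vertices that are attached late\<close>

definition star :: "nat \<Rightarrow> nat \<Rightarrow> (nat \<times> nat) set" where
  "star n v = pair_of v ` ({..<n} - {v})"

lemma finite_star [simp]: "finite (star n v)"
  by (simp add: star_def)

lemma star_subset_pairs: "v < n \<Longrightarrow> star n v \<subseteq> pairs n"
  unfolding star_def image_subset_iff using pair_of_in_pairs by auto

lemma card_star_le: "card (star n v) \<le> n"
proof -
  have "card (star n v) \<le> card ({..<n} - {v})"
    unfolding star_def by (rule card_image_le) simp
  also have "\<dots> \<le> n"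
    using card_Diff1_le[of "{..<n}" v] by simp
  finally show ?thesis .
qed

lemma incident_iff_star:
  assumes "ends x \<in> pairs n"
  shows "incident v x \<longleftrightarrow> ends x \<in> star n v"
proof
  assume "incident v x"
  then show "ends x \<in> star n v"
    using assms unfolding star_def incident_def
    by (intro image_eqI[of _ _ "if fst (ends x) = v then snd (ends x) else fst (ends x)"])
      (auto simp: pairs_def pair_of_def)
qed (auto simp: star_def incident_def pair_of_def min_def max_def split: if_splits)

definition attached_to :: "nat \<Rightarrow> real \<Rightarrow> real \<Rightarrow> nat \<Rightarrow> nat \<Rightarrow> nat set \<Rightarrow> sample \<Rightarrow> bool" where
  "attached_to n s t k v K \<omega> \<longleftrightarrow>
     (\<exists>W\<in>{W. W \<subseteq> K - {v} \<and> card W = k}. exact_arrivals n s t (star n v) (pair_of v ` W) \<omega>)"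

lemma finite_subsets_of_card [simp]: "finite A \<Longrightarrow> finite {W. W \<subseteq> A \<and> card W = k}"
  by (rule finite_subset[of _ "Pow A"]) auto

lemma attached_to_measurable [measurable (raw)]:
  "finite K \<Longrightarrow> Measurable.pred Omega (attached_to n s t k v K)"
  unfolding attached_to_def[abs_def] by (intro pred_intros_finite exact_arrivals_measurable) auto

lemma depends_on_attached_to: "depends_on {e. ends e \<in> star n v} (attached_to n s t k v K)"
proof (rule depends_onI)
  fix \<omega> \<omega>' :: sample
  assume "\<And>e. e \<in> {e. ends e \<in> star n v} \<Longrightarrow> \<omega> e = \<omega>' e"
  then have "exact_arrivals n s t (star n v) S \<omega> = exact_arrivals n s t (star n v) S \<omega>'" for S
    using depends_on_exact_arrivals[of "star n v"] unfolding depends_on_def by blast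
  then show "attached_to n s t k v K \<omega> = attached_to n s t k v K \<omega>'"
    by (simp add: attached_to_def)
qed

lemma filter_incident_arrivals:
  assumes reg: "regular \<omega>" and v: "v < n" and W: "W \<subseteq> {..<n} - {v}"
    and exact: "exact_arrivals n s t (star n v) (pair_of v ` W) \<omega>"
  shows "set (filter (incident v) (arrivals n \<omega> t)) = (\<lambda>w. first_edge (pair_of v w)) ` W"
    and "length (filter (incident v) (arrivals n \<omega> t)) = card W"
proof -
  have "set (filter (incident v) (arrivals n \<omega> t)) = {x \<in> edges_upto n \<omega> t. ends x \<in> star n v}"
    using incident_iff_star by (auto simp: set_arrivals[OF reg] edges_upto_iff)
  also have "\<dots> = first_edge ` pair_of v ` W"
    using W by (intro edges_of_exact_arrivals[OF reg star_subset_pairs[OF v] _ exact])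
      (auto simp: star_def)
  finally show set: "set (filter (incident v) (arrivals n \<omega> t)) =
      (\<lambda>w. first_edge (pair_of v w)) ` W"
    by (simp add: image_image)
  have "inj_on (\<lambda>w. first_edge (pair_of v w)) W"
    by (auto intro!: inj_onI dest!: injD[OF inj_first_edge] injD[OF inj_pair_of])
  moreover have "distinct (filter (incident v) (arrivals n \<omega> t))"
    using distinct_arrivals[OF reg] by simp
  ultimately show "length (filter (incident v) (arrivals n \<omega> t)) = card W"
    using distinct_card[of "filter (incident v) (arrivals n \<omega> t)"] by (simp only: set card_image)
qed

lemma exact_arrivals_isolated:
  assumes "regular \<omega>" "v < n" "W \<subseteq> {..<n} - {v}" "card W < k"
    and "exact_arrivals n s t (star n v) (pair_of v ` W) \<omega>"
  shows "G_rel n \<omega> t k `` {v} = {}"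
  unfolding G_rel_eq using assms loop_free_arrivals
  by (intro isolated_above_degree) (simp_all add: filter_incident_arrivals(2))

lemma attached_to_isolated:
  assumes "regular \<omega>" "v < n" "K \<subseteq> {..<n}" "attached_to n s t k v K \<omega>"
  shows "G_rel n \<omega> t (Suc k) `` {v} = {}"
proof -
  obtain W where W: "W \<subseteq> K - {v}" "card W = k" "exact_arrivals n s t (star n v) (pair_of v ` W) \<omega>"
    using assms(4) unfolding attached_to_def by blast
  show ?thesis
    by (rule exact_arrivals_isolated[OF assms(1,2) _ _ W(3)]) (use W assms(3) in auto)
qed

lemma no_incident_early_arrivals:
  assumes reg: "regular \<omega>" and st: "s \<le> t" and exact: "exact_arrivals n s t (star n v) S \<omega>"
  shows "filter (incident v) (arrivals n \<omega> s) = []"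
proof -
  have "\<not> incident v x" if "x \<in> edges_upto n \<omega> s" for x
  proof
    assume "incident v x"
    then have "ends x \<in> star n v"
      using that incident_iff_star[of x n v] by (simp add: edges_upto_iff)
    then have "s < gap n \<omega> (ends x) 0"
      using exact_arrivals_gap_greater[OF exact st] by blast
    then show False
      using first_gap_le[OF reg that] by simp
  qed
  then show ?thesis
    by (simp add: filter_empty_conv set_arrivals[OF reg])
qed

lemma attached_to_component_conn:
  assumes reg: "regular \<omega>" and st: "s \<le> t" and k: "1 \<le> k" and v: "v < n" and r: "r < n"
    and attached: "attached_to n s t k v (component n (G_rel n \<omega> s k) r) \<omega>"
  shows "(v, r) \<in> (G_rel n \<omega> t k)\<^sup>*"
proof -
  let ?K = "component n (G_rel n \<omega> s k) r"
  obtain W where W: "W \<subseteq> ?K - {v}" "card W = k"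
    and exact: "exact_arrivals n s t (star n v) (pair_of v ` W) \<omega>"
    using attached unfolding attached_to_def by blast
  have Wn: "W \<subseteq> {..<n} - {v}"
    using W(1) component_subset by fast
  obtain rest where rest: "arrivals n \<omega> t = arrivals n \<omega> s @ rest"
    using arrivals_prefix[OF reg st] .
  have "filter (incident v) (arrivals n \<omega> t) = filter (incident v) rest"
    by (simp add: rest no_incident_early_arrivals[OF reg st exact])
  then have incident: "length (filter (incident v) rest) = k"
    "set (filter (incident v) rest) = (\<lambda>w. first_edge (pair_of v w)) ` W"
    using filter_incident_arrivals[OF reg v Wn exact] W(2) by simp_all
  have "crosses {v} ?K x" if "x \<in> set rest" "incident v x" for x
  proof -
    have "x \<in> (\<lambda>w. first_edge (pair_of v w)) ` W"
      using that unfolding incident(2)[symmetric] by simp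
    then obtain w where "x = first_edge (pair_of v w)" "w \<in> ?K"
      using W(1) by blast
    then show ?thesis
      by (auto simp: crosses_def pair_of_def min_def max_def)
  qed
  then have "filter (incident v) rest = filter (incident v) (filter (crosses {v} ?K) rest)"
    by (auto intro!: filter_cong)
  then have "k \<le> length (filter (crosses {v} ?K) rest)"
    using incident(1) by (metis length_filter_le)
  moreover have "?K \<times> ?K \<subseteq> conn (arrivals n \<omega> s) k"
    unfolding component_def G_rel_eq by (auto intro: conn_sym rtrancl_trans)
  ultimately have "{v} \<times> ?K \<subseteq> conn (arrivals n \<omega> s @ rest) k"
    using loop_free_arrivals[OF reg, of n t] k
    by (intro crossing_edges_connect[where k = k]) (auto simp: rest)
  then show ?thesis
    using r by (auto simp: component_def G_rel_eq rest)
qed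

lemma power_le_binomial_mult:
  fixes x a :: real
  assumes "k \<le> m" "0 \<le> x" "x \<le> real m" "0 \<le> a"
  shows "(x / real k * a) ^ k \<le> real (m choose k) * a ^ k"
proof -
  have "(x / real k) ^ k \<le> (real m / real k) ^ k"
    using assms by (intro power_mono divide_right_mono) auto
  also have "\<dots> \<le> real (m choose k)"
    using assms(1) by (rule binomial_ge_n_over_k_pow_k)
  finally have "(x / real k) ^ k * a ^ k \<le> real (m choose k) * a ^ k"
    using assms(4) by (intro mult_right_mono) simp_all
  then show ?thesis
    by (simp only: power_mult_distrib)
qed

lemma prob_exact_star_arrivals_ge:
  assumes "0 < n" "0 \<le> s" "s \<le> t" and W: "W \<subseteq> {..<n} - {v}"
  shows "((t - s) / real n * exp (- (2 * t))) ^ card W * exp (- t) \<le>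
    \<P>(\<omega> in Omega. exact_arrivals n s t (star n v) (pair_of v ` W) \<omega>)"
proof -
  have "pair_of v ` W \<subseteq> star n v"
    using W by (auto simp: star_def)
  from prob_exact_arrivals_ge[OF assms(1-3) finite_star card_star_le this] show ?thesis
    by (simp add: card_image inj_on_subset[OF inj_pair_of])
qed

lemma prob_attached_to_ge:
  assumes n: "0 < n" and st: "0 \<le> s" "s \<le> t" and k: "1 \<le> k" and d: "0 < d"
    and large: "real k + 1 \<le> d * real n / 2" and K: "K \<subseteq> {..<n}" "d * real n \<le> real (card K)"
  shows "(d * (t - s) * exp (- (2 * t)) / (2 * real k)) ^ k * exp (- t) \<le>
    \<P>(\<omega> in Omega. attached_to n s t k v K \<omega>)"
proof -
  let ?a = "(t - s) / real n * exp (- (2 * t))"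
  let ?F = "{W. W \<subseteq> K - {v} \<and> card W = k}"
  have fin: "finite K"
    using K(1) finite_subset by blast
  define m where "m = card (K - {v})"
  have "card K \<le> m + 1"
    unfolding m_def using diff_card_le_card_Diff[of "{v}" K] by simp
  then have m: "d * real n / 2 \<le> real m" "k \<le> m"
    using large K(2) by linarith+
  have a: "0 \<le> ?a"
    using st by simp
  have "d * (t - s) * exp (- (2 * t)) / (2 * real k) = d * real n / 2 / real k * ?a"
    using n by simp
  also have "(d * real n / 2 / real k * ?a) ^ k \<le> real (m choose k) * ?a ^ k"
    using m a d by (intro power_le_binomial_mult) auto
  finally have "(d * (t - s) * exp (- (2 * t)) / (2 * real k)) ^ k * exp (- t) \<le>
      (\<Sum>W\<in>?F. ?a ^ k * exp (- t))"
    using n_subsets[of "K - {v}" k] fin by (simp add: m_def)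
  also have "\<dots> \<le> (\<Sum>W\<in>?F. \<P>(\<omega> in Omega. exact_arrivals n s t (star n v) (pair_of v ` W) \<omega>))"
  proof (rule sum_mono)
    fix W assume "W \<in> ?F"
    then show "?a ^ k * exp (- t) \<le>
        \<P>(\<omega> in Omega. exact_arrivals n s t (star n v) (pair_of v ` W) \<omega>)"
      using K(1) prob_exact_star_arrivals_ge[OF n st, of W v] by auto
  qed
  also have "\<dots> = \<P>(\<omega> in Omega. attached_to n s t k v K \<omega>)"
    unfolding attached_to_def
  proof (rule Om.prob_Bex_disjoint[symmetric])
    fix W W' \<omega>
    assume "W \<in> ?F" "W' \<in> ?F" "exact_arrivals n s t (star n v) (pair_of v ` W) \<omega>"
      "exact_arrivals n s t (star n v) (pair_of v ` W') \<omega>"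
    then have "pair_of v ` W = pair_of v ` W'"
      using K(1) by (intro exact_arrivals_unique[of n s t "star n v" _ \<omega>]) (auto simp: star_def)
    then show "W = W'"
      using inj_image_eq_iff[OF inj_pair_of] by blast
  qed (use fin in \<open>auto intro: exact_arrivals_measurable\<close>)
  finally show ?thesis .
qed

definition largest_component :: "nat \<Rightarrow> (nat \<times> nat) set \<Rightarrow> nat set" where
  "largest_component n R = component n R (LEAST r. r < n \<and> card (component n R r) = C1 n R)"

lemma largest_component:
  assumes "0 < n"
  obtains r where "r < n" "largest_component n R = component n R r"
    "card (largest_component n R) = C1 n R"
proof -
  have "\<exists>r. r < n \<and> card (component n R r) = C1 n R"
    using C1_attained[OF assms] by metis
  from LeastI_ex[OF this] show thesis
    using that by (auto simp: largest_component_def)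
qed

lemma C1_ge_iff_largest_component:
  assumes "0 < n"
  shows "c \<le> real (C1 n R) \<longleftrightarrow> (\<exists>K\<in>{K \<in> Pow {..<n}. c \<le> real (card K)}. largest_component n R = K)"
proof -
  obtain r where "largest_component n R = component n R r" "card (largest_component n R) = C1 n R"
    using largest_component[OF assms] .
  then show ?thesis
    using component_subset[of n R r] by auto
qed

definition attached_to_giant :: "nat \<Rightarrow> real \<Rightarrow> real \<Rightarrow> real \<Rightarrow> nat \<Rightarrow> nat \<Rightarrow> sample \<Rightarrow> bool" where
  "attached_to_giant n c s t k v \<omega> \<longleftrightarrow> (\<exists>K\<in>{K \<in> Pow {..<n}. c \<le> real (card K)}.
     largest_component n (G_rel n (delete_until t (star n v) \<omega>) s k) = K \<and>
     attached_to n s t k v K \<omega>)"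

definition attached_vertices :: "nat \<Rightarrow> real \<Rightarrow> real \<Rightarrow> real \<Rightarrow> nat \<Rightarrow> sample \<Rightarrow> nat set" where
  "attached_vertices n c s t k \<omega> = {v \<in> {..<n}. attached_to_giant n c s t k v \<omega>}"

lemma pred_largest_component_deleted:
  "Measurable.pred Omega (\<lambda>\<omega>. largest_component n (G_rel n (delete_until t P \<omega>) s k) = K)"
  by (rule pred_of_G_rel) simp

lemma attached_to_giant_measurable [measurable]:
  "Measurable.pred Omega (attached_to_giant n c s t k v)"
  unfolding attached_to_giant_def[abs_def]
  by (intro pred_intros_finite pred_intros_logic pred_largest_component_deleted
      attached_to_measurable)
    (auto intro: finite_subset)

lemma attached_to_giant_imp:
  assumes reg: "regular \<omega>" and n: "0 < n" and st: "0 \<le> s" "s \<le> t" and v: "v < n"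
    and attached: "attached_to_giant n c s t k v \<omega>"
  obtains r where "r < n" "c \<le> real (card (component n (G_rel n \<omega> s k) r))"
    "attached_to n s t k v (component n (G_rel n \<omega> s k) r) \<omega>"
proof -
  let ?K = "largest_component n (G_rel n (delete_until t (star n v) \<omega>) s k)"
  have K: "c \<le> real (card ?K)" "attached_to n s t k v ?K \<omega>"
    using attached by (auto simp: attached_to_giant_def)
  then obtain W where "exact_arrivals n s t (star n v) (pair_of v ` W) \<omega>"
    by (auto simp: attached_to_def)
  then have "G_rel n (delete_until t (star n v) \<omega>) s k = G_rel n \<omega> s k"
    using st exact_arrivals_gap_greater by (intro G_rel_delete_until[OF reg n]) auto
  then show thesis
    using K largest_component[OF n, of "G_rel n \<omega> s k"] that by metis
qed

lemma prob_giant_without_star_ge: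
  assumes n: "0 < n" and st: "0 \<le> s" "s \<le> t" and v: "v < n"
    and giant: "\<P>(\<omega> in Omega. \<not> c \<le> real (C1 n (G_rel n \<omega> s k))) \<le> exp (- s) / 2"
  shows "1 / 2 \<le> \<P>(\<omega> in Omega. c \<le> real (C1 n (G_rel n (delete_until t (star n v) \<omega>) s k)))"
proof -
  let ?large = "\<lambda>\<omega>. c \<le> real (C1 n (G_rel n \<omega> s k))"
  have "\<P>(\<omega> in Omega. \<not> ?large (delete_until t (star n v) \<omega>)) \<le> exp s * \<P>(\<omega> in Omega. \<not> ?large \<omega>)"
    by (rule prob_delete_until_le[OF n st star_subset_pairs[OF v] card_star_le])
  also have "\<dots> \<le> exp s * (exp (- s) / 2)"
    using giant by (intro mult_left_mono) auto
  also have "\<dots> = 1 / 2"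
    by (simp add: exp_minus)
  finally show ?thesis
    by (subst (asm) Om.prob_neg) simp_all
qed

lemma prob_attached_to_giant_ge:
  assumes n: "0 < n" and st: "0 \<le> s" "s \<le> t" and k: "1 \<le> k" and d: "0 < d" and v: "v < n"
    and large: "real k + 1 \<le> d * real n / 2"
    and giant: "\<P>(\<omega> in Omega. \<not> d * real n \<le> real (C1 n (G_rel n \<omega> s k))) \<le> exp (- s) / 2"
  shows "1 / 2 * ((d * (t - s) * exp (- (2 * t)) / (2 * real k)) ^ k * exp (- t)) \<le>
    \<P>(\<omega> in Omega. attached_to_giant n (d * real n) s t k v \<omega>)"
proof -
  let ?c = "(d * (t - s) * exp (- (2 * t)) / (2 * real k)) ^ k * exp (- t)"
  let ?G = "\<lambda>\<omega>. G_rel n (delete_until t (star n v) \<omega>) s k"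
  let ?F = "{K \<in> Pow {..<n}. d * real n \<le> real (card K)}"
  have finK: "finite K" if "K \<in> ?F" for K
    using that finite_subset by blast
  have "1 / 2 \<le> \<P>(\<omega> in Omega. \<exists>K\<in>?F. largest_component n (?G \<omega>) = K)"
    using prob_giant_without_star_ge[OF n st v giant] unfolding C1_ge_iff_largest_component[OF n] .
  also have "\<dots> = (\<Sum>K\<in>?F. \<P>(\<omega> in Omega. largest_component n (?G \<omega>) = K))"
    by (rule Om.prob_Bex_disjoint) (auto intro: pred_largest_component_deleted)
  finally have "1 / 2 * ?c \<le> (\<Sum>K\<in>?F. \<P>(\<omega> in Omega. largest_component n (?G \<omega>) = K)) * ?c"
    using d st by (intro mult_right_mono) auto
  also have "\<dots> \<le> (\<Sum>K\<in>?F. \<P>(\<omega> in Omega. largest_component n (?G \<omega>) = K \<and> attached_to n s t k v K \<omega>))"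
    unfolding sum_distrib_right
  proof (rule sum_mono)
    fix K assume K: "K \<in> ?F"
    have "\<P>(\<omega> in Omega. largest_component n (?G \<omega>) = K) * ?c \<le>
        \<P>(\<omega> in Omega. largest_component n (?G \<omega>) = K) * \<P>(\<omega> in Omega. attached_to n s t k v K \<omega>)"
      using K by (intro mult_left_mono prob_attached_to_ge[OF n st k d large]) auto
    also have "\<dots> = \<P>(\<omega> in Omega. largest_component n (?G \<omega>) = K \<and> attached_to n s t k v K \<omega>)"
      by (rule prob_conj_indep[symmetric, OF pred_largest_component_deleted
            attached_to_measurable[OF finK[OF K]]
            depends_on_delete_until[of "star n v" "\<lambda>\<omega>. largest_component n (G_rel n \<omega> s k) = K"]
            depends_on_attached_to]) auto
    finally show "\<P>(\<omega> in Omega. largest_component n (?G \<omega>) = K) * ?c \<le>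
        \<P>(\<omega> in Omega. largest_component n (?G \<omega>) = K \<and> attached_to n s t k v K \<omega>)" .
  qed
  also have "\<dots> = \<P>(\<omega> in Omega. attached_to_giant n (d * real n) s t k v \<omega>)"
    unfolding attached_to_giant_def
    by (rule Om.prob_Bex_disjoint[symmetric])
      (auto intro!: pred_intros_logic pred_largest_component_deleted attached_to_measurable
        intro: finite_subset)
  finally show ?thesis .
qed

lemma prob_many_attached_to_giant:
  assumes st: "0 \<le> s" "s < t" and k: "1 \<le> k" and d: "0 < d" "d < x" and lim: "giant_limit k s x"
  obtains \<beta> where "0 < \<beta>" "\<forall>\<^sub>F n in sequentially.
    \<beta> \<le> \<P>(\<omega> in Omega. \<beta> * real n \<le> real (card (attached_vertices n (d * real n) s t k \<omega>)))"
proof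
  define c where "c = 1 / 2 * ((d * (t - s) * exp (- (2 * t)) / (2 * real k)) ^ k * exp (- t))"
  show c: "0 < c / 2"
    using d st k by (simp add: c_def)
  have "0 < x - d"
    using d by simp
  from giant_limitD[OF lim this] have "whp (\<lambda>n \<omega>. d * real n \<le> real (C1 n (G_rel n \<omega> s k)))"
    by (rule whp_mono) simp
  then have giant: "\<forall>\<^sub>F n in sequentially.
      \<P>(\<omega> in Omega. \<not> d * real n \<le> real (C1 n (G_rel n \<omega> s k))) < exp (- s) / 2"
    by (rule whp_imp_prob_less) simp
  obtain N :: nat where N: "2 * (real k + 1) / d \<le> real N"
    using real_arch_simple by blast
  show "\<forall>\<^sub>F n in sequentially. c / 2 \<le>
      \<P>(\<omega> in Omega. c / 2 * real n \<le> real (card (attached_vertices n (d * real n) s t k \<omega>)))"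
    using giant eventually_gt_at_top[of 0] eventually_ge_at_top[of N]
  proof eventually_elim
    case (elim n)
    have "2 * (real k + 1) / d \<le> real n"
      using N elim(3) by linarith
    then have "real k + 1 \<le> d * real n / 2"
      using d by (simp add: field_simps)
    then have "c \<le> \<P>(\<omega> in Omega. attached_to_giant n (d * real n) s t k v \<omega>)" if "v < n" for v
      unfolding c_def using elim that st by (intro prob_attached_to_giant_ge[OF _ _ _ k d(1)]) auto
    then have "c / 2 \<le> \<P>(\<omega> in Omega. c / 2 * real (card {..<n}) \<le>
        real (card (attached_vertices n (d * real n) s t k \<omega>)))"
      unfolding attached_vertices_def using elim(2) c by (intro Om.prob_card_ge_half) auto
    then show ?case
      by simp
  qed
qed

lemma C1_Suc_add_attached_le:
  assumes reg: "regular \<omega>" and n: "0 < n" and st: "0 \<le> s" "s \<le> t" and k: "1 \<le> k"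
    and unique: "unique_large_component n c (G_rel n \<omega> t k)"
    and large: "c \<le> real (C1 n (G_rel n \<omega> t (Suc k)))"
  shows "C1 n (G_rel n \<omega> t (Suc k)) + card (attached_vertices n c s t k \<omega>) \<le>
      C1 n (G_rel n \<omega> t k) + 1"
proof -
  let ?R = "G_rel n \<omega> t k" and ?S = "attached_vertices n c s t k \<omega>"
  obtain m where m: "m < n"
    "card (component n (G_rel n \<omega> t (Suc k)) m) = C1 n (G_rel n \<omega> t (Suc k))"
    using C1_attained[OF n] .
  have sub: "component n (G_rel n \<omega> t (Suc k)) m \<subseteq> component n ?R m"
    by (intro component_mono G_rel_antimono_level) simp
  then have comp_large: "c \<le> real (card (component n ?R m))"
    using large m(2) card_mono[OF finite_component sub] by linarith
  have attached: "v \<in> component n ?R m \<and> G_rel n \<omega> t (Suc k) `` {v} = {}" if "v \<in> ?S" for v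
  proof -
    have v: "v < n" "attached_to_giant n c s t k v \<omega>"
      using that by (auto simp: attached_vertices_def)
    obtain r where r: "r < n" "c \<le> real (card (component n (G_rel n \<omega> s k) r))"
      "attached_to n s t k v (component n (G_rel n \<omega> s k) r) \<omega>"
      using attached_to_giant_imp[OF reg n st v] .
    have "card (component n (G_rel n \<omega> s k) r) \<le> card (component n ?R r)"
      by (intro card_mono component_mono G_rel_mono_time[OF reg st(2)]) simp
    then have "c \<le> real (card (component n ?R r))"
      using r(2) by linarith
    then have "(m, r) \<in> ?R\<^sup>*"
      using unique m(1) r(1) comp_large unfolding unique_large_component_def by blast
    moreover have "(v, r) \<in> ?R\<^sup>*"
      by (rule attached_to_component_conn[OF reg st(2) k v(1) r(1,3)])
    ultimately have "(m, v) \<in> ?R\<^sup>*"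
      using rtrancl_sym[OF sym_G_rel] by (meson rtrancl_trans)
    then show ?thesis
      using v attached_to_isolated[OF reg v(1) component_subset r(3)] by (simp add: component_def)
  qed
  then have "C1 n (G_rel n \<omega> t (Suc k)) + card ?S \<le> card (component n ?R m) + 1"
    using m sub by (intro C1_add_isolated_le[OF sym_G_rel m sub]) auto
  then show ?thesis
    using card_component_le_C1[OF m(1), of ?R] by linarith
qed

subsection \<open>Comparison of consecutive levels\<close>

lemma limit_less_if_loss:
  assumes lim: "giant_limit k t y" and \<beta>: "0 < \<beta>"
    and loss: "\<forall>\<^sub>F n in sequentially. \<beta> \<le> \<P>(\<omega> in Omega. \<beta> * real n \<le> X n \<omega>)"
    and upper: "\<And>\<epsilon>. 0 < \<epsilon> \<Longrightarrow> whp (\<lambda>n \<omega>. real (C1 n (G_rel n \<omega> t k)) + X n \<omega> \<le> (x + \<epsilon>) * real n + 1)"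
  shows "y < x"
proof -
  have \<epsilon>: "0 < \<beta> / 4"
    using \<beta> by simp
  obtain N :: nat where N: "4 / \<beta> \<le> real N"
    using real_arch_simple by blast
  have "\<forall>\<^sub>F n in sequentially. y + \<beta> / 4 \<le> x"
    using whp_witness[OF whp_conj[OF giant_limitD[OF lim \<epsilon>] upper[OF \<epsilon>]] \<beta> loss]
      eventually_gt_at_top[of 0] eventually_ge_at_top[of N]
  proof eventually_elim
    case (elim n)
    then obtain \<omega> where "\<beta> * real n \<le> X n \<omega>" "(y - \<beta> / 4) * real n \<le> real (C1 n (G_rel n \<omega> t k))"
      "real (C1 n (G_rel n \<omega> t k)) + X n \<omega> \<le> (x + \<beta> / 4) * real n + 1"
      by blast
    moreover have "4 / \<beta> \<le> real n"
      using N elim(3) by linarith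
    then have "1 \<le> \<beta> / 4 * real n"
      using \<beta> by (simp add: field_simps)
    ultimately have "(y - \<beta> / 4) * real n + \<beta> * real n \<le> (x + \<beta> / 4) * real n + \<beta> / 4 * real n"
      by linarith
    then have "(y + \<beta> / 4) * real n \<le> x * real n"
      by (simp add: algebra_simps)
    then show ?case
      using elim(2) by simp
  qed
  then show ?thesis
    using \<beta> by simp
qed

lemma giant_limit_antimono_level: "giant_limit k t x \<Longrightarrow> giant_limit (Suc k) t y \<Longrightarrow> y \<le> x"
  by (rule giant_limit_le[of "Suc k" t y k t x]) (simp_all add: C1_mono G_rel_antimono_level)

lemma giant_limit_mono_time: "giant_limit k s x \<Longrightarrow> giant_limit k t y \<Longrightarrow> s \<le> t \<Longrightarrow> x \<le> y"
  by (rule giant_limit_le[of k s x k t y]) (simp_all add: C1_mono G_rel_mono_time)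

lemma first_giant_limit_less_1:
  assumes lim: "giant_limit 1 t y" and t: "0 \<le> t"
  shows "y < 1"
proof -
  define iso where "iso n \<omega> = {v \<in> {..<n}. exact_arrivals n 0 t (star n v) {} \<omega>}" for n \<omega>
  show ?thesis
  proof (rule limit_less_if_loss[OF lim])
    show "\<forall>\<^sub>F n in sequentially. exp (- t) / 2 \<le>
        \<P>(\<omega> in Omega. exp (- t) / 2 * real n \<le> real (card (iso n \<omega>)))"
      using eventually_gt_at_top[of 0]
    proof eventually_elim
      case (elim n)
      have "exp (- t) \<le> \<P>(\<omega> in Omega. exact_arrivals n 0 t (star n v) {} \<omega>)" for v
        using prob_exact_arrivals_ge[OF elim order_refl t finite_star card_star_le, of "{}"] by simp
      then have "exp (- t) / 2 \<le>
          \<P>(\<omega> in Omega. exp (- t) / 2 * real (card {..<n}) \<le> real (card (iso n \<omega>)))"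
        unfolding iso_def using elim
        by (intro Om.prob_card_ge_half) (auto intro: exact_arrivals_measurable)
      then show ?case
        by simp
    qed
  next
    fix \<epsilon> :: real assume "0 < \<epsilon>"
    have "real (C1 n (G_rel n \<omega> t 1)) + real (card (iso n \<omega>)) \<le> (1 + \<epsilon>) * real n + 1"
      if reg: "regular \<omega>" and n: "0 < n" for n \<omega>
    proof -
      obtain m where "m < n" "card (component n (G_rel n \<omega> t 1) m) = C1 n (G_rel n \<omega> t 1)"
        using C1_attained[OF n] .
      moreover have "G_rel n \<omega> t 1 `` {v} = {}" if "v \<in> iso n \<omega>" for v
        using that exact_arrivals_isolated[OF reg, of v n "{}" 1 0 t] by (simp add: iso_def)
      ultimately have "C1 n (G_rel n \<omega> t 1) + card (iso n \<omega>) \<le> card {..<n} + 1"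
        by (intro C1_add_isolated_le[OF sym_G_rel _ _ component_subset]) (auto simp: iso_def)
      then have "real (C1 n (G_rel n \<omega> t 1)) + real (card (iso n \<omega>)) \<le> real n + 1"
        by simp
      moreover have "0 \<le> \<epsilon> * real n"
        using \<open>0 < \<epsilon>\<close> by simp
      ultimately show ?thesis
        by (simp add: distrib_right)
    qed
    then show "whp (\<lambda>n \<omega>. real (C1 n (G_rel n \<omega> t 1)) + real (card (iso n \<omega>)) \<le>
        (1 + \<epsilon>) * real n + 1)"
      by (intro whpI)
  qed simp
qed

lemma giant_limit_strict_antimono_level:
  assumes st: "0 \<le> s" "s < t" and k: "1 \<le> k"
    and lim: "giant_limit k s z" "giant_limit k t x" "giant_limit (Suc k) t y" and z: "0 < z"
    and unique: "\<And>d. 0 < d \<Longrightarrow> whp (\<lambda>n \<omega>. unique_large_component n (d * real n) (G_rel n \<omega> t k))"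
  shows "y < x"
proof (rule ccontr)
  assume "\<not> y < x"
  then have y: "z \<le> y"
    using giant_limit_mono_time[OF lim(1,2)] st by simp
  define d where "d = z / 2"
  have d: "0 < d" "d < z"
    using z by (simp_all add: d_def)
  obtain \<beta> where \<beta>: "0 < \<beta>" and many: "\<forall>\<^sub>F n in sequentially. \<beta> \<le> \<P>(\<omega> in Omega.
      \<beta> * real n \<le> real (card (attached_vertices n (d * real n) s t k \<omega>)))"
    using prob_many_attached_to_giant[OF st k d lim(1)] .
  have "y < x"
  proof (rule limit_less_if_loss[OF lim(3) \<beta> many])
    fix \<epsilon> :: real assume \<epsilon>: "0 < \<epsilon>"
    from whp_conj[OF unique[OF d(1)]
        whp_conj[OF giant_limitD[OF lim(2) \<epsilon>] giant_limitD[OF lim(3) d(1)]]]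
    show "whp (\<lambda>n \<omega>. real (C1 n (G_rel n \<omega> t (Suc k))) +
        real (card (attached_vertices n (d * real n) s t k \<omega>)) \<le> (x + \<epsilon>) * real n + 1)"
    proof (rule whp_mono, elim conjE)
      fix n \<omega>
      assume n: "0 < n" and reg: "regular \<omega>"
        and unique: "unique_large_component n (d * real n) (G_rel n \<omega> t k)"
        and giant: "real (C1 n (G_rel n \<omega> t k)) \<le> (x + \<epsilon>) * real n"
          "(y - d) * real n \<le> real (C1 n (G_rel n \<omega> t (Suc k)))"
      have "d * real n \<le> (y - d) * real n"
        using y by (intro mult_right_mono) (simp_all add: d_def)
      then have "C1 n (G_rel n \<omega> t (Suc k)) + card (attached_vertices n (d * real n) s t k \<omega>) \<le>
          C1 n (G_rel n \<omega> t k) + 1"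
        using giant st by (intro C1_Suc_add_attached_le[OF reg n _ _ k unique]) auto
      then show "real (C1 n (G_rel n \<omega> t (Suc k))) +
          real (card (attached_vertices n (d * real n) s t k \<omega>)) \<le> (x + \<epsilon>) * real n + 1"
        using giant(1) by linarith
    qed
  qed
  then show False
    using \<open>\<not> y < x\<close> by simp
qed

lemma limit_strict_antimono_level:
  assumes f: "conv_unif_prob k f" and g: "conv_unif_prob (Suc k) g"
    and cont: "continuous_on {0..} f"
    and k: "1 \<le> k" and st: "0 \<le> s" "s < t" and pos: "0 < f s"
  shows "g t < f t"
proof (rule giant_limit_strict_antimono_level[OF st k _ _ _ pos])
  show "giant_limit k s (f s)" "giant_limit k t (f t)" "giant_limit (Suc k) t (g t)"
    using f g st by (auto intro: conv_unif_prob_imp_giant_limit)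
  fix d :: real assume d: "0 < d"
  then obtain e where e: "0 < e" "\<And>r. 0 \<le> r \<Longrightarrow> dist r t < e \<Longrightarrow> dist (f r) (f t) < d"
    using cont st unfolding continuous_on_iff by (metis atLeast_iff less_imp_le order_trans)
  define r where "r = t + e / 2"
  have r: "t < r" "f r < f t + d"
    using e(1) e(2)[of r] st by (auto simp: r_def dist_real_def abs_less_iff)
  show "whp (\<lambda>n \<omega>. unique_large_component n (d * real n) (G_rel n \<omega> t k))"
    using st r d by (intro whp_unique_large_component[OF _ r(1) k _ _ _ r(2)])
      (auto intro: conv_unif_prob_imp_giant_limit[OF f])
qed

lemma threshold_ge_add_1:
  assumes a: "0 \<le> a" "a = 0 \<or> 1 \<le> k \<and> giant_limit k a 0"
    and g: "conv_unif_prob (Suc k) g" "\<And>t. b < t \<Longrightarrow> 0 < g t"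
  shows "a + 1 \<le> b"
proof (rule ccontr)
  assume "\<not> a + 1 \<le> b"
  then obtain t where t: "max a b < t" "t < a + 1"
    using dense[of "max a b" "a + 1"] by auto
  then have "giant_limit (Suc k) t (g t)"
    using a by (intro conv_unif_prob_imp_giant_limit[OF g(1)]) simp
  then have "g t \<le> 0"
    using subcritical_limit_le_0[OF a(1) _ t(2) a(2)] t(1) by simp
  then show False
    using g(2)[of t] t(1) by simp
qed

theorem theorem2p3:
  fixes \<rho> :: "nat \<Rightarrow> real \<Rightarrow> real" and \<sigma> :: "nat \<Rightarrow> real"
  assumes rho0: "\<And>t. \<rho> 0 t = 1"
    and sigma0: "\<sigma> 0 = 0"
    and rho_conv: "\<And>k. 1 \<le> k \<Longrightarrow> conv_unif_prob k (\<rho> k)"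
    and rho_cont: "\<And>k. 1 \<le> k \<Longrightarrow> continuous_on {0..} (\<rho> k)"
    and rho_mono: "\<And>k. 1 \<le> k \<Longrightarrow> mono_on {0..} (\<rho> k)"
    and rho_range: "\<And>k t. 1 \<le> k \<Longrightarrow> 0 \<le> t \<Longrightarrow> 0 \<le> \<rho> k t \<and> \<rho> k t \<le> 1"
    and sigma_pos: "\<And>k. 1 \<le> k \<Longrightarrow> 0 < \<sigma> k"
    and sigma_zero: "\<And>k t. 1 \<le> k \<Longrightarrow> 0 \<le> t \<Longrightarrow> t \<le> \<sigma> k \<Longrightarrow> \<rho> k t = 0"
    and sigma_posr: "\<And>k t. 1 \<le> k \<Longrightarrow> \<sigma> k < t \<Longrightarrow> 0 < \<rho> k t"
  shows "\<forall>k\<ge>1. (\<forall>t\<ge>0. \<rho> k t \<le> \<rho> (k - 1) t \<and> (0 < \<rho> (k - 1) t \<longrightarrow> \<rho> k t < \<rho> (k - 1) t))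
               \<and> \<sigma> (k - 1) + 1 \<le> \<sigma> k"
proof -
  have giant: "giant_limit k t (\<rho> k t)" if "1 \<le> k" "0 \<le> t" for k t
    using conv_unif_prob_imp_giant_limit[OF rho_conv that(2)] that(1) .
  have antimono: "\<rho> (Suc j) t \<le> \<rho> j t" if "0 \<le> t" for j t
    using that rho0 rho_range giant giant_limit_antimono_level[of j t] by (cases "j = 0") auto
  have strict: "\<rho> (Suc j) t < \<rho> j t" if "0 \<le> t" "0 < \<rho> j t" for j t
  proof (cases "j = 0")
    case False
    then have "0 < \<sigma> j" "\<sigma> j < t"
      using sigma_pos sigma_zero[of j t] that by force+
    then obtain s where s: "0 < s" "\<sigma> j < s" "s < t"
      using dense[of "\<sigma> j" t] by force
    show ?thesis
      by (rule limit_strict_antimono_level[OF rho_conv rho_conv rho_cont _ _ s(3) sigma_posr])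
        (use False s in auto)
  qed (use that rho0 first_giant_limit_less_1[OF giant] in simp)
  have "0 \<le> \<sigma> j \<and> (\<sigma> j = 0 \<or> 1 \<le> j \<and> giant_limit j (\<sigma> j) 0)" for j
    using sigma0 sigma_pos[of j] sigma_zero[of j "\<sigma> j"] giant[of j "\<sigma> j"] by (cases "j = 0") auto
  then have threshold: "\<sigma> j + 1 \<le> \<sigma> (Suc j)" for j
    by (intro threshold_ge_add_1[where k = j, OF _ _ rho_conv sigma_posr]) auto
  show ?thesis
    using antimono strict threshold by (metis Suc_diff_1 less_eq_Suc_le One_nat_def)
qed

end
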